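(* Let $X$ be a Kähler manifold, let $\alpha$ be a closed formal $(1,1)$-form $\alpha=\sum_{k\ge1}\hbar^k\omega_k$, and let $\gamma$ be the solution of the Fedosov equation $\nabla\gamma+\frac1\hbar\gamma\star\gamma+R_\nabla=\omega_\hbar$ (where $\omega_\hbar=-\omega+\alpha$) associated to the Fedosov connection $D_{F,\alpha}$. Then the Feynman weight of every connected graph $\mathcal{G}$ with two or more loops vanishes: $$W_{\mathcal{G}}(P,d_{TX}\gamma)=0\qquad\text{whenever } b_1(\mathcal{G})\ge2 .$$ Hence the graph expansion of $\gamma_\infty$ involves only trees and one-loop graphs: $$\gamma_\infty=\sum_{\mathcal{G}\ \text{connected},\ b_1(\mathcal{G})=0,1}\frac{\hbar^{g(\mathcal{G})}}{|\mathrm{Aut}(\mathcal{G})|}W_{\mathcal{G}}(P,d_{TX}\gamma).$$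
   Context: **Kähler conventions.** Summation convention. $\omega=\omega_{\alpha\bar\beta}dz^\alpha\wedge d\bar z^\beta=\sqrt{-1}g_{\alpha\bar\beta}dz^\alpha\wedge d\bar z^\beta$ is the Kähler form, $\omega^{\bar\gamma\alpha}\omega_{\alpha\bar\beta}=\delta^{\bar\gamma}_{\bar\beta}$, $\omega^{\alpha\bar\beta}=-\omega^{\bar\beta\alpha}$; $\dim_{\mathbb C}X=n$. **Weyl bundle.** $\mathcal{W}_X=\widehat{\mathrm{Sym}}(T^*X)[[\hbar]]$ (holomorphic cotangent bundle, local frame $y^i$) and $\mathcal{W}_{X,\mathbb{C}}=\mathcal{W}_X\otimes\widehat{\mathrm{Sym}}(\overline{T^*X})[[\hbar]]$ (further variables $\bar y^j$). $\delta^{1,0}a=dz^i\wedge\partial_{y^i}a$, $\delta=\delta^{1,0}+d\bar z^j\wedge\partial_{\bar y^j}$; $(\delta^{1,0})^{-1}a=\frac{1}{p_1+p_2}y^k\iota_{\partial_{z^k}}a$ if $a$ has form type $(p_1,q_1)$ and degree $p_2$ in the $y$'s (zero if $p_1+p_2=0$). $\nabla=\nabla^{1,0}+\nabla^{0,1}$ is the Levi-Civita connection. Wick product: $a\star b=\sum_k\frac{\hbar^k}{k!}\omega^{i_1\bar j_1}\cdots\omega^{i_k\bar j_k}\partial_{y^{i_1}}\cdots\partial_{y^{i_k}}a\;\partial_{\bar y^{j_1}}\cdots\partial_{\bar y^{j_k}}b$, with form parts wedged. Curvature: $\nabla^2(y^m)=R_{i\bar jk}^mdz^i\wedge d\bar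 z^j\otimes y^k$, $R_{i\bar jk\bar l}=R_{i\bar jk}^mg_{m\bar l}$, $R_\nabla=\sqrt{-1}R_{i\bar jk\bar l}dz^i\wedge d\bar z^j\otimes y^k\bar y^l$. **The solution $\gamma$.** Put $R_2^*=\frac12R_{i\bar jk}^md\bar z^j\otimes(y^iy^k\otimes\partial_{z^m})$, $R_n^*=(\delta^{1,0})^{-1}\nabla^{1,0}R_{n-1}^*$ for $n\ge3$; write $R_n^*=R_{i_1\cdots i_n,\bar l}^jd\bar z^l\otimes(y^{i_1}\cdots y^{i_n}\otimes\partial_{z^j})$ and $I=\sum_{n\ge2}R_{i_1\cdots i_n,\bar l}^j\omega_{j\bar k}d\bar z^l\otimes y^{i_1}\cdots y^{i_n}\bar y^k$. Choose locally a formal function $g$ with $\alpha=\bar\partial\partial g$ and put $J_\alpha=\sum_{k\ge1}((\delta^{1,0})^{-1}\nabla^{1,0})^k(\bar\partial g)\in\mathcal{A}_X^{0,1}(\mathcal{W}_X)$, which is independent of $g$ and globally defined. Then $I_\alpha=I+J_\alpha$ satisfies $\nabla I_\alpha-\delta I_\alpha+\frac1\hbar I_\alpha\star I_\alpha+R_\nabla=\alpha$, $D_{F,\alpha}=\nabla-\delta+\frac1\hbar[I_\alpha,-]_\star$, and $$\gamma=I_\alpha-\omega_{i\bar j}(dz^i\otimes\bar y^j-d\bar z^j\otimes y^i),\qquad D_{F,\alpha}=\nabla+\tfrac1\hbar[\gamma,-]_\star .$$ Write $\gamma=\sum_{i\ge0}\hbar^i\gamma_i$ and let $\gamma_i^{(m)}$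 be the part of $\gamma_i$ of degree $m$ in $(y,\bar y)$. **BV bundle.** $\widehat\Omega_{TX}^{-\bullet}=\widehat{\mathrm{Sym}}(T^*X_{\mathbb C})\otimes\wedge^{-\bullet}(T^*X_{\mathbb C})$, i.e. formal power series in $y^i,\bar y^j$ times polynomials in odd variables $dy^i,d\bar y^j$; $d_{TX}$ is the fiberwise de Rham operator $y\mapsto dy,\ \bar y\mapsto d\bar y$, $\mathcal{A}_X^\bullet$-linear. Products in $\mathcal{A}_X^\bullet\otimes\widehat\Omega_{TX}^{-\bullet}$ are $(a\otimes s)(b\otimes t)=(a\wedge b)\otimes(st)$, so that $d_{TX}\gamma$ commutes with itself and with similar elements. $\mathcal{L}_{\partial_{z^i}},\mathcal{L}_{\partial_{\bar z^j}}$ denote fiberwise Lie derivatives along $\partial/\partial y^i$, $\partial/\partial\bar y^j$ (they differentiate $y,\bar y$ and annihilate $dy,d\bar y$). $\mathrm{Mult}$ is multiplication of tensor factors. **Propagator.** For distinct points $\theta_\alpha,\theta_\beta\in S^1=\mathbb{R}/\mathbb{Z}$, $P(\theta_\alpha,\theta_\beta)=u-\frac12$ where $u\in(0,1)$, $u\equiv\theta_\alpha-\theta_\beta$ mod $1$. On $k$-fold tensors, for $\alpha<\beta$, $$\partial_P^{\alpha\beta}=\left(P(\theta_\alpha,\theta_\beta)+\tfrac12\right)\omega^{i\bar j}\mathcal{L}^{(\alpha)}_{\partial_{z^i}}\mathcal{L}^{(\beta)}_{\partial_{\bar z^j}}-\left(P(\theta_\alpha,\theta_\beta)-\tfrac12\right)\omega^{i\bar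 j}\mathcal{L}^{(\alpha)}_{\partial_{\bar z^j}}\mathcal{L}^{(\beta)}_{\partial_{z^i}},$$ where the superscript indicates the tensor factor acted on, and $\partial_P=\sum_{\alpha<\beta}\partial_P^{\alpha\beta}$. **$\gamma_\infty$.** $\gamma_\infty$ is defined by $$e^{\gamma_\infty/\hbar}=\sum_{k\ge0}\frac{1}{k!\hbar^k}\int_{S^1[k]}d\theta_1\cdots d\theta_k\ \mathrm{Mult}\Big(e^{\hbar\partial_P}\big((d_{TX}\gamma)^{\otimes k}\big)\Big),$$ where $S^1[k]$ is the compactified configuration space of $k$ points on $S^1$ (the integral equals that over $k$-tuples of pairwise distinct points, with $\int d\theta_1\cdots d\theta_k=1$). This is $\mathrm{Mult}\int_{S^1[*]}e^{\hbar\partial_P+D}e^{\otimes\gamma/\hbar}$ with $D=\sum_i d\theta_i\otimes d_{TX}^{(i)}$, written out. **Graphs.** A graph $\mathcal{G}$ has a finite set $V(\mathcal{G})$ of vertices, each with a genus $g(v)\in\mathbb{Z}_{\ge0}$, a finite set of half-edges each attached to a vertex, and an involution on half-edges whose two-element orbits are the internal edges and whose fixed points are the tails. $b_1(\mathcal{G})$ is the first Betti number of the associated space and $g(\mathcal{G})=b_1(\mathcal{G})+\sum_vg(v)$. Sums are over isomorphism classes. **Feynman weight.** Number the vertices $1,\dots,k$. Label the vertex $v$, of valency $m_v$ with $t_v$ tails, by $d_{TX}\gamma_{g(v)}^{(m_v)}$, and set $$W_{\mathcal{G}}(P,d_{TX}\gamma)=\prod_vt_v!\int_{S^1[k]}d\theta_1\cdots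 d\theta_k\ \mathrm{Mult}\Big(\prod_{e}\partial_P^{e}\ \bigotimes_vd_{TX}\gamma_{g(v)}^{(m_v)}\Big),$$ where for an internal edge $e$ joining distinct vertices $\alpha<\beta$, $\partial_P^e=\partial_P^{\alpha\beta}$; the weight is $0$ if some internal edge is a self-loop (the operator $\partial_P$ only joins distinct vertices). *)

theory Defs
  imports
    "HOL-Analysis.Analysis"
    "HOL-Computational_Algebra.Formal_Laurent_Series"
    "HOL-Combinatorics.Permutations"
    "HOL-Library.Multiset"
    "HOL-Library.Function_Algebras"
    "HOL-Library.Groups_Big_Fun"
begin

section \<open>Complex manifolds, Wirtinger derivatives\<close>

text \<open>
  The summand \<open>Inl i\<close> stands for the holomorphic direction \<open>z\<^sup>i\<close> (or \<open>y\<^sup>i\<close>),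
  \<open>Inr j\<close> for the antiholomorphic one. \<open>before\<close> lists the holomorphic generators first; it is only
  used to fix an ordered monomial basis of the exterior algebras.
\<close>

type_synonym 'n cvec = "complex^'n"
type_synonym 'n cmat = "complex^'n^'n"
type_synonym 'n gen = "'n + 'n"

fun before :: "'n::linorder gen \<Rightarrow> 'n gen \<Rightarrow> bool" where
  "before (Inl i) (Inl j) \<longleftrightarrow> i < j"
| "before (Inr i) (Inr j) \<longleftrightarrow> i < j"
| "before (Inl i) (Inr j) \<longleftrightarrow> True"
| "before (Inr i) (Inl j) \<longleftrightarrow> False"

fun wirt :: "'n::finite gen \<Rightarrow> ('n cvec \<Rightarrow> complex) \<Rightarrow> 'n cvec \<Rightarrow> complex" where
  "wirt (Inl i) f z = (frechet_derivative f (at z) (axis i 1)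
      - \<i> * frechet_derivative f (at z) (axis i \<i>)) / 2"
| "wirt (Inr i) f z = (frechet_derivative f (at z) (axis i 1)
      + \<i> * frechet_derivative f (at z) (axis i \<i>)) / 2"

primrec Ck_on :: "nat \<Rightarrow> ('n::finite cvec) set \<Rightarrow> ('n cvec \<Rightarrow> complex) \<Rightarrow> bool" where
  "Ck_on 0 S f \<longleftrightarrow> continuous_on S f"
| "Ck_on (Suc k) S f \<longleftrightarrow> (\<forall>z\<in>S. f differentiable (at z)) \<and>
     (\<forall>v. Ck_on k S (\<lambda>z. frechet_derivative f (at z) v))"

text \<open>Only used for open \<open>S\<close>.\<close>

definition smooth_on :: "('n::finite cvec) set \<Rightarrow> ('n cvec \<Rightarrow> complex) \<Rightarrow> bool" where
  "smooth_on S f \<longleftrightarrow> (\<forall>k. Ck_on k S f)"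

definition holo_map :: "('n::finite cvec) set \<Rightarrow> ('n cvec \<Rightarrow> 'n cvec) \<Rightarrow> bool" where
  "holo_map S f \<longleftrightarrow> (\<forall>z\<in>S. \<exists>f'. (f has_derivative f') (at z) \<and>
     (\<forall>c v. f' (c *s v) = c *s f' v))"

type_synonym ('x, 'n) chart = "'x set \<times> ('x \<Rightarrow> 'n cvec)"

abbreviation chart_image :: "('x, 'n::finite) chart \<Rightarrow> 'n cvec set" where
  "chart_image c \<equiv> snd c ` fst c"

definition transition ::
    "('x, 'n::finite) chart \<Rightarrow> ('x, 'n) chart \<Rightarrow> 'n cvec \<Rightarrow> 'n cvec" where
  "transition c c' = snd c' \<circ> inv_into (fst c) (snd c)"

definition complex_manifold :: "'x topology \<Rightarrow> ('x, 'n::finite) chart set \<Rightarrow> bool" where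
  "complex_manifold X A \<longleftrightarrow>
     Hausdorff_space X \<and> second_countable X \<and>
     (\<Union>c\<in>A. fst c) = topspace X \<and>
     (\<forall>c\<in>A. openin X (fst c) \<and> open (chart_image c) \<and>
        homeomorphic_map (subtopology X (fst c)) (top_of_set (chart_image c)) (snd c)) \<and>
     (\<forall>c\<in>A. \<forall>c'\<in>A. holo_map (snd c ` (fst c \<inter> fst c')) (transition c c'))"

text \<open>
  A smooth \<open>T\<^sup>*X \<otimes> \<bar>T\<^sup>*X\<close>-valued field, given by its component
  matrices \<open>(w\<^bsub>ij\<^esub>)\<close> (second index barred) in all charts. This describes both Hermitian metrics
  and (1,1)-forms.
\<close>

definition tensor11 :: "('x, 'n::finite) chart set \<Rightarrow>
    (('x, 'n) chart \<Rightarrow> 'n cvec \<Rightarrow> 'n cmat) \<Rightarrow> bool" where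
  "tensor11 A w \<longleftrightarrow>
     (\<forall>c\<in>A. \<forall>i j. smooth_on (chart_image c) (\<lambda>z. w c z $ i $ j)) \<and>
     (\<forall>c\<in>A. \<forall>c'\<in>A. \<forall>x\<in>fst c \<inter> fst c'. \<forall>i j.
        w c (snd c x) $ i $ j =
          (\<Sum>k\<in>UNIV. \<Sum>l\<in>UNIV. w c' (snd c' x) $ k $ l
             * wirt (Inl i) (\<lambda>z. transition c c' z $ k) (snd c x)
             * cnj (wirt (Inl j) (\<lambda>z. transition c c' z $ l) (snd c x))))"


section \<open>Fibrewise algebra\<close>

text \<open>
  An element of the fibre of \<open>\<A>\<^sub>X \<otimes> Sym \<otimes> \<and>\<close> (forms on \<open>X\<close>, power series in
  \<open>y\<close> and \<open>\<bar>y\<close>, odd variables \<open>dy\<close> and \<open>d\<bar>y\<close>) is its family of coefficients: the index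
  \<open>(S, M, T)\<close> belongs to the monomial \<open>dz\<^sub>S \<otimes> y\<^sup>M dy\<^sub>T\<close>, the wedge products being taken in the order
  \<open>before\<close>. The coefficients lie in \<open>\<complex>\<close>, or in power or Laurent series in \<open>\<hbar>\<close>.
\<close>

type_synonym 'n idx = "'n gen set \<times> 'n gen multiset \<times> 'n gen set"
type_synonym ('n, 'c) elt = "'n idx \<Rightarrow> 'c"
type_synonym 'n sec = "'n cvec \<Rightarrow> ('n, complex) elt"

text \<open>\<open>e\<^sub>A \<and> e\<^sub>B = wsgn A B \<cdot> e\<^bsub>A \<union> B\<^esub>\<close>.\<close>

definition wsgn :: "'n::linorder gen set \<Rightarrow> 'n gen set \<Rightarrow> 'c::comm_ring_1" where
  "wsgn A B = (if A \<inter> B = {} then (- 1) ^ card {(a, b). a \<in> A \<and> b \<in> B \<and> before b a} else 0)"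

definition mon :: "'n gen set \<Rightarrow> 'n gen multiset \<Rightarrow> 'n gen set \<Rightarrow> ('n, 'c::zero_neq_one) elt" where
  "mon S M T = (\<lambda>m. if m = (S, M, T) then 1 else 0)"

definition elt_mult :: "('n::linorder, 'c::comm_ring_1) elt \<Rightarrow> ('n, 'c) elt \<Rightarrow> ('n, 'c) elt" where
  "elt_mult a b = (\<lambda>(S, M, T). \<Sum>A\<in>Pow S. \<Sum>K\<in>{K. K \<subseteq># M}. \<Sum>B\<in>Pow T.
      wsgn A (S - A) * wsgn B (T - B) * a (A, K, B) * b (S - A, M - K, T - B))"

primrec elt_pow :: "('n::linorder, 'c::comm_ring_1) elt \<Rightarrow> nat \<Rightarrow> ('n, 'c) elt" where
  "elt_pow a 0 = mon {} {#} {}"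
| "elt_pow a (Suc k) = elt_mult a (elt_pow a k)"

definition wedge :: "'n::linorder gen \<Rightarrow> ('n, complex) elt \<Rightarrow> ('n, complex) elt" where
  "wedge A a = (\<lambda>(S, M, T). if A \<in> S then wsgn {A} (S - {A}) * a (S - {A}, M, T) else 0)"

definition contract :: "'n::linorder gen \<Rightarrow> ('n, complex) elt \<Rightarrow> ('n, complex) elt" where
  "contract A a = (\<lambda>(S, M, T). if A \<notin> S then wsgn {A} S * a (insert A S, M, T) else 0)"

definition ymult :: "'n gen \<Rightarrow> ('n, complex) elt \<Rightarrow> ('n, complex) elt" where
  "ymult A a = (\<lambda>(S, M, T). if A \<in># M then a (S, M - {#A#}, T) else 0)"

definition yder :: "'n gen \<Rightarrow> ('n, complex) elt \<Rightarrow> ('n, complex) elt" where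
  "yder A a = (\<lambda>(S, M, T). of_nat (count M A + 1) * a (S, add_mset A M, T))"

text \<open>\<open>d\<^bsub>TX\<^esub>\<close> is linear over the forms on \<open>X\<close>, hence there is no sign from \<open>S\<close>.\<close>

definition dTX :: "('n::linorder, 'c::comm_ring_1) elt \<Rightarrow> ('n, 'c) elt" where
  "dTX a = (\<lambda>(S, M, T). \<Sum>A\<in>T. wsgn {A} (T - {A}) * of_nat (count M A + 1)
      * a (S, add_mset A M, T - {A}))"


section \<open>Differential operators on sections over a chart\<close>

definition sder :: "'n gen \<Rightarrow> 'n::finite sec \<Rightarrow> 'n sec" where
  "sder A a = (\<lambda>z m. wirt A (\<lambda>w. a w m) z)"

definition del :: "'n::{finite,linorder} sec \<Rightarrow> 'n sec" where
  "del a = (\<lambda>z m. \<Sum>i\<in>UNIV. wedge (Inl i) (sder (Inl i) a z) m)"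

definition delbar :: "'n::{finite,linorder} sec \<Rightarrow> 'n sec" where
  "delbar a = (\<lambda>z m. \<Sum>j\<in>UNIV. wedge (Inr j) (sder (Inr j) a z) m)"

definition fun_sec :: "('n::finite cvec \<Rightarrow> complex) \<Rightarrow> 'n sec" where
  "fun_sec f = (\<lambda>z m. f z * mon {} {#} {} m)"

definition form11 :: "('n cvec \<Rightarrow> 'n cmat) \<Rightarrow> 'n::finite sec" where
  "form11 w = (\<lambda>z m. \<Sum>i\<in>UNIV. \<Sum>j\<in>UNIV. w z $ i $ j * mon {Inl i, Inr j} {#} {} m)"

definition closed11 :: "'n cvec set \<Rightarrow>
    ('n cvec \<Rightarrow> 'n::{finite,linorder} cmat) \<Rightarrow> bool" where
  "closed11 S w \<longleftrightarrow> (\<forall>z\<in>S. \<forall>m. del (form11 w) z m + delbar (form11 w) z m = 0)"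

text \<open>The components \<open>\<omega>\<^bsub>ij\<^esub>\<close> of the Kaehler form of the metric \<open>g\<close>.\<close>

definition kform :: "('n::finite cvec \<Rightarrow> 'n cmat) \<Rightarrow> 'n cvec \<Rightarrow> 'n cmat" where
  "kform g z = (\<chi> i j. \<i> * g z $ i $ j)"

definition kaehler_manifold :: "'x topology \<Rightarrow> ('x, 'n::{finite,linorder}) chart set \<Rightarrow>
    (('x, 'n) chart \<Rightarrow> 'n cvec \<Rightarrow> 'n cmat) \<Rightarrow> bool" where
  "kaehler_manifold X A g \<longleftrightarrow> complex_manifold X A \<and> tensor11 A g \<and>
     (\<forall>c\<in>A. \<forall>z\<in>chart_image c.
        (\<forall>i j. g c z $ j $ i = cnj (g c z $ i $ j)) \<and>
        (\<forall>v. v \<noteq> 0 \<longrightarrow> 0 < Re (\<Sum>i\<in>UNIV. \<Sum>j\<in>UNIV. g c z $ i $ j * v $ i * cnj (v $ j)))) \<and>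
     (\<forall>c\<in>A. closed11 (chart_image c) (kform (g c)))"

text \<open>The formal form \<open>\<alpha> = \<Sum>k\<ge>1. \<hbar>\<^sup>k \<omega>\<^sub>k\<close>; \<open>\<alpha> c k\<close> is \<open>\<omega>\<^sub>k\<close> in the chart \<open>c\<close>.\<close>

definition closed_formal_form11 :: "('x, 'n::{finite,linorder}) chart set \<Rightarrow>
    (('x, 'n) chart \<Rightarrow> nat \<Rightarrow> 'n cvec \<Rightarrow> 'n cmat) \<Rightarrow> bool" where
  "closed_formal_form11 A \<alpha> \<longleftrightarrow>
     (\<forall>c\<in>A. \<forall>z\<in>chart_image c. \<alpha> c 0 z = 0) \<and>
     (\<forall>k. tensor11 A (\<lambda>c. \<alpha> c k)) \<and>
     (\<forall>k. \<forall>c\<in>A. closed11 (chart_image c) (\<alpha> c k))"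

text \<open>\<open>\<alpha> = \<bar>\<partial>\<partial>f\<close> on the open set \<open>N\<close>, with \<open>f = \<Sum>k. \<hbar>\<^sup>k f\<^sub>k\<close>.\<close>

definition local_potential :: "(nat \<Rightarrow> 'n cvec \<Rightarrow> 'n::{finite,linorder} cmat) \<Rightarrow> 'n cvec set \<Rightarrow>
    (nat \<Rightarrow> 'n cvec \<Rightarrow> complex) \<Rightarrow> bool" where
  "local_potential \<alpha> N f \<longleftrightarrow> open N \<and>
     (\<forall>k. smooth_on N (f k) \<and>
        (\<forall>z\<in>N. form11 (\<alpha> k) z = delbar (del (fun_sec (f k))) z))"

text \<open>
  The complex bilinear extension of the metric in the frame \<open>\<partial>\<^sub>z, \<partial>\<^bsub>\<bar>z\<^esub>\<close>, and the Christoffel symbols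
  \<open>\<Gamma>\<^sup>C\<^bsub>AB\<^esub> = \<Sum>D. G\<^bsup>CD\<^esup> (\<partial>\<^sub>A G\<^bsub>BD\<^esub> + \<partial>\<^sub>B G\<^bsub>AD\<^esub> - \<partial>\<^sub>D G\<^bsub>AB\<^esub>) / 2\<close> of its Levi-Civita connection; all indices
  range over both types. The normalisation of \<open>G\<close> does not affect \<open>\<Gamma>\<close>.
\<close>

definition cmetric :: "'n::finite cmat \<Rightarrow> 'n gen cmat" where
  "cmetric h = (\<chi> A B. case (A, B) of
       (Inl i, Inr j) \<Rightarrow> h $ i $ j
     | (Inr j, Inl i) \<Rightarrow> h $ i $ j
     | _ \<Rightarrow> 0)"

definition christoffel :: "('n cvec \<Rightarrow> 'n cmat) \<Rightarrow>
    'n::finite gen \<Rightarrow> 'n gen \<Rightarrow> 'n gen \<Rightarrow> 'n cvec \<Rightarrow> complex" where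
  "christoffel g C A B z = (\<Sum>D\<in>UNIV. matrix_inv (cmetric (g z)) $ C $ D *
      (wirt A (\<lambda>w. cmetric (g w) $ B $ D) z + wirt B (\<lambda>w. cmetric (g w) $ A $ D) z
       - wirt D (\<lambda>w. cmetric (g w) $ A $ B) z)) / 2"

text \<open>
  \<open>\<nabla> = dz\<^sup>A \<and> \<nabla>\<^sub>A\<close> on forms with values in the Weyl bundle, with
  \<open>\<nabla>\<^sub>A y\<^sup>C = - \<Gamma>\<^sup>C\<^bsub>AB\<^esub> y\<^sup>B\<close>. In \<open>nabla10_T\<close> the values are moreover in the tangent bundle:
  \<open>s C\<close> is the component along \<open>\<partial>\<^sub>C\<close>, and \<open>\<nabla>\<^sub>A \<partial>\<^sub>B = \<Gamma>\<^sup>C\<^bsub>AB\<^esub> \<partial>\<^sub>C\<close>.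
\<close>

definition cov :: "('n cvec \<Rightarrow> 'n cmat) \<Rightarrow> 'n gen \<Rightarrow> 'n::finite sec \<Rightarrow> 'n sec" where
  "cov g A a = (\<lambda>z m. sder A a z m
      - (\<Sum>B\<in>UNIV. \<Sum>C\<in>UNIV. christoffel g C A B z * ymult B (yder C (a z)) m))"

definition nabla :: "('n cvec \<Rightarrow> 'n cmat) \<Rightarrow> 'n::{finite,linorder} sec \<Rightarrow> 'n sec" where
  "nabla g a = (\<lambda>z m. \<Sum>A\<in>UNIV. wedge A (cov g A a z) m)"

definition nabla10 :: "('n cvec \<Rightarrow> 'n cmat) \<Rightarrow> 'n::{finite,linorder} sec \<Rightarrow> 'n sec" where
  "nabla10 g a = (\<lambda>z m. \<Sum>i\<in>UNIV. wedge (Inl i) (cov g (Inl i) a z) m)"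

definition nabla10_T :: "('n cvec \<Rightarrow> 'n cmat) \<Rightarrow>
    ('n gen \<Rightarrow> 'n::{finite,linorder} sec) \<Rightarrow> 'n gen \<Rightarrow> 'n sec" where
  "nabla10_T g s C = (\<lambda>z m. \<Sum>i\<in>UNIV. wedge (Inl i)
      (\<lambda>m'. cov g (Inl i) (s C) z m' + (\<Sum>B\<in>UNIV. christoffel g C (Inl i) B z * s B z m')) m)"

text \<open>
  \<open>(\<delta>\<^bsup>1,0\<^esup>)\<^sup>-\<^sup>1\<close>: the divisor is \<open>p\<^sub>1 + p\<^sub>2\<close> for the monomial of the argument, and division by
  \<open>0\<close> yields \<open>0\<close>.
\<close>

definition hol_degree :: "'n idx \<Rightarrow> nat" where
  "hol_degree = (\<lambda>(S, M, T). card {i. Inl i \<in> S} + size {#A \<in># M. isl A#})"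

definition delta_inv :: "('n::{finite,linorder}, complex) elt \<Rightarrow> ('n, complex) elt" where
  "delta_inv a = (\<lambda>m. \<Sum>k\<in>UNIV. ymult (Inl k)
      (contract (Inl k) (\<lambda>m'. a m' / of_nat (hol_degree m'))) m)"


section \<open>The solution \<open>\<gamma>\<close>\<close>

text \<open>
  The Fedosov equation \<open>\<nabla>\<gamma> + (1/\<hbar>) \<gamma> \<star> \<gamma> + R\<^sub>\<nabla> = -\<omega> + \<alpha>\<close> alone does not determine its solution; the one
  belonging to the connection \<open>D\<^bsub>F,\<alpha>\<^esub>\<close> is \<open>\<gamma> = I + J\<^sub>\<alpha> - \<omega>\<^bsub>ij\<^esub> (dz\<^sup>i \<otimes> \<bar>y\<^sup>j - d\<bar>z\<^sup>j \<otimes> y\<^sup>i)\<close>, constructed here.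
\<close>

text \<open>\<open>R\<^bsub>ijk\<^esub>\<^sup>m\<close> (\<open>j\<close> barred), the coefficient of \<open>dz\<^sup>i \<and> d\<bar>z\<^sup>j \<otimes> y\<^sup>k\<close> in \<open>\<nabla>\<^sup>2 y\<^sup>m\<close>.\<close>

definition curv :: "('n cvec \<Rightarrow> 'n cmat) \<Rightarrow>
    'n \<Rightarrow> 'n \<Rightarrow> 'n \<Rightarrow> 'n::{finite,linorder} \<Rightarrow> 'n cvec \<Rightarrow> complex" where
  "curv g i j k m z =
     nabla g (nabla g (\<lambda>_. mon {} {#Inl m#} {})) z ({Inl i, Inr j}, {#Inl k#}, {})"

text \<open>\<open>Rstar g r C\<close> is the component of \<open>R\<^sup>*\<^bsub>r+2\<^esub>\<close> along \<open>\<partial>\<^sub>C\<close>.\<close>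

primrec Rstar :: "('n cvec \<Rightarrow> 'n cmat) \<Rightarrow> nat \<Rightarrow>
    'n gen \<Rightarrow> 'n::{finite,linorder} sec" where
  "Rstar g 0 = (\<lambda>C z m. case C of
      Inl l \<Rightarrow> \<Sum>i\<in>UNIV. \<Sum>j\<in>UNIV. \<Sum>k\<in>UNIV.
        1 / 2 * curv g i j k l z * mon {Inr j} {#Inl i, Inl k#} {} m
    | Inr _ \<Rightarrow> 0)"
| "Rstar g (Suc r) = (\<lambda>C z. delta_inv (nabla10_T g (Rstar g r) C z))"

text \<open>
  In \<open>I\<close> the vector \<open>\<partial>\<^bsub>z\<^sup>j\<^esub>\<close> is replaced by \<open>\<omega>\<^bsub>jk\<^esub> \<bar>y\<^sup>k\<close>. The infinite sums here and in \<open>J\<^sub>\<alpha>\<close> are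
  locally finite: each coefficient receives finitely many nonzero contributions.
\<close>

definition I_sec :: "('n cvec \<Rightarrow> 'n cmat) \<Rightarrow> 'n::{finite,linorder} sec" where
  "I_sec g = (\<lambda>z m. Sum_any (\<lambda>r. \<Sum>j\<in>UNIV. \<Sum>k\<in>UNIV.
      kform g z $ j $ k * ymult (Inr k) (Rstar g r (Inl j) z) m))"

text \<open>
  The sum defining \<open>J\<^sub>\<alpha>\<close> for one \<open>\<hbar>\<close>-coefficient \<open>f\<close> of the potential; all operators
  involved are \<open>\<hbar>\<close>-linear.
\<close>

definition J_sec :: "('n cvec \<Rightarrow> 'n cmat) \<Rightarrow> ('n cvec \<Rightarrow> complex) \<Rightarrow>
    'n::{finite,linorder} sec" where
  "J_sec g f = (\<lambda>z m. Sum_any (\<lambda>k.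
      (((\<lambda>a w. delta_inv (nabla10 g a w)) ^^ Suc k) (delbar (fun_sec f))) z m))"

definition gamma_coeff :: "('n cvec \<Rightarrow> 'n cmat) \<Rightarrow> (nat \<Rightarrow> 'n cvec \<Rightarrow> complex) \<Rightarrow>
    nat \<Rightarrow> 'n::{finite,linorder} sec" where
  "gamma_coeff g f i = (\<lambda>z m. J_sec g (f i) z m +
     (if i = 0 then I_sec g z m
        - (\<Sum>a\<in>UNIV. \<Sum>b\<in>UNIV. kform g z $ a $ b *
             (mon {Inl a} {#Inr b#} {} m - mon {Inr b} {#Inl a#} {} m))
      else 0))"

text \<open>The value of \<open>\<gamma> = \<Sum>i. \<hbar>\<^sup>i \<gamma>\<^sub>i\<close> at a point.\<close>

definition gamma :: "('n cvec \<Rightarrow> 'n cmat) \<Rightarrow> (nat \<Rightarrow> 'n cvec \<Rightarrow> complex) \<Rightarrow>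
    'n cvec \<Rightarrow> ('n::{finite,linorder}, complex fps) elt" where
  "gamma g f z = (\<lambda>m. Abs_fps (\<lambda>i. gamma_coeff g f i z m))"

definition gamma_part :: "('n, complex fps) elt \<Rightarrow> nat \<Rightarrow> nat \<Rightarrow> ('n, complex) elt" where
  "gamma_part \<gamma> i d = (\<lambda>(S, M, T). if size M = d then fps_nth (\<gamma> (S, M, T)) i else 0)"


section \<open>Tensor powers and the propagator\<close>

text \<open>
  Tensors over the forms on \<open>X\<close>: the index \<open>(S, [(M\<^sub>1,T\<^sub>1), \<dots>, (M\<^sub>k,T\<^sub>k)])\<close> belongs to
  \<open>dz\<^sub>S \<otimes> (y\<^bsup>M\<^sub>1\<^esup> dy\<^bsub>T\<^sub>1\<^esub> \<otimes> \<dots> \<otimes> y\<^bsup>M\<^sub>k\<^esup> dy\<^bsub>T\<^sub>k\<^esub>)\<close>. As for products, forms are moved to the left without sign.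
\<close>

type_synonym ('n, 'c) tens = "'n gen set \<times> ('n gen multiset \<times> 'n gen set) list \<Rightarrow> 'c"

fun tensor :: "('n::linorder, 'c::comm_ring_1) elt list \<Rightarrow> ('n, 'c) tens" where
  "tensor [] (S, []) = (if S = {} then 1 else 0)"
| "tensor (x # xs) (S, p # ps) =
     (\<Sum>A\<in>Pow S. wsgn A (S - A) * x (A, fst p, snd p) * tensor xs (S - A, ps))"
| "tensor _ _ = 0"

fun odd_sign :: "'n::linorder gen set list \<Rightarrow> 'c::comm_ring_1" where
  "odd_sign [] = 1"
| "odd_sign (T # Ts) = wsgn T (\<Union>(set Ts)) * odd_sign Ts"

definition Mult :: "nat \<Rightarrow> ('n::linorder, 'c::comm_ring_1) tens \<Rightarrow> ('n, 'c) elt" where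
  "Mult k t = (\<lambda>(S, M, T).
     \<Sum>ps\<in>{ps. length ps = k \<and> sum_list (map fst ps) = M \<and> \<Union>(snd ` set ps) = T}.
       odd_sign (map snd ps) * t (S, ps))"

definition lie :: "nat \<Rightarrow> 'n gen \<Rightarrow> ('n, complex) tens \<Rightarrow> ('n, complex) tens" where
  "lie \<alpha> A t = (\<lambda>(S, ps). if \<alpha> < length ps
     then of_nat (count (fst (ps ! \<alpha>)) A + 1)
       * t (S, ps[\<alpha> := (add_mset A (fst (ps ! \<alpha>)), snd (ps ! \<alpha>))])
     else 0)"

text \<open>Points of \<open>S\<^sup>1 = \<real>/\<int>\<close> are represented in \<open>[0,1)\<close>.\<close>

definition propagator :: "real \<Rightarrow> real \<Rightarrow> real" where
  "propagator s t = frac (s - t) - 1 / 2"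

text \<open>
  \<open>\<omega>\<^bsup>ij\<^esup>\<close> (\<open>j\<close> barred) is minus the \<open>(j,i)\<close> entry of the inverse matrix of \<open>(\<omega>\<^bsub>ij\<^esub>)\<close>, by
  \<open>\<omega>\<^bsup>\<bar>\<gamma>\<alpha>\<^esup> \<omega>\<^bsub>\<alpha>\<bar>\<beta>\<^esub> = \<delta>\<close> and \<open>\<omega>\<^bsup>\<alpha>\<bar>\<beta>\<^esup> = - \<omega>\<^bsup>\<bar>\<beta>\<alpha>\<^esup>\<close>.
\<close>

definition omega_up :: "'n cmat \<Rightarrow> 'n \<Rightarrow> 'n::finite \<Rightarrow> complex" where
  "omega_up w i j = - (matrix_inv w $ j $ i)"

definition dP_pair :: "'n cmat \<Rightarrow> (nat \<Rightarrow> real) \<Rightarrow> nat \<Rightarrow> nat \<Rightarrow>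
    ('n::finite, complex) tens \<Rightarrow> ('n, complex) tens" where
  "dP_pair w \<theta> \<alpha> \<beta> t = (\<lambda>q. \<Sum>i\<in>UNIV. \<Sum>j\<in>UNIV.
      of_real (propagator (\<theta> \<alpha>) (\<theta> \<beta>) + 1 / 2) * omega_up w i j
        * lie \<alpha> (Inl i) (lie \<beta> (Inr j) t) q
    - of_real (propagator (\<theta> \<alpha>) (\<theta> \<beta>) - 1 / 2) * omega_up w i j
        * lie \<alpha> (Inr j) (lie \<beta> (Inl i) t) q)"

definition dP :: "'n cmat \<Rightarrow> nat \<Rightarrow> (nat \<Rightarrow> real) \<Rightarrow>
    ('n::finite, complex) tens \<Rightarrow> ('n, complex) tens" where
  "dP w k \<theta> t = (\<lambda>q. \<Sum>\<beta><k. \<Sum>\<alpha><\<beta>. dP_pair w \<theta> \<alpha> \<beta> t q)"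

text \<open>\<open>e\<^bsup>\<hbar>\<partial>\<^sub>P\<^esup>\<close>: the coefficient of \<open>\<hbar>\<^sup>N\<close> of \<open>\<Sum>l. \<hbar>\<^sup>l/l! \<partial>\<^sub>P\<^sup>l t\<close>.\<close>

definition exp_dP :: "'n cmat \<Rightarrow> nat \<Rightarrow> (nat \<Rightarrow> real) \<Rightarrow>
    ('n::finite, complex fps) tens \<Rightarrow> ('n, complex fps) tens" where
  "exp_dP w k \<theta> t = (\<lambda>q. Abs_fps (\<lambda>N. \<Sum>l\<le>N.
      1 / fact l * ((dP w k \<theta> ^^ l) (\<lambda>q'. fps_nth (t q') (N - l))) q))"

definition config_integral :: "nat \<Rightarrow> ((nat \<Rightarrow> real) \<Rightarrow> complex) \<Rightarrow> complex" where
  "config_integral k F =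
     set_lebesgue_integral (PiM {..<k} (\<lambda>_. restrict_space lborel {0..<1}))
       {\<theta>. inj_on \<theta> {..<k}} F"


section \<open>\<open>\<gamma>\<^sub>\<infinity>\<close>\<close>

text \<open>
  The sum over \<open>k\<close> is finite in each coefficient, since \<open>\<gamma>\<close> is a 1-form on \<open>X\<close>.
\<close>

definition exp_gamma_infinity :: "'n cmat \<Rightarrow> ('n::{finite,linorder}, complex fps) elt \<Rightarrow>
    ('n, complex fls) elt" where
  "exp_gamma_infinity w \<gamma> = (\<lambda>m. Sum_any (\<lambda>k.
     fls_const (1 / fact k) * fls_X_inv ^ k *
     fps_to_fls (Abs_fps (\<lambda>N. config_integral k (\<lambda>\<theta>.
       fps_nth (Mult k (exp_dP w k \<theta> (tensor (replicate k (dTX \<gamma>)))) m) N)))))"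

text \<open>Used for \<open>x\<close> of positive form degree, where \<open>x\<close> is nilpotent.\<close>

definition elt_exp :: "('n::linorder, complex fls) elt \<Rightarrow> ('n, complex fls) elt" where
  "elt_exp x = (\<lambda>m. Sum_any (\<lambda>l. fls_const (1 / fact l) * elt_pow x l m))"

text \<open>
  The right-hand side of the definition of \<open>\<gamma>\<^sub>\<infinity>\<close> is \<open>1\<close> plus terms of positive form degree on \<open>X\<close>, and
  \<open>\<gamma>\<^sub>\<infinity>\<close> is its logarithm of positive form degree.
\<close>

definition gamma_infinity :: "'n cmat \<Rightarrow> ('n::{finite,linorder}, complex fps) elt \<Rightarrow>
    ('n, complex fls) elt" where
  "gamma_infinity w \<gamma> = (THE x. (\<forall>M T. x ({}, M, T) = 0) \<and>
     elt_exp (\<lambda>m. fls_X_inv * x m) = exp_gamma_infinity w \<gamma>)"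


section \<open>Graphs and Feynman weights\<close>

record ('v, 'h) graph =
  gverts :: "'v set"
  ggenus :: "'v \<Rightarrow> nat"
  ghalfs :: "'h set"
  gattach :: "'h \<Rightarrow> 'v"
  gflip :: "'h \<Rightarrow> 'h"

definition is_graph :: "('v, 'h) graph \<Rightarrow> bool" where
  "is_graph G \<longleftrightarrow> finite (gverts G) \<and> finite (ghalfs G) \<and>
     (\<forall>h\<in>ghalfs G. gattach G h \<in> gverts G \<and> gflip G h \<in> ghalfs G \<and> gflip G (gflip G h) = h)"

definition internal_edges :: "('v, 'h) graph \<Rightarrow> 'h set set" where
  "internal_edges G = {{h, gflip G h} | h. h \<in> ghalfs G \<and> gflip G h \<noteq> h}"

definition valency :: "('v, 'h) graph \<Rightarrow> 'v \<Rightarrow> nat" where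
  "valency G v = card {h \<in> ghalfs G. gattach G h = v}"

definition num_tails :: "('v, 'h) graph \<Rightarrow> 'v \<Rightarrow> nat" where
  "num_tails G v = card {h \<in> ghalfs G. gattach G h = v \<and> gflip G h = h}"

definition connected_graph :: "('v, 'h) graph \<Rightarrow> bool" where
  "connected_graph G \<longleftrightarrow> gverts G \<noteq> {} \<and>
     (\<forall>u\<in>gverts G. \<forall>v\<in>gverts G.
        (u, v) \<in> {(gattach G h, gattach G (gflip G h)) | h. h \<in> ghalfs G}\<^sup>*)"

text \<open>
  The first homology with real coefficients of the associated 1-dimensional cell complex: a 1-chain
  is an antisymmetric function on half-edges (the coefficient of an edge oriented away from the
  vertex of that half-edge; antisymmetry makes it vanish on the contractible tails), and it is a
  cycle if its boundary vanishes at every vertex.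
\<close>

definition cycle_space :: "('v, 'h) graph \<Rightarrow> ('h \<Rightarrow> real) set" where
  "cycle_space G = {c. (\<forall>h. h \<notin> ghalfs G \<longrightarrow> c h = 0) \<and>
     (\<forall>h\<in>ghalfs G. c (gflip G h) = - c h) \<and>
     (\<forall>v\<in>gverts G. (\<Sum>h\<in>{h \<in> ghalfs G. gattach G h = v}. c h) = 0)}"

definition betti1 :: "('v, 'h) graph \<Rightarrow> nat" where
  "betti1 G = vector_space.dim (\<lambda>(r::real) c h. r * c h) (cycle_space G)"

definition graph_genus :: "('v, 'h) graph \<Rightarrow> nat" where
  "graph_genus G = betti1 G + (\<Sum>v\<in>gverts G. ggenus G v)"

definition is_graph_iso :: "('v, 'h) graph \<Rightarrow> ('w, 'k) graph \<Rightarrow> ('v \<Rightarrow> 'w) \<Rightarrow> ('h \<Rightarrow> 'k) \<Rightarrow> bool" where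
  "is_graph_iso G H f \<phi> \<longleftrightarrow>
     bij_betw f (gverts G) (gverts H) \<and> bij_betw \<phi> (ghalfs G) (ghalfs H) \<and>
     (\<forall>v\<in>gverts G. ggenus H (f v) = ggenus G v) \<and>
     (\<forall>h\<in>ghalfs G. gattach H (\<phi> h) = f (gattach G h) \<and> gflip H (\<phi> h) = \<phi> (gflip G h))"

text \<open>\<open>permutes\<close> makes the automorphisms the identity outside the graph, so that they can be counted.\<close>

definition num_aut :: "('v, 'h) graph \<Rightarrow> nat" where
  "num_aut G = card {(f, \<phi>). f permutes gverts G \<and> \<phi> permutes ghalfs G \<and> is_graph_iso G G f \<phi>}"

definition isoclass_representatives :: "('v, 'h) graph set \<Rightarrow> ('v, 'h) graph set \<Rightarrow> bool" where
  "isoclass_representatives C R \<longleftrightarrow> R \<subseteq> C \<and>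
     (\<forall>G\<in>C. \<exists>!H. H \<in> R \<and> (\<exists>f \<phi>. is_graph_iso G H f \<phi>))"

text \<open>Vertices are numbered from \<open>0\<close>.\<close>

definition numbering :: "('v, 'h) graph \<Rightarrow> ('v \<Rightarrow> nat) \<Rightarrow> bool" where
  "numbering G num \<longleftrightarrow> bij_betw num (gverts G) {..<card (gverts G)}"

definition edge_dP :: "'n cmat \<Rightarrow> (nat \<Rightarrow> real) \<Rightarrow> ('v, 'h) graph \<Rightarrow> ('v \<Rightarrow> nat) \<Rightarrow> 'h set \<Rightarrow>
    ('n::finite, complex) tens \<Rightarrow> ('n, complex) tens" where
  "edge_dP w \<theta> G num e =
     dP_pair w \<theta> (Min ((num \<circ> gattach G) ` e)) (Max ((num \<circ> gattach G) ` e))"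

text \<open>The operators of the edges commute, so that \<open>Finite_Set.fold\<close> forms their product.\<close>

definition feynman_weight :: "'n cmat \<Rightarrow> ('n::{finite,linorder}, complex fps) elt \<Rightarrow>
    ('v, 'h) graph \<Rightarrow> ('v \<Rightarrow> nat) \<Rightarrow> ('n, complex) elt" where
  "feynman_weight w \<gamma> G num = (\<lambda>m.
     if \<exists>h\<in>ghalfs G. gflip G h \<noteq> h \<and> gattach G (gflip G h) = gattach G h then 0
     else (\<Prod>v\<in>gverts G. fact (num_tails G v)) *
       config_integral (card (gverts G)) (\<lambda>\<theta>.
         Mult (card (gverts G))
           (Finite_Set.fold (edge_dP w \<theta> G num)
              (tensor (map (\<lambda>\<alpha>. let v = inv_into (gverts G) num \<alpha> in
                   dTX (gamma_part \<gamma> (ggenus G v) (valency G v))) [0..<card (gverts G)]))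
              (internal_edges G)) m))"

end

(*
  Since the Kaehler form is closed, the Christoffel symbols of mixed type vanish, and every monomial of gamma
  is a 1-form on the base containing at most one barred variable y or dy. Each propagator edge differentiates
  one barred variable away, so the weight of a graph with more edges than vertices is 0; for connected graphs
  this is the condition b_1 >= 2.

  The coefficients of the integrand are even, and the even elements form a commutative ring. There the sum over
  k vertices and l edges in the definition of exp(gamma_infinity / hbar) is a sum of weights of lists of edges,
  and these weights are multiplicative over connected components. Splitting off the component of one vertex gives
  Z_{n+1} = sum_d binom(n, d) C_{d+1} Z_{n-d}, where Z_n and C_n are the sums over all and over connected edge
  lists on n vertices. Hence both exp(sum_n C_n / (n! hbar^n)) and sum_n Z_n / (n! hbar^n) solve the equation
  E u = (E c) u, where c = sum_n C_n / (n! hbar^n) and E is the Euler derivation for the form degree, and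
  gamma_infinity = hbar c. Finally, a connected graph with k vertices, l internal edges and t tails has
  k! l! 2^l t! numberings of its vertices, oriented edges and tails, and |Aut| of them yield the same lists of
  numbers; this turns sums over lists into sums over isomorphism classes weighted by 1 / |Aut|.
*)
theory Submission
  imports Defs "HOL-Probability.Infinite_Product_Measure" "HOL-Combinatorics.Multiset_Permutations"
begin

section \<open>The even part of the fibrewise algebra\<close>

text \<open>Signs come separately from the forms and from the odd variables, with none between the
  two kinds. Elements whose monomials have an even total number of both commute, and
  \<open>dTX\<close> of gamma has one of each. Renaming vertices and splitting off components rely
  on such order-free products.

  The propagator is written for ordered indices, whereas edges of graphs are unoriented. At distinct
  points it is symmetric under exchanging both ends, so its powers are sums over lists of ordered
  pairs with a factor 1/2 for each edge: the origin of 2^l. Coinciding points form a null set, and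
  loops get coefficient 0.

  Every vertex is a 1-form, so the index n of C_n and Z_n is the form degree. Hence n! and hbar^n
  can be read off from a monomial, and the Euler derivation, invertible in positive degree, can
  decide the equality of the two series.

  A Feynman weight fixes valencies, while a vertex of the exponential carries all of gamma. The
  number of tails is recovered from the monomial: it counts the variables y and dy that are left
  after the edges have acted.\<close>

lemma wsgn_Un_left:
  fixes A B C :: "'n::{finite,linorder} gen set"
  assumes "A \<inter> B = {}"
  shows "wsgn (A \<union> B) C = (wsgn A C * wsgn B C :: 'c::comm_ring_1)"
proof (cases "(A \<union> B) \<inter> C = {}")
  case True
  have "{(a, b). a \<in> A \<union> B \<and> b \<in> C \<and> before b a}
      = {(a, b). a \<in> A \<and> b \<in> C \<and> before b a} \<union> {(a, b). a \<in> B \<and> b \<in> C \<and> before b a}"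
    by auto
  moreover have "{(a, b). a \<in> A \<and> b \<in> C \<and> before b a} \<inter> {(a, b). a \<in> B \<and> b \<in> C \<and> before b a} = {}"
    using assms by auto
  ultimately have "card {(a, b). a \<in> A \<union> B \<and> b \<in> C \<and> before b a}
      = card {(a, b). a \<in> A \<and> b \<in> C \<and> before b a} + card {(a, b). a \<in> B \<and> b \<in> C \<and> before b a}"
    by (simp add: card_Un_disjoint)
  then show ?thesis using True
    by (auto simp: wsgn_def power_add Int_Un_distrib2)
next
  case False
  then show ?thesis by (auto simp: wsgn_def Int_Un_distrib2)
qed

text \<open>For disjoint sets every pair in \<open>A\<close> \<times> \<open>B\<close> is an
  inversion for exactly one of the two orders, so the two exponents add up to
  \<open>card A * card B\<close>. Sets that meet give 0 on both sides.\<close>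

lemma wsgn_commute:
  fixes A B :: "'n::{finite,linorder} gen set"
  shows "wsgn A B = ((- 1) ^ (card A * card B) * wsgn B A :: 'c::comm_ring_1)"
proof (cases "A \<inter> B = {}")
  case True
  let ?P = "{(a, b). a \<in> A \<and> b \<in> B \<and> before b a}"
  let ?Q = "{(a, b). a \<in> B \<and> b \<in> A \<and> before b a}"
  have tot: "before a b \<or> before b a" if "a \<noteq> b" for a b :: "'n gen"
    using that by (cases a; cases b) auto
  have asym: "\<not> (before a b \<and> before b a)" for a b :: "'n gen"
    by (cases a; cases b) auto
  have un: "A \<times> B = ?P \<union> prod.swap ` ?Q"
    using True by (auto simp: image_iff) (metis disjoint_iff tot)
  have "?P \<inter> prod.swap ` ?Q = {}" using asym by auto
  then have "card (A \<times> B) = card ?P + card (prod.swap ` ?Q)"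
    unfolding un by (intro card_Un_disjoint) auto
  then have "card A * card B = card ?P + card (prod.swap ` ?Q)" by (simp add: card_cartesian_product)
  also have "card (prod.swap ` ?Q) = card ?Q" by (rule card_image) (auto simp: inj_on_def)
  finally have e: "card A * card B = card ?P + card ?Q" .
  have sq: "(- 1 :: 'c) ^ k * (- 1) ^ k = 1" for k by (simp add: power_mult_distrib[symmetric])
  have "(- 1 :: 'c) ^ (card A * card B) * (- 1) ^ card ?Q = (- 1) ^ card ?P * ((- 1) ^ card ?Q * (- 1) ^ card ?Q)"
    unfolding e power_add by (rule mult.assoc)
  then have "(- 1 :: 'c) ^ (card A * card B) * (- 1) ^ card ?Q = (- 1) ^ card ?P"
    unfolding sq by simp
  then show ?thesis using True by (simp add: wsgn_def Int_commute)
next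
  case False
  then show ?thesis by (auto simp: wsgn_def Int_commute)
qed

lemma wsgn_Un_right:
  fixes A B C :: "'n::{finite,linorder} gen set"
  assumes "B \<inter> C = {}"
  shows "wsgn A (B \<union> C) = (wsgn A B * wsgn A C :: 'c::comm_ring_1)"
proof -
  have "card (B \<union> C) = card B + card C" using assms by (simp add: card_Un_disjoint)
  then show ?thesis
    unfolding wsgn_commute[of A "B \<union> C"] wsgn_commute[of A B] wsgn_commute[of A C] wsgn_Un_left[OF assms]
    by (simp add: power_add algebra_simps)
qed

lemma wsgn_empty [simp]: "wsgn {} A = 1" "wsgn A {} = 1"
  by (simp_all add: wsgn_def)

definition idx_join :: "'n idx \<Rightarrow> 'n idx \<Rightarrow> 'n idx" where
  "idx_join x y = (fst x \<union> fst y, fst (snd x) + fst (snd y), snd (snd x) \<union> snd (snd y))"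

definition idx_disj :: "'n idx \<Rightarrow> 'n idx \<Rightarrow> bool" where
  "idx_disj x y \<longleftrightarrow> fst x \<inter> fst y = {} \<and> snd (snd x) \<inter> snd (snd y) = {}"

definition idx_sgn :: "'n::{finite,linorder} idx \<Rightarrow> 'n idx \<Rightarrow> 'c::comm_ring_1" where
  "idx_sgn x y = wsgn (fst x) (fst y) * wsgn (snd (snd x)) (snd (snd y))"

text \<open>The factorisations of a basis monomial up to sign. One sum over this set replaces the
  three nested sums of \<open>elt_mult\<close>, so that the ring laws become reindexings.\<close>

definition splits :: "'n idx \<Rightarrow> ('n idx \<times> 'n idx) set" where
  "splits m = {(x, y). idx_join x y = m \<and> idx_disj x y}"

lemma splits_eq_image:
  "splits (S, M, T) = (\<lambda>(A, K, B). ((A, K, B), (S - A, M - K, T - B))) ` (Pow S \<times> {K. K \<subseteq># M} \<times> Pow T)"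
proof (intro set_eqI iffI)
  fix p assume "p \<in> splits (S, M, T)"
  then obtain A K B A' K' B' where p: "p = ((A, K, B), (A', K', B'))"
    and *: "A \<union> A' = S" "K + K' = M" "B \<union> B' = T" "A \<inter> A' = {}" "B \<inter> B' = {}"
    by (auto simp: splits_def idx_join_def idx_disj_def)
  have "A' = S - A" "K' = M - K" "B' = T - B" "A \<subseteq> S" "K \<subseteq># M" "B \<subseteq> T" using * by auto
  then show "p \<in> (\<lambda>(A, K, B). ((A, K, B), (S - A, M - K, T - B))) ` (Pow S \<times> {K. K \<subseteq># M} \<times> Pow T)"
    unfolding p by (auto intro!: image_eqI[of _ _ "(A, K, B)"])
qed (auto simp: splits_def idx_join_def idx_disj_def)

lemma finite_submsets: "finite {K. K \<subseteq># M}"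
proof (induction M)
  case (add x M)
  have "{K. K \<subseteq># add_mset x M} \<subseteq> {K. K \<subseteq># M} \<union> add_mset x ` {K. K \<subseteq># M}"
  proof
    fix K assume K: "K \<in> {K. K \<subseteq># add_mset x M}"
    show "K \<in> {K. K \<subseteq># M} \<union> add_mset x ` {K. K \<subseteq># M}"
    proof (cases "x \<in># K")
      case True
      then obtain L where "K = add_mset x L" by (meson multi_member_split)
      then show ?thesis using K by auto
    next
      case False
      moreover have "count K y \<le> count (add_mset x M) y" for y
        using K by (simp add: subseteq_mset_def)
      ultimately have "count K y \<le> count M y" for y
        by (cases "y = x") (metis le_zero_eq not_in_iff zero_le, metis count_add_mset)
      then have "K \<subseteq># M" by (simp add: subseteq_mset_def)
      then show ?thesis by simp
    qed
  qed
  then show ?case using add by (meson finite_UnI finite_imageI finite_subset)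
qed simp

lemma finite_splits [simp]: "finite (splits (m :: 'n::finite idx))"
  by (cases m) (simp add: splits_eq_image finite_submsets)

lemma elt_mult_splits:
  fixes a b :: "('n::{finite,linorder}, 'c::comm_ring_1) elt"
  shows "elt_mult a b m = (\<Sum>(x, y)\<in>splits m. idx_sgn x y * a x * b y)"
proof -
  obtain S M T where m: "m = (S, M, T)" by (cases m)
  have inj: "inj_on (\<lambda>(A, K, B). ((A, K, B), (S - A, M - K, T - B))) (Pow S \<times> {K. K \<subseteq># M} \<times> Pow T)"
    by (auto simp: inj_on_def)
  show ?thesis
    unfolding m splits_eq_image sum.reindex[OF inj] elt_mult_def
    by (simp add: sum.cartesian_product idx_sgn_def case_prod_unfold)
qed

text \<open>Both sides run over the ordered splittings of \<open>m\<close> into three disjoint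
  parts; the join of two neighbouring parts is recovered from the parts.\<close>

lemma splits_sum_assoc:
  fixes f :: "'n::finite idx \<Rightarrow> 'n idx \<Rightarrow> 'n idx \<Rightarrow> 'a::comm_monoid_add"
  shows "(\<Sum>(p, z)\<in>splits m. \<Sum>(x, y)\<in>splits p. f x y z) = (\<Sum>(x, p)\<in>splits m. \<Sum>(y, z)\<in>splits p. f x y z)"
proof -
  have "(\<Sum>(p, z)\<in>splits m. \<Sum>(x, y)\<in>splits p. f x y z)
      = (\<Sum>(pz, xy)\<in>(SIGMA pz:splits m. splits (fst pz)). f (fst xy) (snd xy) (snd pz))"
    by (simp add: case_prod_unfold sum.Sigma)
  also have "\<dots> = (\<Sum>(xp, yz)\<in>(SIGMA xp:splits m. splits (snd xp)). f (fst xp) (fst yz) (snd yz))"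
    by (rule sum.reindex_bij_witness[of _
          "\<lambda>(xp, yz). ((idx_join (fst xp) (fst yz), snd yz), (fst xp, fst yz))"
          "\<lambda>(pz, xy). ((fst xy, idx_join (snd xy) (snd pz)), (snd xy, snd pz))"])
      (auto simp: splits_def idx_join_def idx_disj_def)
  also have "\<dots> = (\<Sum>(x, p)\<in>splits m. \<Sum>(y, z)\<in>splits p. f x y z)"
    by (simp add: case_prod_unfold sum.Sigma)
  finally show ?thesis .
qed

text \<open>Additivity of inversions turns both sides into the product of the three pairwise signs.
  Associativity of the product amounts to this 2-cocycle identity.\<close>

lemma idx_sgn_cocycle:
  assumes "idx_disj x y" "idx_disj (idx_join x y) z"
  shows "idx_sgn (idx_join x y) z * idx_sgn x y = (idx_sgn x (idx_join y z) * idx_sgn y z :: 'c::comm_ring_1)"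
  using assms unfolding idx_sgn_def idx_join_def idx_disj_def
  by (simp add: wsgn_Un_left wsgn_Un_right Int_Un_distrib2 algebra_simps)

lemma elt_mult_assoc:
  fixes a b c :: "('n::{finite,linorder}, 'c::comm_ring_1) elt"
  shows "elt_mult (elt_mult a b) c = elt_mult a (elt_mult b c)"
proof
  fix m
  have "elt_mult (elt_mult a b) c m = (\<Sum>(p, z)\<in>splits m. \<Sum>(x, y)\<in>splits p. idx_sgn (idx_join x y) z * idx_sgn x y * a x * b y * c z)"
    unfolding elt_mult_splits
  proof (intro sum.cong refl, clarify)
    fix p z :: "'n idx" assume "(p, z) \<in> splits m"
    show "idx_sgn p z * (\<Sum>(x, y)\<in>splits p. idx_sgn x y * a x * b y) * c z
        = (\<Sum>(x, y)\<in>splits p. idx_sgn (idx_join x y) z * idx_sgn x y * a x * b y * c z)"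
      unfolding sum_distrib_left sum_distrib_right
      by (intro sum.cong) (auto simp: splits_def algebra_simps)
  qed
  also have "\<dots> = (\<Sum>(x, p)\<in>splits m. \<Sum>(y, z)\<in>splits p. idx_sgn (idx_join x y) z * idx_sgn x y * a x * b y * c z)"
    by (rule splits_sum_assoc)
  also have "\<dots> = elt_mult a (elt_mult b c) m"
    unfolding elt_mult_splits sum_distrib_left
  proof (intro sum.cong refl, clarify, intro sum.cong refl, clarify)
    fix x p y z :: "'n idx" assume 1: "(x, p) \<in> splits m" and 2: "(y, z) \<in> splits p"
    then have "idx_disj x y" "idx_disj (idx_join x y) z" "p = idx_join y z"
      by (auto simp: splits_def idx_disj_def idx_join_def)
    then show "idx_sgn (idx_join x y) z * idx_sgn x y * a x * b y * c z
        = idx_sgn x p * a x * (idx_sgn y z * b y * c z)"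
      using idx_sgn_cocycle[of x y z, where ?'c = 'c] by (simp add: algebra_simps)
  qed
  finally show "elt_mult (elt_mult a b) c m = elt_mult a (elt_mult b c) m" .
qed

lemma elt_mult_one:
  fixes a :: "('n::{finite,linorder}, 'c::comm_ring_1) elt"
  shows "elt_mult (mon {} {#} {}) a = a" "elt_mult a (mon {} {#} {}) = a"
proof -
  have mem: "(({}, {#}, {}), m) \<in> splits m" "(m, ({}, {#}, {})) \<in> splits m" for m :: "'n idx"
    by (auto simp: splits_def idx_join_def idx_disj_def)
  show "elt_mult (mon {} {#} {}) a = a"
  proof
    fix m
    have "elt_mult (mon {} {#} {}) a m = (\<Sum>p\<in>splits m. if p = (({}, {#}, {}), m) then a m else 0)"
      unfolding elt_mult_splits
    proof (intro sum.cong refl, clarify)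
      fix x y :: "'n idx" assume "(x, y) \<in> splits m"
      then show "idx_sgn x y * mon {} {#} {} x * a y = (if (x, y) = (({}, {#}, {}), m) then a m else 0)"
        by (cases "x = ({}, {#}, {})") (auto simp: mon_def idx_sgn_def splits_def idx_join_def)
    qed
    then show "elt_mult (mon {} {#} {}) a m = a m" using mem by simp
  qed
  show "elt_mult a (mon {} {#} {}) = a"
  proof
    fix m
    have "elt_mult a (mon {} {#} {}) m = (\<Sum>p\<in>splits m. if p = (m, ({}, {#}, {})) then a m else 0)"
      unfolding elt_mult_splits
    proof (intro sum.cong refl, clarify)
      fix x y :: "'n idx" assume "(x, y) \<in> splits m"
      then show "idx_sgn x y * a x * mon {} {#} {} y = (if (x, y) = (m, ({}, {#}, {})) then a m else 0)"
        by (cases "y = ({}, {#}, {})") (auto simp: mon_def idx_sgn_def splits_def idx_join_def)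
    qed
    then show "elt_mult a (mon {} {#} {}) m = a m" using mem by simp
  qed
qed

definition even_elt :: "('n, 'c::zero) elt \<Rightarrow> bool" where
  "even_elt a \<longleftrightarrow> (\<forall>m. odd (card (fst m) + card (snd (snd m))) \<longrightarrow> a m = 0)"

lemma splits_swap: "(x, y) \<in> splits m \<Longrightarrow> (y, x) \<in> splits m"
  by (auto simp: splits_def idx_join_def idx_disj_def)

text \<open>Swapping two monomials costs (-1)^(pp' + qq'), with p, p' the form degrees and q, q' the
  numbers of odd variables. Evenness means that p = q and p' = q' modulo 2, so the exponent is
  even.\<close>

lemma elt_mult_commute:
  fixes a b :: "('n::{finite,linorder}, 'c::comm_ring_1) elt"
  assumes "even_elt a" "even_elt b"
  shows "elt_mult a b = elt_mult b a"
proof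
  fix m
  have "elt_mult a b m = (\<Sum>(y, x)\<in>splits m. idx_sgn x y * a x * b y)"
    unfolding elt_mult_splits
    by (rule sum.reindex_bij_witness[of _ prod.swap prod.swap]) (auto intro: splits_swap)
  also have "\<dots> = elt_mult b a m" unfolding elt_mult_splits
  proof (intro sum.cong refl, clarify)
    fix y x :: "'n idx"
    show "idx_sgn x y * a x * b y = idx_sgn y x * b y * a x"
    proof (cases "a x = 0 \<or> b y = 0")
      case False
      then have "even (card (fst x) + card (snd (snd x)))" "even (card (fst y) + card (snd (snd y)))"
        using assms unfolding even_elt_def by blast+
      then have "even (card (fst x) * card (fst y) + card (snd (snd x)) * card (snd (snd y)))" by auto
      then have "(- 1 :: 'c) ^ (card (fst x) * card (fst y)) * (- 1) ^ (card (snd (snd x)) * card (snd (snd y))) = 1"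
        by (simp flip: power_add)
      moreover have "idx_sgn x y = (- 1) ^ (card (fst x) * card (fst y))
          * (- 1) ^ (card (snd (snd x)) * card (snd (snd y))) * (idx_sgn y x :: 'c)"
        unfolding idx_sgn_def wsgn_commute[of "fst x" "fst y"] wsgn_commute[of "snd (snd x)" "snd (snd y)"]
        by (simp add: mult_ac)
      ultimately have "idx_sgn x y = (idx_sgn y x :: 'c)" by simp
      then show ?thesis by (simp add: mult_ac)
    qed auto
  qed
  finally show "elt_mult a b m = elt_mult b a m" .
qed

lemma even_elt_mult:
  fixes a b :: "('n::{finite,linorder}, 'c::comm_ring_1) elt"
  assumes "even_elt a" "even_elt b"
  shows "even_elt (elt_mult a b)"
  unfolding even_elt_def
proof (intro allI impI)
  fix m :: "'n idx" assume m: "odd (card (fst m) + card (snd (snd m)))"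
  have "idx_sgn x y * a x * b y = 0" if "(x, y) \<in> splits m" for x y
  proof -
    have "card (fst m) = card (fst x) + card (fst y)" "card (snd (snd m)) = card (snd (snd x)) + card (snd (snd y))"
      using that by (auto simp: splits_def idx_join_def idx_disj_def card_Un_disjoint)
    then have "odd (card (fst x) + card (snd (snd x))) \<or> odd (card (fst y) + card (snd (snd y)))"
      using m by auto
    then have "a x = 0 \<or> b y = 0" using assms unfolding even_elt_def by blast
    then show ?thesis by auto
  qed
  then show "elt_mult a b m = 0" unfolding elt_mult_splits by (intro sum.neutral) auto
qed

lemma elt_mult_add:
  fixes a b c :: "('n::{finite,linorder}, 'c::comm_ring_1) elt"
  shows "elt_mult (\<lambda>m. a m + b m) c = (\<lambda>m. elt_mult a c m + elt_mult b c m)"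
    and "elt_mult a (\<lambda>m. b m + c m) = (\<lambda>m. elt_mult a b m + elt_mult a c m)"
  by (auto simp: elt_mult_splits algebra_simps case_prod_unfold sum.distrib)

text \<open>As a type of class \<open>comm_ring_1\<close> the even elements admit products over sets
  of vertices and power series in hbar with such coefficients.\<close>

typedef (overloaded) ('n, 'c) bv = "{a :: ('n::{finite,linorder}, 'c::comm_ring_1) elt. even_elt a}"
  by (rule exI[of _ "\<lambda>_. 0"]) (simp add: even_elt_def)

lemma even_Rep_bv [simp]: "even_elt (Rep_bv a)"
  using Rep_bv by auto

lemma bv_eqI: "(\<And>m. Rep_bv a m = Rep_bv b m) \<Longrightarrow> a = b"
  by (metis Rep_bv_inject ext)

lemma even_elt_mon: "even_elt (\<lambda>m. c * mon {} {#} {} m :: 'c::comm_ring_1)"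
  by (auto simp: even_elt_def mon_def)

instantiation bv :: ("{finite,linorder}", comm_ring_1) comm_ring_1
begin

definition "0 = Abs_bv (\<lambda>_. 0)"
definition "1 = Abs_bv (mon {} {#} {})"
definition "a + b = Abs_bv (\<lambda>m. Rep_bv a m + Rep_bv b m)"
definition "- a = Abs_bv (\<lambda>m. - Rep_bv a m)"
definition "a - b = Abs_bv (\<lambda>m. Rep_bv a m - Rep_bv b m)"
definition "a * b = Abs_bv (elt_mult (Rep_bv a) (Rep_bv b))"

lemma Rep_bv_ops:
  "Rep_bv (0 :: ('a, 'b) bv) = (\<lambda>_. 0)"
  "Rep_bv (1 :: ('a, 'b) bv) = mon {} {#} {}"
  "Rep_bv (a + b) = (\<lambda>m. Rep_bv a m + Rep_bv b m)"
  "Rep_bv (- a) = (\<lambda>m. - Rep_bv a m)"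
  "Rep_bv (a - b) = (\<lambda>m. Rep_bv a m - Rep_bv b m)"
  "Rep_bv (a * b) = elt_mult (Rep_bv a) (Rep_bv b)"
  for a b :: "('a, 'b) bv"
proof -
  have e: "even_elt (Rep_bv a)" "even_elt (Rep_bv b)" by simp_all
  show "Rep_bv (0 :: ('a, 'b) bv) = (\<lambda>_. 0)"
    unfolding zero_bv_def by (rule Abs_bv_inverse) (simp add: even_elt_def)
  show "Rep_bv (1 :: ('a, 'b) bv) = mon {} {#} {}"
    unfolding one_bv_def by (rule Abs_bv_inverse) (auto simp: even_elt_def mon_def)
  show "Rep_bv (a + b) = (\<lambda>m. Rep_bv a m + Rep_bv b m)"
    unfolding plus_bv_def by (rule Abs_bv_inverse) (use e in \<open>auto simp: even_elt_def\<close>)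
  show "Rep_bv (- a) = (\<lambda>m. - Rep_bv a m)"
    unfolding uminus_bv_def by (rule Abs_bv_inverse) (use e in \<open>auto simp: even_elt_def\<close>)
  show "Rep_bv (a - b) = (\<lambda>m. Rep_bv a m - Rep_bv b m)"
    unfolding minus_bv_def by (rule Abs_bv_inverse) (use e in \<open>auto simp: even_elt_def\<close>)
  show "Rep_bv (a * b) = elt_mult (Rep_bv a) (Rep_bv b)"
    unfolding times_bv_def by (rule Abs_bv_inverse) (use even_elt_mult[OF e] in simp)
qed

instance
proof
  fix a b c :: "('a, 'b) bv"
  show "a * b * c = a * (b * c)" by (rule bv_eqI) (simp add: Rep_bv_ops elt_mult_assoc)
  show "a * b = b * a" by (rule bv_eqI) (simp add: Rep_bv_ops elt_mult_commute)
  show "1 * a = a" by (rule bv_eqI) (simp add: Rep_bv_ops elt_mult_one)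
  show "(a + b) * c = a * c + b * c" by (rule bv_eqI) (simp add: Rep_bv_ops elt_mult_add)
  show "(0 :: ('a, 'b) bv) \<noteq> 1"
  proof
    assume "(0 :: ('a, 'b) bv) = 1"
    then have "Rep_bv (0 :: ('a, 'b) bv) ({}, {#}, {}) = Rep_bv (1 :: ('a, 'b) bv) ({}, {#}, {})" by simp
    then show False by (simp add: Rep_bv_ops mon_def)
  qed
qed (rule bv_eqI; simp add: Rep_bv_ops add_ac)+

end

definition cst :: "'c \<Rightarrow> ('n::{finite,linorder}, 'c::comm_ring_1) bv" where
  "cst c = Abs_bv (\<lambda>m. c * mon {} {#} {} m)"

lemma Rep_cst: "Rep_bv (cst c :: ('n::{finite,linorder}, 'c::comm_ring_1) bv) = (\<lambda>m. c * mon {} {#} {} m)"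
  unfolding cst_def by (rule Abs_bv_inverse) (simp add: even_elt_mon)

lemma elt_mult_scale:
  fixes a b :: "('n::{finite,linorder}, 'c::comm_ring_1) elt"
  shows "elt_mult (\<lambda>m. c * a m) b = (\<lambda>m. c * elt_mult a b m)"
  by (auto simp: elt_mult_splits sum_distrib_left case_prod_unfold mult_ac)

lemma Rep_cst_mult: "Rep_bv (cst c * a) m = c * Rep_bv a m"
  for a :: "('n::{finite,linorder}, 'c::comm_ring_1) bv"
  by (simp add: Rep_bv_ops Rep_cst elt_mult_scale elt_mult_one)

lemma cst_simps:
  "cst 0 = (0 :: ('n::{finite,linorder}, 'c::comm_ring_1) bv)"
  "cst 1 = (1 :: ('n::{finite,linorder}, 'c::comm_ring_1) bv)"
  "cst (c + d) = (cst c + cst d :: ('n::{finite,linorder}, 'c::comm_ring_1) bv)"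
  "cst (c * d) = (cst c * cst d :: ('n::{finite,linorder}, 'c::comm_ring_1) bv)"
     apply (rule bv_eqI, simp add: Rep_cst Rep_bv_ops)
    apply (rule bv_eqI, simp add: Rep_cst Rep_bv_ops)
   apply (rule bv_eqI, simp add: Rep_cst Rep_bv_ops algebra_simps)
  apply (rule bv_eqI, simp add: Rep_cst_mult, simp add: Rep_cst)
  done

lemma Rep_bv_sum: "Rep_bv (sum f A) m = (\<Sum>x\<in>A. Rep_bv (f x) m)"
  by (induction A rule: infinite_finite_induct) (auto simp: Rep_bv_ops)


section \<open>Tensor powers\<close>

text \<open>An edge with chosen indices: the vertices at its two ends, followed by the generators
  differentiated there.\<close>

type_synonym 'n ledge = "(nat \<times> nat) \<times> ('n gen \<times> 'n gen)"

lemma yder_commute: "yder A (yder B a) = yder B (yder A a)"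
  by (rule ext) (auto simp: yder_def add_mset_commute)

interpretation yder: comp_fun_commute yder
  by standard (simp add: fun_eq_iff yder_commute)

text \<open>Fibrewise derivatives commute, so a multiset of generators determines the
  operator.\<close>

definition ydrs :: "'n gen multiset \<Rightarrow> ('n, complex) elt \<Rightarrow> ('n, complex) elt" where
  "ydrs L a = fold_mset yder a L"

lemma ydrs_empty [simp]: "ydrs {#} a = a"
  by (simp add: ydrs_def)

lemma ydrs_add_mset: "ydrs (add_mset A L) a = yder A (ydrs L a)"
  by (simp add: ydrs_def)

lemma ydrs_union: "ydrs (L + L') a = ydrs L' (ydrs L a)"
  by (simp add: ydrs_def yder.fold_mset_union)

definition lieop :: "'n ledge \<Rightarrow> ('n, complex) tens \<Rightarrow> ('n, complex) tens" where
  "lieop e t = lie (fst (fst e)) (fst (snd e)) (lie (snd (fst e)) (snd (snd e)) t)"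

text \<open>The derivatives that the labelled half-edges of \<open>q\<close> impose on the vertex \<open>v\<close>.\<close>

definition lab :: "'n ledge list \<Rightarrow> nat \<Rightarrow> 'n gen multiset" where
  "lab q v = sum_list (map (\<lambda>((u, w), (A, B)).
     (if u = v then {#A#} else {#}) + (if w = v then {#B#} else {#})) q)"

lemma lab_Nil [simp]: "lab [] v = {#}" by (simp add: lab_def)

lemma lab_Cons: "lab (e # q) v = lab [e] v + lab q v" by (simp add: lab_def)

lemma lie_tensor:
  "\<alpha> < length xs \<Longrightarrow> lie \<alpha> A (tensor xs) (S, ps) = tensor (xs[\<alpha> := yder A (xs ! \<alpha>)]) (S, ps)"
proof (induction xs arbitrary: \<alpha> S ps)
  case (Cons x xs)
  show ?case
  proof (cases ps)
    case Nil
    then show ?thesis by (cases \<alpha>) (simp_all add: lie_def)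
  next
    case ps: (Cons p ps')
    show ?thesis
    proof (cases \<alpha>)
      case 0
      then show ?thesis unfolding ps
        by (cases p) (simp add: lie_def yder_def sum_distrib_left mult_ac)
    next
      case (Suc \<beta>)
      have "lie \<alpha> A (tensor (x # xs)) (S, ps)
          = (\<Sum>B\<in>Pow S. wsgn B (S - B) * x (B, fst p, snd p) * lie \<beta> A (tensor xs) (S - B, ps'))"
        unfolding ps Suc by (simp add: lie_def sum_distrib_left mult_ac)
      also have "\<dots> = tensor ((x # xs)[\<alpha> := yder A ((x # xs) ! \<alpha>)]) (S, ps)"
        using Cons Suc by (simp add: ps)
      finally show ?thesis .
    qed
  qed
qed simp

lemma lie_tensor': "\<alpha> < length xs \<Longrightarrow> lie \<alpha> A (tensor xs) = tensor (xs[\<alpha> := yder A (xs ! \<alpha>)])"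
  by (rule ext, case_tac x) (simp add: lie_tensor)

text \<open>Each derivative touches one tensor factor, and derivatives commute, so only the multiset
  arriving at each factor matters. Only the even variables \<open>y\<close> are differentiated,
  hence no signs arise.\<close>

lemma lieops_tensor:
  assumes "\<And>e. e \<in> set q \<Longrightarrow> fst (fst e) < length xs \<and> snd (fst e) < length xs"
  shows "fold lieop q (tensor xs) = tensor (map (\<lambda>v. ydrs (lab q v) (xs ! v)) [0..<length xs])"
  using assms
proof (induction q arbitrary: xs)
  case Nil
  then show ?case by (simp add: map_nth)
next
  case (Cons e q)
  obtain u v A B where e: "e = ((u, v), (A, B))" by (metis prod.exhaust)
  have uv: "u < length xs" "v < length xs" using Cons.prems[of e] by (auto simp: e)
  define ys where "ys = map (\<lambda>v. ydrs (lab [e] v) (xs ! v)) [0..<length xs]"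
  have "lieop e (tensor xs) = tensor ((xs[v := yder B (xs ! v)])[u := yder A (xs[v := yder B (xs ! v)] ! u)])"
    using uv by (simp add: lieop_def e lie_tensor')
  also have "(xs[v := yder B (xs ! v)])[u := yder A (xs[v := yder B (xs ! v)] ! u)] = ys"
    using uv by (intro nth_equalityI) (auto simp: ys_def lab_def e nth_list_update ydrs_add_mset add_mset_commute)
  finally have "fold lieop (e # q) (tensor xs) = fold lieop q (tensor ys)" by simp
  also have "\<dots> = tensor (map (\<lambda>v. ydrs (lab q v) (ys ! v)) [0..<length ys])"
    using Cons.prems by (intro Cons.IH) (auto simp: ys_def)
  also have "map (\<lambda>v. ydrs (lab q v) (ys ! v)) [0..<length ys] = map (\<lambda>v. ydrs (lab (e # q) v) (xs ! v)) [0..<length xs]"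
    unfolding lab_Cons[of e q] ydrs_union by (auto simp: ys_def)
  finally show ?case .
qed

lemma lie_sum: "lie \<alpha> A (\<lambda>q. \<Sum>x\<in>X. c x * t x q) = (\<lambda>q. \<Sum>x\<in>X. c x * lie \<alpha> A (t x) q)"
  by (rule ext) (auto simp: lie_def sum_distrib_left mult_ac)

lemma lie_commute: "lie \<alpha> A (lie \<beta> B t) = lie \<beta> B (lie \<alpha> A t)"
proof
  fix q :: "'a gen set \<times> ('a gen multiset \<times> 'a gen set) list"
  obtain S ps where q: "q = (S, ps)" by (cases q)
  show "lie \<alpha> A (lie \<beta> B t) q = lie \<beta> B (lie \<alpha> A t) q"
  proof (cases "\<alpha> = \<beta>")
    case True
    then show ?thesis by (auto simp: q lie_def add_mset_commute)
  next
    case False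
    then show ?thesis by (auto simp: q lie_def list_update_swap)
  qed
qed

lemma lieop_sum: "lieop e (\<lambda>q. \<Sum>x\<in>X. c x * t x q) = (\<lambda>q. \<Sum>x\<in>X. c x * lieop e (t x) q)"
  unfolding lieop_def lie_sum by (simp add: lie_sum)

text \<open>The two label patterns are the two summands of the propagator, now read for ordered
  pairs of vertices in either order. Loops get 0, which lets later sums run over all pairs.\<close>

definition pc :: "'n cmat \<Rightarrow> (nat \<Rightarrow> real) \<Rightarrow> 'n::finite ledge \<Rightarrow> complex" where
  "pc w \<theta> e = (if fst (fst e) = snd (fst e) then 0 else
     let P = propagator (\<theta> (fst (fst e))) (\<theta> (snd (fst e))) in
     case snd e of
       (Inl i, Inr j) \<Rightarrow> of_real (P + 1 / 2) * omega_up w i j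
     | (Inr j, Inl i) \<Rightarrow> - (of_real (P - 1 / 2) * omega_up w i j)
     | _ \<Rightarrow> 0)"

definition pairop :: "'n cmat \<Rightarrow> (nat \<Rightarrow> real) \<Rightarrow> nat \<times> nat \<Rightarrow>
    ('n::finite, complex) tens \<Rightarrow> ('n, complex) tens" where
  "pairop w \<theta> e t = (\<lambda>q. \<Sum>l\<in>UNIV. pc w \<theta> (e, l) * lieop (e, l) t q)"

lemma sum_UNIV_gen:
  fixes f :: "'n::finite gen \<Rightarrow> 'a::comm_monoid_add"
  shows "(\<Sum>A\<in>UNIV. f A) = (\<Sum>i\<in>UNIV. f (Inl i)) + (\<Sum>j\<in>UNIV. f (Inr j))"
  by (simp add: UNIV_Plus_UNIV[symmetric] sum.Plus del: UNIV_Plus_UNIV)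

lemma sum_UNIV_prod: "(\<Sum>p\<in>UNIV. f p) = (\<Sum>a\<in>UNIV. \<Sum>b\<in>UNIV. f (a, b))"
  for f :: "'a::finite \<times> 'b::finite \<Rightarrow> 'c::comm_monoid_add"
  by (simp add: sum.cartesian_product flip: UNIV_Times_UNIV)

lemma pairop_eq_dP_pair:
  assumes "u \<noteq> v"
  shows "pairop w \<theta> (u, v) = dP_pair w \<theta> u v"
proof (intro ext)
  fix t q
  have "pairop w \<theta> (u, v) t q =
    (\<Sum>i\<in>UNIV. \<Sum>j\<in>UNIV. of_real (propagator (\<theta> u) (\<theta> v) + 1 / 2) * omega_up w i j * lie u (Inl i) (lie v (Inr j) t) q)
    + (\<Sum>j\<in>UNIV. \<Sum>i\<in>UNIV. - (of_real (propagator (\<theta> u) (\<theta> v) - 1 / 2) * omega_up w i j) * lie u (Inr j) (lie v (Inl i) t) q)"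
    using assms unfolding pairop_def
    by (simp add: sum_UNIV_prod sum_UNIV_gen pc_def lieop_def Let_def)
  also have "(\<Sum>j\<in>UNIV. \<Sum>i\<in>UNIV. - (of_real (propagator (\<theta> u) (\<theta> v) - 1 / 2) * omega_up w i j) * lie u (Inr j) (lie v (Inl i) t) q)
      = (\<Sum>i\<in>UNIV. \<Sum>j\<in>UNIV. - (of_real (propagator (\<theta> u) (\<theta> v) - 1 / 2) * omega_up w i j) * lie u (Inr j) (lie v (Inl i) t) q)"
    by (rule sum.swap)
  finally show "pairop w \<theta> (u, v) t q = dP_pair w \<theta> u v t q"
    by (simp add: dP_pair_def sum_subtractf sum_negf)
qed

lemma pairop_diag: "pairop w \<theta> (u, u) = (\<lambda>t q. 0)"
  by (intro ext) (simp add: pairop_def pc_def)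

text \<open>Off the integers frac(-x) = 1 - frac(x), so the propagator is antisymmetric at distinct
  points. Swapping the ends thus exchanges P + 1/2 with -(P - 1/2), and it exchanges the two label
  patterns as well. At coinciding points antisymmetry fails.\<close>

lemma pc_swap:
  assumes "\<theta> u \<noteq> \<theta> v" "\<theta> u \<in> {0..<1}" "\<theta> v \<in> {0..<1}"
  shows "pc w \<theta> ((u, v), (A, B)) = pc w \<theta> ((v, u), (B, A))"
proof -
  have "\<theta> u - \<theta> v \<notin> \<int>"
  proof
    assume "\<theta> u - \<theta> v \<in> \<int>"
    then obtain k :: int where "\<theta> u - \<theta> v = of_int k" by (auto elim: Ints_cases)
    then have "k = 0" using assms by auto
    then show False using assms \<open>\<theta> u - \<theta> v = of_int k\<close> by simp
  qed
  then have "frac (\<theta> v - \<theta> u) = 1 - frac (\<theta> u - \<theta> v)"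
    using frac_neg[of "\<theta> u - \<theta> v"] by simp
  then have "propagator (\<theta> v) (\<theta> u) = - propagator (\<theta> u) (\<theta> v)"
    by (simp add: propagator_def)
  then show ?thesis
    by (cases A; cases B) (auto simp: pc_def Let_def algebra_simps)
qed

lemma pairop_swap:
  assumes "\<theta> u \<noteq> \<theta> v" "\<theta> u \<in> {0..<1}" "\<theta> v \<in> {0..<1}"
  shows "pairop w \<theta> (u, v) = pairop w \<theta> (v, u)"
proof (intro ext)
  fix t q
  have "pairop w \<theta> (v, u) t q = (\<Sum>l\<in>UNIV. pc w \<theta> ((v, u), prod.swap l) * lieop ((v, u), prod.swap l) t q)"
    unfolding pairop_def
    by (rule sum.reindex_bij_witness[of _ prod.swap prod.swap]) auto
  also have "\<dots> = pairop w \<theta> (u, v) t q" unfolding pairop_def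
    using pc_swap[OF assms, of w] by (intro sum.cong) (auto simp: lieop_def lie_commute)
  finally show "pairop w \<theta> (u, v) t q = pairop w \<theta> (v, u) t q" by simp
qed

lemma pairop_sum: "pairop w \<theta> e (\<lambda>q. \<Sum>x\<in>X. c x * t x q) = (\<lambda>q. \<Sum>x\<in>X. c x * pairop w \<theta> e (t x) q)"
proof
  fix q
  have "pairop w \<theta> e (\<lambda>q. \<Sum>x\<in>X. c x * t x q) q = (\<Sum>l\<in>UNIV. \<Sum>x\<in>X. c x * (pc w \<theta> (e, l) * lieop (e, l) (t x) q))"
    by (simp add: pairop_def lieop_sum sum_distrib_left mult_ac)
  also have "\<dots> = (\<Sum>x\<in>X. \<Sum>l\<in>UNIV. c x * (pc w \<theta> (e, l) * lieop (e, l) (t x) q))" by (rule sum.swap)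
  finally show "pairop w \<theta> e (\<lambda>q. \<Sum>x\<in>X. c x * t x q) q = (\<Sum>x\<in>X. c x * pairop w \<theta> e (t x) q)"
    by (simp add: pairop_def sum_distrib_left)
qed

lemma fold_pairop_sum:
  "fold (pairop w \<theta>) es (\<lambda>q. \<Sum>x\<in>X. c x * t x q) = (\<lambda>q. \<Sum>x\<in>X. c x * fold (pairop w \<theta>) es (t x) q)"
  by (induction es arbitrary: t) (simp_all add: pairop_sum)

lemma labellings_Cons:
  "{q. map fst q = e # es} = (\<lambda>(l, q). (e, l) # q) ` (UNIV \<times> {q. map fst q = es})"
  by (auto simp: map_eq_Cons_conv image_iff)

lemma finite_labellings [simp]: "finite {q :: ('a \<times> 'b::finite) list. map fst q = es}"
  by (induction es) (simp_all add: labellings_Cons)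

lemma sum_labellings_Cons:
  fixes f :: "('a \<times> 'b::finite) list \<Rightarrow> 'c::comm_monoid_add"
  shows "(\<Sum>q\<in>{q. map fst q = e # es}. f q) = (\<Sum>l\<in>UNIV. \<Sum>q\<in>{q. map fst q = es}. f ((e, l) # q))"
  unfolding labellings_Cons
  by (subst sum.reindex) (auto simp: inj_on_def sum.cartesian_product case_prod_unfold)

text \<open>Multiplying out: a summand chosen from every edge operator is a label chosen for every
  edge.\<close>

lemma fold_pairop_labellings:
  "fold (pairop w \<theta>) es t = (\<lambda>p. \<Sum>q\<in>{q. map fst q = es}. prod_list (map (pc w \<theta>) q) * fold lieop q t p)"
proof (induction es arbitrary: t)
  case (Cons e es)
  have "fold (pairop w \<theta>) (e # es) t = fold (pairop w \<theta>) es (\<lambda>q. \<Sum>l\<in>UNIV. pc w \<theta> (e, l) * lieop (e, l) t q)"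
    by (simp add: pairop_def[abs_def])
  also have "\<dots> = (\<lambda>p. \<Sum>l\<in>UNIV. pc w \<theta> (e, l) * (\<Sum>q\<in>{q. map fst q = es}. prod_list (map (pc w \<theta>) q) * fold lieop q (lieop (e, l) t) p))"
    by (simp only: fold_pairop_sum Cons.IH)
  finally show ?case by (simp add: sum_labellings_Cons sum_distrib_left mult_ac)
qed (simp add: fun_eq_iff)

section \<open>Powers of the propagator as sums over lists of edges\<close>

definition edge_lists :: "'v set \<Rightarrow> nat \<Rightarrow> ('v \<times> 'v) list set" where
  "edge_lists K l = {es. set es \<subseteq> K \<times> K \<and> length es = l}"

lemma sum_edge_lists_Suc:
  "(\<Sum>es\<in>edge_lists K (Suc l). f es) = (\<Sum>e\<in>K \<times> K. \<Sum>es\<in>edge_lists K l. f (e # es))"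
proof -
  have "(\<Sum>es\<in>edge_lists K (Suc l). f es) = (\<Sum>(es, e)\<in>edge_lists K l \<times> (K \<times> K). f (e # es))"
    unfolding edge_lists_def lists_length_Suc_eq
    by (subst sum.reindex) (auto simp: inj_on_def intro!: sum.cong)
  also have "\<dots> = (\<Sum>es\<in>edge_lists K l. \<Sum>e\<in>K \<times> K. f (e # es))" by (simp add: sum.cartesian_product)
  finally show ?thesis by (simp add: sum.swap[of _ "K \<times> K"])
qed

text \<open>Each unordered pair of vertices appears as two ordered pairs with equal operators, and
  the diagonal contributes 0; this explains the factor 1/2.\<close>

lemma dP_eq_pairop:
  assumes "inj_on \<theta> {..<k}" "\<theta> ` {..<k} \<subseteq> {0..<1}"
  shows "dP w k \<theta> t = (\<lambda>q. \<Sum>e\<in>{..<k} \<times> {..<k}. 1 / 2 * pairop w \<theta> e t q)"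
proof
  fix q
  let ?f = "\<lambda>e. pairop w \<theta> e t q"
  let ?L = "{e \<in> {..<k} \<times> {..<k}. fst e < snd e}" and ?G = "{e \<in> {..<k} \<times> {..<k}. snd e < fst e}"
    and ?D = "{e \<in> {..<k} \<times> {..<k}. fst e = snd e}"
  have dp: "dP w k \<theta> t q = (\<Sum>e\<in>?L. ?f e)"
  proof -
    have "dP w k \<theta> t q = (\<Sum>\<beta><k. \<Sum>\<alpha><\<beta>. ?f (\<alpha>, \<beta>))"
      unfolding dP_def by (intro sum.cong) (auto simp: pairop_eq_dP_pair)
    also have "\<dots> = (\<Sum>p\<in>(SIGMA \<beta>:{..<k}. {..<\<beta>}). ?f (prod.swap p))"
      by (simp add: sum.Sigma case_prod_unfold prod.swap_def)
    also have "\<dots> = (\<Sum>e\<in>?L. ?f e)"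
      by (rule sum.reindex_bij_witness[of _ prod.swap prod.swap]) auto
    finally show ?thesis .
  qed
  have "(\<Sum>e\<in>?G. ?f e) = (\<Sum>e\<in>?L. ?f (prod.swap e))"
    by (rule sum.reindex_bij_witness[of _ prod.swap prod.swap]) auto
  also have "\<dots> = (\<Sum>e\<in>?L. ?f e)"
  proof (intro sum.cong refl)
    fix e assume e: "e \<in> ?L"
    then have "\<theta> (fst e) \<noteq> \<theta> (snd e)" using assms(1) by (auto dest: inj_onD)
    then show "?f (prod.swap e) = ?f e"
      using pairop_swap[of \<theta> "fst e" "snd e" w] e assms(2) by (cases e) (auto simp: image_subset_iff)
  qed
  finally have G: "(\<Sum>e\<in>?G. ?f e) = (\<Sum>e\<in>?L. ?f e)" .
  have D: "(\<Sum>e\<in>?D. ?f e) = 0" by (intro sum.neutral) (auto simp: pairop_diag)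
  have fin: "finite ?L" "finite ?G" "finite ?D" by (auto intro: finite_subset[of _ "{..<k} \<times> {..<k}"])
  have "{..<k} \<times> {..<k} = (?L \<union> ?G) \<union> ?D" by auto
  then have "(\<Sum>e\<in>{..<k} \<times> {..<k}. ?f e) = (\<Sum>e\<in>(?L \<union> ?G) \<union> ?D. ?f e)" by metis
  also have "\<dots> = (\<Sum>e\<in>?L. ?f e) + (\<Sum>e\<in>?G. ?f e) + (\<Sum>e\<in>?D. ?f e)"
    using fin by (subst sum.union_disjoint, simp, simp, force, subst sum.union_disjoint) auto
  finally have "(\<Sum>e\<in>{..<k} \<times> {..<k}. ?f e) = 2 * dP w k \<theta> t q" using G D dp by simp
  then show "dP w k \<theta> t q = (\<Sum>e\<in>{..<k} \<times> {..<k}. 1 / 2 * ?f e)"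
    by (simp add: sum_divide_distrib[symmetric])
qed

lemma dP_funpow:
  assumes "inj_on \<theta> {..<k}" "\<theta> ` {..<k} \<subseteq> {0..<1}"
  shows "(dP w k \<theta> ^^ l) t = (\<lambda>p. \<Sum>es\<in>edge_lists {..<k} l. (1 / 2) ^ l * fold (pairop w \<theta>) es t p)"
proof (induction l arbitrary: t)
  case 0
  have "edge_lists {..<k} 0 = {[]}" by (auto simp: edge_lists_def)
  then show ?case by (simp add: fun_eq_iff)
next
  case (Suc l)
  have "(dP w k \<theta> ^^ Suc l) t = (dP w k \<theta> ^^ l) (dP w k \<theta> t)" by (simp add: funpow_swap1)
  also have "\<dots> = (\<lambda>p. \<Sum>es\<in>edge_lists {..<k} l. (1 / 2) ^ l * (\<Sum>e\<in>{..<k} \<times> {..<k}. 1 / 2 * fold (pairop w \<theta>) es (pairop w \<theta> e t) p))"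
    unfolding Suc dP_eq_pairop[OF assms] fold_pairop_sum ..
  also have "\<dots> = (\<lambda>p. \<Sum>es\<in>edge_lists {..<k} l. \<Sum>e\<in>{..<k} \<times> {..<k}. (1 / 2) ^ Suc l * fold (pairop w \<theta>) (e # es) t p)"
    by (simp add: sum_distrib_left mult_ac)
  finally show ?case by (simp only: sum_edge_lists_Suc sum.swap[of _ "{..<k} \<times> {..<k}"])
qed

section \<open>Multiplication of tensor factors\<close>

lemma Mult_sum: "Mult k (\<lambda>q. \<Sum>x\<in>X. c x * t x q) m = (\<Sum>x\<in>X. c x * Mult k (t x) m)"
proof -
  obtain S M T where m: "m = (S, M, T)" by (cases m)
  let ?P = "{ps. length ps = k \<and> sum_list (map fst ps) = M \<and> \<Union> (snd ` set ps) = T}"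
  have "Mult k (\<lambda>q. \<Sum>x\<in>X. c x * t x q) m = (\<Sum>ps\<in>?P. \<Sum>x\<in>X. c x * (odd_sign (map snd ps) * t x (S, ps)))"
    by (simp add: m Mult_def sum_distrib_left mult_ac)
  also have "\<dots> = (\<Sum>x\<in>X. \<Sum>ps\<in>?P. c x * (odd_sign (map snd ps) * t x (S, ps)))" by (rule sum.swap)
  finally show ?thesis by (simp add: m Mult_def sum_distrib_left)
qed

lemma finite_Mult_index:
  fixes M :: "'n::finite gen multiset" and T :: "'n gen set"
  shows "finite {ps. length ps = k \<and> sum_list (map fst ps) = M \<and> \<Union> (snd ` set ps) = T}"
proof (rule finite_subset)
  show "{ps. length ps = k \<and> sum_list (map fst ps) = M \<and> \<Union> (snd ` set ps) = T}
      \<subseteq> {ps. set ps \<subseteq> {K. K \<subseteq># M} \<times> Pow T \<and> length ps = k}"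
  proof
    fix ps :: "('n gen multiset \<times> 'n gen set) list"
    assume ps: "ps \<in> {ps. length ps = k \<and> sum_list (map fst ps) = M \<and> \<Union> (snd ` set ps) = T}"
    have "K \<subseteq># sum_list (map fst ps) \<and> B \<subseteq> \<Union> (snd ` set ps)" if "(K, B) \<in> set ps" for K B
    proof
      show "K \<subseteq># sum_list (map fst ps)" using that
        by (induction ps) (auto intro: subset_mset.order_trans)
      show "B \<subseteq> \<Union> (snd ` set ps)" using that by force
    qed
    then show "ps \<in> {ps. set ps \<subseteq> {K. K \<subseteq># M} \<times> Pow T \<and> length ps = k}" using ps by auto
  qed
  show "finite {ps. set ps \<subseteq> {K. K \<subseteq># M} \<times> Pow T \<and> length ps = k}"
    by (intro finite_lists_length_eq finite_cartesian_product finite_submsets) simp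
qed

text \<open>The index set of \<open>Mult\<close> only prescribes the union of the odd sets and so
  admits overlaps. There \<open>wsgn\<close> vanishes, and the indices that remain are the
  splittings in \<open>elt_mult\<close>.\<close>

lemma Mult_tensor_Cons:
  fixes x :: "('n::{finite,linorder}, 'c::comm_ring_1) elt"
  shows "Mult (Suc k) (tensor (x # xs)) = elt_mult x (Mult k (tensor xs))"
proof
  fix m :: "'n idx"
  obtain S M T where m: "m = (S, M, T)" by (cases m)
  let ?P = "\<lambda>k M T. {ps :: ('n gen multiset \<times> 'n gen set) list. length ps = k \<and> sum_list (map fst ps) = M \<and> \<Union> (snd ` set ps) = T}"
  let ?h = "\<lambda>A p ps. wsgn A (S - A) * wsgn (snd p) (\<Union> (snd ` set ps)) * x (A, fst p, snd p)
      * (odd_sign (map snd ps) * tensor xs (S - A, ps))"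
  let ?KB = "{K. K \<subseteq># M} \<times> Pow T"
  let ?Q = "SIGMA KB:?KB. ?P k (M - fst KB) (T - snd KB)"
  let ?g = "\<lambda>y. fst y # snd y"
  have finP: "finite (?P k M T)" for k M T by (rule finite_Mult_index)
  have finQ: "finite ?Q" using finP by (auto intro!: finite_SigmaI simp: finite_submsets)
  have "Mult (Suc k) (tensor (x # xs)) m = (\<Sum>ps\<in>?P (Suc k) M T. \<Sum>A\<in>Pow S. ?h A (hd ps) (tl ps))"
    unfolding m Mult_def prod.case
  proof (intro sum.cong refl, clarify)
    fix ps :: "('n gen multiset \<times> 'n gen set) list" assume "length ps = Suc k"
    then obtain p ps' where "ps = p # ps'" by (cases ps) auto
    then show "odd_sign (map snd ps) * tensor (x # xs) (S, ps) = (\<Sum>A\<in>Pow S. ?h A (hd ps) (tl ps))"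
      by (simp add: sum_distrib_left mult_ac)
  qed
  also have "\<dots> = (\<Sum>ps\<in>?g ` ?Q. \<Sum>A\<in>Pow S. ?h A (hd ps) (tl ps))"
  proof (rule sum.mono_neutral_right)
    show "finite (?P (Suc k) M T)" by (rule finP)
    show "?g ` ?Q \<subseteq> ?P (Suc k) M T" by (clarsimp simp: Un_absorb1)
    show "\<forall>ps\<in>?P (Suc k) M T - ?g ` ?Q. (\<Sum>A\<in>Pow S. ?h A (hd ps) (tl ps)) = 0"
    proof
      fix ps assume ps: "ps \<in> ?P (Suc k) M T - ?g ` ?Q"
      then obtain K B ps' where c: "ps = (K, B) # ps'" by (cases ps) auto
      have "B \<inter> \<Union> (snd ` set ps') \<noteq> {}"
      proof
        assume "B \<inter> \<Union> (snd ` set ps') = {}"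
        then have q: "((K, B), ps') \<in> ?Q" using ps by (auto simp: c)
        have "ps \<in> ?g ` ?Q" unfolding c by (rule image_eqI[OF _ q]) simp
        then show False using ps by simp
      qed
      then have "wsgn B (\<Union> (snd ` set ps')) = (0 :: 'c)" by (simp add: wsgn_def)
      then show "(\<Sum>A\<in>Pow S. ?h A (hd ps) (tl ps)) = 0" by (simp add: c)
    qed
  qed
  also have "\<dots> = (\<Sum>y\<in>?Q. \<Sum>A\<in>Pow S. ?h A (fst y) (snd y))"
    by (subst sum.reindex) (auto simp: inj_on_def prod_eq_iff)
  also have "\<dots> = (\<Sum>KB\<in>?KB. \<Sum>ps\<in>?P k (M - fst KB) (T - snd KB). \<Sum>A\<in>Pow S. ?h A KB ps)"
    by (rule sum.Sigma[symmetric, unfolded case_prod_unfold]) (use finP in \<open>auto simp: finite_submsets\<close>)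
  also have "\<dots> = (\<Sum>KB\<in>?KB. \<Sum>A\<in>Pow S. \<Sum>ps\<in>?P k (M - fst KB) (T - snd KB). ?h A KB ps)"
    by (intro sum.cong refl sum.swap)
  also have "\<dots> = (\<Sum>A\<in>Pow S. \<Sum>KB\<in>?KB. \<Sum>ps\<in>?P k (M - fst KB) (T - snd KB). ?h A KB ps)"
    by (rule sum.swap)
  also have "\<dots> = (\<Sum>A\<in>Pow S. \<Sum>KB\<in>?KB. wsgn A (S - A) * wsgn (snd KB) (T - snd KB) * x (A, fst KB, snd KB)
      * Mult k (tensor xs) (S - A, M - fst KB, T - snd KB))"
  proof (intro sum.cong refl)
    fix A KB
    show "(\<Sum>ps\<in>?P k (M - fst KB) (T - snd KB). ?h A KB ps) = wsgn A (S - A) * wsgn (snd KB) (T - snd KB) * x (A, fst KB, snd KB)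
      * Mult k (tensor xs) (S - A, M - fst KB, T - snd KB)"
      unfolding Mult_def prod.case sum_distrib_left by (intro sum.cong refl) auto
  qed
  also have "\<dots> = elt_mult x (Mult k (tensor xs)) m"
    unfolding m elt_mult_def by (simp add: sum.cartesian_product case_prod_unfold)
  finally show "Mult (Suc k) (tensor (x # xs)) m = elt_mult x (Mult k (tensor xs)) m" .
qed

text \<open>Passes from lists of tensor factors to a product in a commutative ring, in which the
  order of the vertices is immaterial.\<close>

lemma Mult_tensor:
  fixes xs :: "('n::{finite,linorder}, 'c::comm_ring_1) bv list"
  shows "Mult (length xs) (tensor (map Rep_bv xs)) = Rep_bv (prod_list xs)"
proof (induction xs)
  case Nil
  show ?case
  proof
    fix m :: "'n idx"
    obtain S M T where m: "m = (S, M, T)" by (cases m)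
    have "{ps :: ('n gen multiset \<times> 'n gen set) list. length ps = 0 \<and> sum_list (map fst ps) = M \<and> \<Union> (snd ` set ps) = T}
        = (if M = {#} \<and> T = {} then {[]} else {})" by auto
    then show "Mult (length []) (tensor (map Rep_bv [])) m = Rep_bv (prod_list []) m"
      unfolding m by (simp add: Mult_def mon_def Rep_bv_ops)
  qed
next
  case (Cons x xs)
  then show ?case by (simp add: Mult_tensor_Cons Rep_bv_ops del: tensor.simps)
qed

section \<open>Propagator integrals over the torus\<close>

abbreviation circ :: "real measure" where "circ \<equiv> restrict_space lborel {0..<1}"

abbreviation torus :: "nat set \<Rightarrow> (nat \<Rightarrow> real) measure" where "torus K \<equiv> PiM K (\<lambda>_. circ)"

lemma prob_space_circ: "prob_space circ"
  by (rule prob_spaceI) (simp add: emeasure_restrict_space space_restrict_space)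

lemma product_prob_space_circ: "product_prob_space (\<lambda>_::nat. circ)"
proof -
  interpret prob_space circ by (rule prob_space_circ)
  show ?thesis by unfold_locales
qed

lemma prob_space_torus: "prob_space (torus K)"
  by (intro prob_space_PiM prob_space_circ)

lemma torus_component_measurable:
  assumes "u \<in> K" shows "(\<lambda>\<theta>. \<theta> u) \<in> borel_measurable (torus K)"
proof -
  have "(\<lambda>x. x) \<in> borel_measurable circ" by (rule measurable_restrict_space1) simp
  then show ?thesis by (rule measurable_compose[OF measurable_component_singleton[OF assms]])
qed

lemma space_torus: "\<theta> \<in> space (torus K) \<Longrightarrow> \<theta> ` K \<subseteq> {0..<1}"
  by (auto simp: space_PiM PiE_iff space_restrict_space)

text \<open>By Fubini: once the other coordinates are fixed, the coordinate of \<open>v\<close> is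
  confined to one point, which has Lebesgue measure 0.\<close>

lemma AE_torus_neq:
  assumes "finite K" "u \<in> K" "v \<in> K" "u \<noteq> v"
  shows "AE \<theta> in torus K. \<theta> u \<noteq> \<theta> v"
proof -
  interpret product_prob_space "\<lambda>_::nat. circ" K by (rule product_prob_space_circ)
  define L where "L = K - {v}"
  have K: "K = insert v L" "v \<notin> L" "finite L" "u \<in> L" using assms by (auto simp: L_def)
  note [measurable] = torus_component_measurable[OF assms(2)] torus_component_measurable[OF assms(3)]
  have meas: "{\<theta> \<in> space (torus K). \<theta> u = \<theta> v} \<in> sets (torus K)" by measurable
  have "emeasure (torus K) {\<theta> \<in> space (torus K). \<theta> u = \<theta> v}
      = (\<integral>\<^sup>+\<theta>. indicator {\<theta> \<in> space (torus K). \<theta> u = \<theta> v} \<theta> \<partial>torus K)"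
    using meas by simp
  also have "\<dots> = (\<integral>\<^sup>+x. (\<integral>\<^sup>+y. indicator {\<theta> \<in> space (torus K). \<theta> u = \<theta> v} (x(v := y)) \<partial>circ) \<partial>torus L)"
    unfolding K(1) by (rule product_nn_integral_insert) (use K meas in auto)
  also have "\<dots> = (\<integral>\<^sup>+x. 0 \<partial>torus L)"
  proof (rule nn_integral_cong)
    fix x assume "x \<in> space (torus L)"
    have "(\<integral>\<^sup>+y. indicator {\<theta> \<in> space (torus K). \<theta> u = \<theta> v} (x(v := y)) \<partial>circ) \<le> (\<integral>\<^sup>+y. indicator {x u} y \<partial>circ)"
      using assms(4) by (intro nn_integral_mono) (auto simp: indicator_def)
    also have "\<dots> = (\<integral>\<^sup>+y. indicator {x u} y * indicator {0..<1} y \<partial>lborel)"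
      by (subst nn_integral_restrict_space) auto
    also have "\<dots> \<le> (\<integral>\<^sup>+y. indicator {x u} y \<partial>lborel)"
      by (intro nn_integral_mono) (auto simp: indicator_def)
    also have "\<dots> = 0" by simp
    finally show "(\<integral>\<^sup>+y. indicator {\<theta> \<in> space (torus K). \<theta> u = \<theta> v} (x(v := y)) \<partial>circ) = 0" by simp
  qed
  finally have "emeasure (torus K) {\<theta> \<in> space (torus K). \<theta> u = \<theta> v} = 0" by simp
  then show ?thesis by (subst AE_iff_measurable[OF meas]) auto
qed

lemma AE_torus_inj:
  assumes "finite K"
  shows "AE \<theta> in torus K. inj_on \<theta> K"
proof -
  have "AE \<theta> in torus K. \<forall>p\<in>{p \<in> K \<times> K. fst p \<noteq> snd p}. \<theta> (fst p) \<noteq> \<theta> (snd p)"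
    using assms AE_torus_neq
    by (intro AE_finite_allI) (auto intro: finite_subset[of _ "K \<times> K"])
  then show ?thesis by (rule AE_mp) (auto simp: inj_on_def)
qed

definition ledges_in :: "nat set \<Rightarrow> 'n ledge list \<Rightarrow> bool" where
  "ledges_in K q \<longleftrightarrow> set (map fst q) \<subseteq> K \<times> K"

lemma borel_measurable_propagator:
  assumes [measurable]: "f \<in> borel_measurable M" "g \<in> borel_measurable M"
  shows "(\<lambda>x. propagator (f x) (g x)) \<in> borel_measurable M"
  unfolding propagator_def frac_def by measurable

lemma pc_measurable:
  assumes "fst (fst e) \<in> K" "snd (fst e) \<in> K"
  shows "(\<lambda>\<theta>. pc w \<theta> e) \<in> borel_measurable (torus K)"
proof -
  note [measurable] = borel_measurable_propagator[OF torus_component_measurable[OF assms(1)] torus_component_measurable[OF assms(2)]]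
  obtain u v A B where e: "e = ((u, v), (A, B))" by (metis prod.exhaust)
  show ?thesis
  proof (cases "u = v")
    case False
    show ?thesis using False
      by (cases A; cases B) (simp_all add: pc_def Let_def e, insert borel_measurable_propagator[OF torus_component_measurable[OF assms(1)] torus_component_measurable[OF assms(2)]], auto simp: e)
  qed (simp add: pc_def e)
qed

text \<open>\<open>frac\<close> takes values in [0,1), so P + 1/2 and P - 1/2 have absolute value at
  most 1. On a probability space boundedness gives integrability.\<close>

lemma pc_bounded: "\<exists>B. \<forall>\<theta>. norm (pc w \<theta> e) \<le> B"
proof -
  obtain u v A B where e: "e = ((u, v), (A, B))" by (metis prod.exhaust)
  have P: "\<bar>propagator s t + 1 / 2\<bar> \<le> 1" "\<bar>propagator s t - 1 / 2\<bar> \<le> 1" for s t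
    using frac_ge_0[of "s - t"] frac_lt_1[of "s - t"] by (auto simp: propagator_def)
  have N: "norm (of_real r * c) \<le> norm c" if "\<bar>r\<bar> \<le> 1" for r and c :: complex
    using that by (simp add: norm_mult mult_left_le_one_le)
  show ?thesis
  proof (cases A)
    case A: (Inl i)
    show ?thesis
    proof (cases B)
      case (Inr j)
      then show ?thesis using N[OF P(1)] A by (intro exI[of _ "norm (omega_up w i j)"]) (auto simp: pc_def e Let_def)
    qed (auto simp: pc_def e Let_def A intro: exI[of _ 0])
  next
    case A: (Inr j)
    show ?thesis
    proof (cases B)
      case (Inl i)
      then show ?thesis using N[OF P(2)] A by (intro exI[of _ "norm (omega_up w i j)"]) (auto simp: pc_def e Let_def)
    qed (auto simp: pc_def e Let_def A intro: exI[of _ 0])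
  qed
qed

lemma prod_pc_bounded: "\<exists>B. \<forall>\<theta>. norm (prod_list (map (pc w \<theta>) q)) \<le> B"
proof (induction q)
  case (Cons e q)
  then obtain B where B: "\<And>\<theta>. norm (prod_list (map (pc w \<theta>) q)) \<le> B" by blast
  obtain C where C: "\<And>\<theta>. norm (pc w \<theta> e) \<le> C" using pc_bounded by blast
  have "norm (prod_list (map (pc w \<theta>) (e # q))) \<le> C * B" for \<theta>
    using B[of \<theta>] C[of \<theta>] by (auto simp: norm_mult intro!: mult_mono intro: order_trans[OF norm_ge_zero])
  then show ?case by blast
qed (auto intro: exI[of _ 1])

lemma prod_pc_measurable:
  "ledges_in K q \<Longrightarrow> (\<lambda>\<theta>. prod_list (map (pc w \<theta>) q)) \<in> borel_measurable (torus K)"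
  by (induction q) (auto simp: ledges_in_def intro!: borel_measurable_times pc_measurable)

lemma prod_pc_integrable:
  assumes "ledges_in K q"
  shows "integrable (torus K) (\<lambda>\<theta>. prod_list (map (pc w \<theta>) q))"
proof -
  interpret prob_space "torus K" by (rule prob_space_torus)
  obtain B where "\<And>\<theta>. norm (prod_list (map (pc w \<theta>) q)) \<le> B" using prod_pc_bounded by blast
  then show ?thesis by (intro integrable_const_bound[of _ B] prod_pc_measurable assms) auto
qed

text \<open>The analytic factor of a weight. The derivatives of gamma are constant in \<theta>, so
  all dependence on the configuration sits in this number.\<close>

definition PInt :: "'n cmat \<Rightarrow> nat set \<Rightarrow> 'n::finite ledge list \<Rightarrow> complex" where
  "PInt w K q = (\<integral>\<theta>. prod_list (map (pc w \<theta>) q) \<partial>torus K)"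

text \<open>The integrand is described only at pairwise distinct points, but these are almost all
  points. There it is a finite combination of bounded measurable functions, which may be integrated
  termwise over the whole torus.\<close>

lemma config_integral_eq_sum:
  assumes X: "finite X" "\<And>x. x \<in> X \<Longrightarrow> ledges_in {..<k} (q x)"
    and F: "\<And>\<theta>. inj_on \<theta> {..<k} \<Longrightarrow> \<theta> ` {..<k} \<subseteq> {0..<1} \<Longrightarrow>
      F \<theta> = (\<Sum>x\<in>X. c x * prod_list (map (pc w \<theta>) (q x)))"
  shows "config_integral k F = (\<Sum>x\<in>X. c x * PInt w {..<k} (q x))"
proof -
  let ?G = "\<lambda>\<theta>. \<Sum>x\<in>X. c x * prod_list (map (pc w \<theta>) (q x))"
  let ?A = "{\<theta> \<in> space (torus {..<k}). inj_on \<theta> {..<k}}"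
  have meas: "?G \<in> borel_measurable (torus {..<k})"
    using X by (intro borel_measurable_sum borel_measurable_times prod_pc_measurable) auto
  have A: "?A \<in> sets (torus {..<k})"
  proof -
    have "?A = space (torus {..<k}) - (\<Union>p\<in>{p \<in> {..<k} \<times> {..<k}. fst p \<noteq> snd p}. {\<theta> \<in> space (torus {..<k}). \<theta> (fst p) = \<theta> (snd p)})"
      by (auto simp: inj_on_def)
    moreover have "{\<theta> \<in> space (torus {..<k}). \<theta> (fst p) = \<theta> (snd p)} \<in> sets (torus {..<k})"
      if "p \<in> {..<k} \<times> {..<k}" for p
    proof -
      have k: "fst p \<in> {..<k}" "snd p \<in> {..<k}" using that by auto
      note [measurable] = torus_component_measurable[OF k(1)] torus_component_measurable[OF k(2)]
      show ?thesis by measurable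
    qed
    ultimately show ?thesis
      by (auto intro!: sets.Diff sets.finite_UN intro: finite_subset[of _ "{..<k} \<times> {..<k}"])
  qed
  have "config_integral k F = (\<integral>\<theta>. indicator {\<theta>. inj_on \<theta> {..<k}} \<theta> *\<^sub>R F \<theta> \<partial>torus {..<k})"
    by (simp add: config_integral_def set_lebesgue_integral_def)
  also have "\<dots> = (\<integral>\<theta>. indicator ?A \<theta> *\<^sub>R ?G \<theta> \<partial>torus {..<k})"
    using F space_torus by (intro Bochner_Integration.integral_cong refl) (auto simp: indicator_def)
  also have "\<dots> = (\<integral>\<theta>. ?G \<theta> \<partial>torus {..<k})"
  proof (rule integral_cong_AE)
    show "(\<lambda>\<theta>. indicator ?A \<theta> *\<^sub>R ?G \<theta>) \<in> borel_measurable (torus {..<k})"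
      by (intro borel_measurable_scaleR borel_measurable_indicator A meas)
    show "AE \<theta> in torus {..<k}. indicator ?A \<theta> *\<^sub>R ?G \<theta> = ?G \<theta>"
      by (rule AE_mp[OF AE_torus_inj]) (auto intro!: AE_I2 simp: indicator_def)
  qed (rule meas)
  also have "\<dots> = (\<Sum>x\<in>X. c x * PInt w {..<k} (q x))"
    using X by (simp add: PInt_def prod_pc_integrable)
  finally show ?thesis .
qed

lemma PInt_mset: "mset q = mset q' \<Longrightarrow> PInt w K q = PInt w K q'"
  unfolding PInt_def by (simp flip: prod_mset_prod_list)

definition relab :: "(nat \<Rightarrow> nat) \<Rightarrow> 'n ledge \<Rightarrow> 'n ledge" where
  "relab f e = (map_prod f f (fst e), snd e)"

text \<open>All circle factors carry the same measure, so renaming coordinates preserves the product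
  measure.\<close>

lemma PInt_relabel:
  assumes f: "inj_on f K" and q: "ledges_in K q"
  shows "PInt w (f ` K) (map (relab f) q) = PInt w K q"
proof -
  have d: "torus K = distr (torus (f ` K)) (torus K) (\<lambda>\<omega>. \<lambda>n\<in>K. \<omega> (f n))"
    using distr_PiM_reindex[of "f ` K" "\<lambda>_. circ" f K] f prob_space_circ by auto
  have "PInt w K q = (\<integral>\<theta>. prod_list (map (pc w \<theta>) q) \<partial>distr (torus (f ` K)) (torus K) (\<lambda>\<omega>. \<lambda>n\<in>K. \<omega> (f n)))"
    unfolding PInt_def using d by simp
  also have "\<dots> = (\<integral>\<omega>. prod_list (map (pc w (\<lambda>n\<in>K. \<omega> (f n))) q) \<partial>torus (f ` K))"
    by (intro integral_distr prod_pc_measurable q measurable_restrict measurable_component_singleton) auto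
  also have "\<dots> = PInt w (f ` K) (map (relab f) q)"
    unfolding PInt_def map_map
  proof (intro Bochner_Integration.integral_cong refl arg_cong[of _ _ prod_list] map_cong)
    fix \<omega> e assume "e \<in> set q"
    then have "fst (fst e) \<in> K" "snd (fst e) \<in> K" using q by (auto simp: ledges_in_def)
    then show "pc w (\<lambda>n\<in>K. \<omega> (f n)) e = (pc w \<omega> \<circ> relab f) e"
      using f by (cases e) (auto simp: pc_def relab_def inj_on_eq_iff)
  qed
  finally show ?thesis ..
qed

lemma pc_cong:
  "\<theta> (fst (fst e)) = \<theta>' (fst (fst e)) \<Longrightarrow> \<theta> (snd (fst e)) = \<theta>' (snd (fst e)) \<Longrightarrow> pc w \<theta> e = pc w \<theta>' e"
  by (simp add: pc_def)

text \<open>Fubini for the coordinates in \<open>K\<close> and in \<open>L\<close>: the edges of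
  each list see only one group of coordinates, so the integrand is a product.\<close>

lemma PInt_append:
  assumes K: "finite K" "finite L" "K \<inter> L = {}" and q: "ledges_in K q" "ledges_in L r"
  shows "PInt w (K \<union> L) (q @ r) = PInt w K q * PInt w L r"
proof -
  interpret product_prob_space "\<lambda>_::nat. circ" K by (rule product_prob_space_circ)
  have qr: "ledges_in (K \<union> L) (q @ r)" using q by (auto simp: ledges_in_def)
  have "PInt w (K \<union> L) (q @ r) = (\<integral>x. (\<integral>y. prod_list (map (pc w (merge K L (x, y))) (q @ r)) \<partial>torus L) \<partial>torus K)"
    unfolding PInt_def by (rule product_integral_fold[OF K(3,1,2) prod_pc_integrable[OF qr]])
  also have "\<dots> = (\<integral>x. (\<integral>y. prod_list (map (pc w x) q) * prod_list (map (pc w y) r) \<partial>torus L) \<partial>torus K)"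
  proof (intro Bochner_Integration.integral_cong refl)
    fix x y :: "nat \<Rightarrow> real"
    have "map (pc w (merge K L (x, y))) q = map (pc w x) q"
      using q(1) by (intro map_cong refl pc_cong) (auto simp: ledges_in_def merge_def)
    moreover have "map (pc w (merge K L (x, y))) r = map (pc w y) r"
      using q(2) K(3) by (intro map_cong refl pc_cong) (auto simp: ledges_in_def merge_def)
    ultimately show "prod_list (map (pc w (merge K L (x, y))) (q @ r)) = prod_list (map (pc w x) q) * prod_list (map (pc w y) r)"
      by (simp only: map_append prod_list.append)
  qed
  finally show ?thesis by (simp add: PInt_def)
qed

section \<open>Weights of edge lists\<close>

text \<open>\<open>Y v L\<close> stands for the label of vertex \<open>v\<close> after the
  derivatives \<open>L\<close>. The target ring and the embedding \<open>cs\<close> of scalars are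
  left open because weights are needed both for one power of hbar, in \<open>bv\<close>, and for all
  powers together, in series over \<open>bv\<close>.\<close>

definition wgt :: "(complex \<Rightarrow> 'r::comm_ring_1) \<Rightarrow> 'n cmat \<Rightarrow> nat set \<Rightarrow> (nat \<times> nat) list \<Rightarrow>
    (nat \<Rightarrow> 'n::finite gen multiset \<Rightarrow> 'r) \<Rightarrow> 'r" where
  "wgt cs w K es Y = (\<Sum>q\<in>{q. map fst q = es}. cs (PInt w K q) * (\<Prod>v\<in>K. Y v (lab q v)))"

lemma lab_mset:
  assumes "mset q = mset q'" shows "lab q v = lab q' v"
  using arg_cong[OF assms, of "\<lambda>m. sum_mset (image_mset (\<lambda>((u, w), (A, B)).
     (if u = v then {#A#} else {#}) + (if w = v then {#B#} else {#})) m)"]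
  by (simp add: lab_def sum_mset_sum_list flip: mset_map)

lemma wgt_mset:
  assumes "mset es = mset es'" shows "wgt cs w K es Y = wgt cs w K es' Y"
proof -
  obtain p where p: "p permutes {..<length es'}" "permute_list p es' = es"
    using mset_eq_permutation[OF assms] by blast
  note ip = permutes_inv[OF p(1)]
  have len: "length q = length es'" if "map fst q = es'" for q :: "'b ledge list"
    using that by auto
  have len': "length q = length es'" if "map fst q = es" for q :: "'b ledge list"
    using that p(2) by (metis length_map length_permute_list)
  have inv1: "permute_list p (permute_list (inv p) q) = q" if "length q = length es'" for q :: "'b ledge list"
    using that p(1) ip permute_list_compose[of p q "inv p"] permutes_inv_o(2)[OF p(1)] by simp
  have inv2: "permute_list (inv p) (permute_list p q) = q" if "length q = length es'" for q :: "'b ledge list"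
    using that p(1) ip permute_list_compose[of "inv p" q p] permutes_inv_o(1)[OF p(1)] by simp
  show ?thesis unfolding wgt_def
  proof (rule sum.reindex_bij_witness[of _ "permute_list p" "permute_list (inv p)"])
    fix q :: "'b ledge list"
    assume q: "q \<in> {q. map fst q = es}"
    then have l: "length q = length es'" using len' by simp
    show "permute_list p (permute_list (inv p) q) = q" using inv1 l .
    have "map fst (permute_list (inv p) q) = permute_list (inv p) (permute_list p es')"
      using q l ip p(2) permute_list_map[of "inv p" q fst] by simp
    also have "\<dots> = es'"
      using p(1) permute_list_compose[of "inv p" es' p] permutes_inv_o(1)[OF p(1)] ip by simp
    finally show "permute_list (inv p) q \<in> {q. map fst q = es'}" by simp
    have m: "mset (permute_list (inv p) q) = mset q" using ip l by simp
    show "cs (PInt w K (permute_list (inv p) q)) * (\<Prod>v\<in>K. Y v (lab (permute_list (inv p) q) v))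
        = cs (PInt w K q) * (\<Prod>v\<in>K. Y v (lab q v))"
      using PInt_mset[OF m] lab_mset[OF m] by simp
  next
    fix q :: "'b ledge list"
    assume q: "q \<in> {q. map fst q = es'}"
    then have l: "length q = length es'" using len by simp
    show "permute_list (inv p) (permute_list p q) = q" using inv2 l .
    show "permute_list p q \<in> {q. map fst q = es}" using q l p permute_list_map[of p q fst] by simp
  qed
qed

lemma labellings_append:
  "{q. map fst q = es @ es'} = (\<lambda>(q, q'). q @ q') ` ({q. map fst q = es} \<times> {q. map fst q = es'})"
  by (auto simp: map_eq_append_conv image_iff)

lemma lab_outside: "ledges_in K q \<Longrightarrow> v \<notin> K \<Longrightarrow> lab q v = {#}"
proof (induction q)
  case (Cons e q)
  then show ?case by (cases e) (auto simp: ledges_in_def lab_def)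
qed simp

lemma lab_append: "lab (q @ r) v = lab q v + lab r v"
  by (simp add: lab_def)

text \<open>Labellings of the joint list are pairs of labellings, the integral factorises, and a
  vertex receives derivatives only from the list on its own side.\<close>

lemma wgt_append:
  assumes hom: "\<And>a b. cs (a * b) = cs a * cs b"
    and K: "finite K" "finite L" "K \<inter> L = {}" and es: "set es \<subseteq> K \<times> K" "set es' \<subseteq> L \<times> L"
  shows "wgt cs w (K \<union> L) (es @ es') Y = wgt cs w K es Y * wgt cs w L es' Y"
proof -
  have inj: "inj_on (\<lambda>(q, q'). q @ q') ({q. map fst q = es} \<times> {q :: 'b ledge list. map fst q = es'})"
  proof (rule inj_onI)
    fix x y :: "'b ledge list \<times> 'b ledge list"
    assume a: "x \<in> {q. map fst q = es} \<times> {q. map fst q = es'}" "y \<in> {q. map fst q = es} \<times> {q. map fst q = es'}"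
      "(\<lambda>(q, q'). q @ q') x = (\<lambda>(q, q'). q @ q') y"
    obtain q q' r r' where xy: "x = (q, q')" "y = (r, r')" by (cases x; cases y)
    have "map fst q = map fst r" using a(1,2) by (simp add: xy)
    then have "length q = length r" by (rule map_eq_imp_length_eq)
    then show "x = y" using a(3) by (simp add: xy)
  qed
  have *: "cs (PInt w (K \<union> L) (q @ r)) * (\<Prod>v\<in>K \<union> L. Y v (lab (q @ r) v))
        = cs (PInt w K q) * (\<Prod>v\<in>K. Y v (lab q v)) * (cs (PInt w L r) * (\<Prod>v\<in>L. Y v (lab r v)))"
    if eq: "map fst q = es" "map fst r = es'" for q r :: "'b ledge list"
  proof -
    have q: "ledges_in K q" "ledges_in L r" using es eq by (auto simp: ledges_in_def)
    have "(\<Prod>v\<in>K \<union> L. Y v (lab (q @ r) v)) = (\<Prod>v\<in>K. Y v (lab (q @ r) v)) * (\<Prod>v\<in>L. Y v (lab (q @ r) v))"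
      using K by (simp add: prod.union_disjoint)
    also have "(\<Prod>v\<in>K. Y v (lab (q @ r) v)) = (\<Prod>v\<in>K. Y v (lab q v))"
      using K(3) lab_outside[OF q(2)] by (intro prod.cong refl) (auto simp: lab_append disjoint_iff)
    also have "(\<Prod>v\<in>L. Y v (lab (q @ r) v)) = (\<Prod>v\<in>L. Y v (lab r v))"
      using K(3) lab_outside[OF q(1)] by (intro prod.cong refl) (metis IntI add_0 empty_iff lab_append)
    finally show ?thesis
      by (simp only: PInt_append[OF K q] hom mult_ac)
  qed
  have "wgt cs w (K \<union> L) (es @ es') Y = (\<Sum>p\<in>{q. map fst q = es} \<times> {q. map fst q = es'}.
      (cs (PInt w K (fst p)) * (\<Prod>v\<in>K. Y v (lab (fst p) v))) * (cs (PInt w L (snd p)) * (\<Prod>v\<in>L. Y v (lab (snd p) v))))"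
    unfolding wgt_def labellings_append sum.reindex[OF inj]
    using * by (intro sum.cong refl) (simp add: case_prod_unfold mem_Times_iff)
  then show ?thesis unfolding wgt_def sum_product by (simp add: sum.cartesian_product case_prod_unfold)
qed

lemma lab_relab:
  assumes "inj_on f K" "ledges_in K q" "v \<in> K"
  shows "lab (map (relab f) q) (f v) = lab q v"
  using assms(2)
proof (induction q)
  case (Cons e q)
  obtain a b A B where e: "e = ((a, b), (A, B))" by (metis prod.exhaust)
  have "f a = f v \<longleftrightarrow> a = v" "f b = f v \<longleftrightarrow> b = v"
    using assms(1,3) Cons.prems by (auto simp: e ledges_in_def inj_on_eq_iff)
  then show ?case using Cons by (auto simp: lab_def e relab_def ledges_in_def)
qed simp

lemma wgt_relabel:
  assumes f: "inj_on f K" and es: "set es \<subseteq> K \<times> K"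
  shows "wgt cs w (f ` K) (map (map_prod f f) es) Y = wgt cs w K es (\<lambda>v. Y (f v))"
proof -
  have lab: "{q. map fst q = map (map_prod f f) es} = map (relab f) ` {q :: 'b ledge list. map fst q = es}"
  proof (intro set_eqI iffI)
    fix q :: "'b ledge list" assume "q \<in> {q. map fst q = map (map_prod f f) es}"
    then have q: "map fst q = map (map_prod f f) es" by simp
    then have l: "length q = length es" by (metis length_map)
    have "map (relab f) (zip es (map snd q)) = zip (map fst q) (map snd q)"
      unfolding q by (simp add: zip_map1 relab_def[abs_def] case_prod_unfold)
    then have "q = map (relab f) (zip es (map snd q))" by (simp only: zip_map_fst_snd)
    moreover have "map fst (zip es (map snd q)) = es" using l by simp
    ultimately show "q \<in> map (relab f) ` {q. map fst q = es}" by blast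
  next
    fix q :: "'b ledge list" assume "q \<in> map (relab f) ` {q. map fst q = es}"
    then show "q \<in> {q. map fst q = map (map_prod f f) es}" by (auto simp: relab_def)
  qed
  have inj: "inj_on (map (relab f)) {q :: 'b ledge list. map fst q = es}"
  proof (rule inj_onI)
    fix q r :: "'b ledge list"
    assume a: "q \<in> {q. map fst q = es}" "r \<in> {q. map fst q = es}" "map (relab f) q = map (relab f) r"
    have "map snd q = map snd (map (relab f) q)" by (simp add: relab_def comp_def)
    also have "\<dots> = map snd r" unfolding a(3) by (simp add: relab_def comp_def)
    finally have "zip (map fst q) (map snd q) = zip (map fst r) (map snd r)" using a(1,2) by simp
    then show "q = r" by (simp only: zip_map_fst_snd)
  qed
  have *: "cs (PInt w (f ` K) (map (relab f) q)) * (\<Prod>v\<in>f ` K. Y v (lab (map (relab f) q) v))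
        = cs (PInt w K q) * (\<Prod>v\<in>K. Y (f v) (lab q v))" if "map fst q = es" for q :: "'b ledge list"
  proof -
    have q: "ledges_in K q" unfolding ledges_in_def that by (rule es)
    have "(\<Prod>v\<in>f ` K. Y v (lab (map (relab f) q) v)) = (\<Prod>v\<in>K. Y (f v) (lab (map (relab f) q) (f v)))"
      by (subst prod.reindex[OF f]) simp
    also have "\<dots> = (\<Prod>v\<in>K. Y (f v) (lab q v))"
      by (intro prod.cong refl) (simp only: lab_relab[OF f q])
    finally show ?thesis unfolding PInt_relabel[OF f q] by simp
  qed
  have "wgt cs w (f ` K) (map (map_prod f f) es) Y
      = (\<Sum>q\<in>{q. map fst q = es}. cs (PInt w (f ` K) (map (relab f) q)) * (\<Prod>v\<in>f ` K. Y v (lab (map (relab f) q) v)))"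
    unfolding wgt_def lab by (rule sum.reindex[OF inj, unfolded comp_def])
  also have "\<dots> = wgt cs w K es (\<lambda>v. Y (f v))"
    unfolding wgt_def by (rule sum.cong[OF refl]) (rule *, simp)
  finally show ?thesis .
qed

text \<open>A vertex carries at most one barred variable and every edge takes one away.\<close>

lemma wgt_eq_0:
  assumes zero: "cs 0 = 0" and K: "finite K" and es: "set es \<subseteq> K \<times> K" "length es > card K"
    and Y: "\<And>v L. v \<in> K \<Longrightarrow> size (filter_mset (\<lambda>A. \<not> isl A) L) \<ge> 2 \<Longrightarrow> Y v L = 0"
  shows "wgt cs w K es Y = 0"
  unfolding wgt_def
proof (intro sum.neutral ballI)
  fix q :: "'b ledge list" assume "q \<in> {q. map fst q = es}"
  then have q: "map fst q = es" by simp
  let ?bars = "\<lambda>L. size (filter_mset (\<lambda>A. \<not> isl A) L)"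
  show "cs (PInt w K q) * (\<Prod>v\<in>K. Y v (lab q v)) = 0"
  \<comment> \<open>An edge labelled by two barred or two unbarred generators has coefficient 0. In
    the remaining labellings every edge carries exactly one barred derivative.\<close>
  proof (cases "\<forall>e\<in>set q. isl (fst (snd e)) \<noteq> isl (snd (snd e))")
    case True
    have "(\<Sum>v\<in>K. ?bars (lab r v)) = length r" if "set r \<subseteq> set q" for r
      using that
    proof (induction r)
      case (Cons e r)
      obtain a b A B where e: "e = ((a, b), (A, B))" by (metis prod.exhaust)
      have "e \<in> set q" using Cons.prems by simp
      then have "(a, b) \<in> set es" using q by (force simp: e)
      then have "a \<in> K" "b \<in> K" using es by auto
      have AB: "isl A \<noteq> isl B" using True \<open>e \<in> set q\<close> by (auto simp: e)
      have "(\<Sum>v\<in>K. ?bars (lab (e # r) v)) = (\<Sum>v\<in>K. (if v = a then of_bool (\<not> isl A) else 0) + (if v = b then of_bool (\<not> isl B) else 0) + ?bars (lab r v))"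
        by (intro sum.cong refl) (auto simp: lab_def e)
      also have "\<dots> = of_bool (\<not> isl A) + of_bool (\<not> isl B) + length r"
        using Cons K \<open>a \<in> K\<close> \<open>b \<in> K\<close> by (simp add: sum.distrib)
      finally show ?case using AB by auto
    qed simp
    then have tot: "(\<Sum>v\<in>K. ?bars (lab q v)) = length es" using q by (metis length_map order_refl)
    \<comment> \<open>Pigeonhole: there are as many barred derivatives as edges, hence more than
      vertices.\<close>
    have "\<exists>v\<in>K. ?bars (lab q v) \<ge> 2"
    proof (rule ccontr)
      assume "\<not> ?thesis"
      then have "(\<Sum>v\<in>K. ?bars (lab q v)) \<le> (\<Sum>v\<in>K. 1)" by (intro sum_mono) (metis Suc_1 not_less_eq_eq One_nat_def)
      then show False using tot es by simp
    qed
    then have "(\<Prod>v\<in>K. Y v (lab q v)) = 0" using Y K by (intro prod_zero) auto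
    then show ?thesis by simp
  next
    case False
    then obtain e where "e \<in> set q" "isl (fst (snd e)) = isl (snd (snd e))" by auto
    moreover obtain u v A B where "e = ((u, v), (A, B))" by (metis prod.exhaust)
    ultimately have "pc w \<theta> e = 0" for \<theta> by (cases A; cases B) (auto simp: pc_def)
    then have "prod_list (map (pc w \<theta>) q) = 0" for \<theta> using \<open>e \<in> set q\<close> by (force simp: prod_list_zero_iff)
    then show ?thesis by (simp add: PInt_def zero)
  qed
qed

section \<open>Decomposition into connected components\<close>

definition symedges :: "('v \<times> 'v) list \<Rightarrow> ('v \<times> 'v) set" where
  "symedges es = set es \<union> (set es)\<inverse>"

definition conn :: "'v set \<Rightarrow> ('v \<times> 'v) list \<Rightarrow> bool" where
  "conn K es \<longleftrightarrow> (\<forall>u\<in>K. \<forall>v\<in>K. (u, v) \<in> (symedges es)\<^sup>*)"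

definition component :: "('v \<times> 'v) list \<Rightarrow> 'v \<Rightarrow> 'v set" where
  "component es v = {u. (v, u) \<in> (symedges es)\<^sup>*}"

definition elists :: "'v set \<Rightarrow> nat \<Rightarrow> ('v \<times> 'v) list set" where
  "elists K N = {es. set es \<subseteq> K \<times> K \<and> length es \<le> N}"

lemma finite_elists [simp]: "finite K \<Longrightarrow> finite (elists K N)"
  unfolding elists_def by (rule finite_lists_length_le) simp

lemma sym_symedges: "sym ((symedges es)\<^sup>*)"
  by (rule sym_rtrancl) (auto simp: symedges_def sym_def)

lemma component_subset:
  assumes "set es \<subseteq> K \<times> K" "v \<in> K" shows "component es v \<subseteq> K"
proof
  fix u assume "u \<in> component es v"
  then have "(v, u) \<in> (symedges es)\<^sup>*" by (simp add: component_def)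
  then show "u \<in> K" by induction (use assms in \<open>auto simp: symedges_def\<close>)
qed

lemma component_edge:
  assumes "e \<in> set es" shows "fst e \<in> component es v \<longleftrightarrow> snd e \<in> component es v"
proof -
  have "(fst e, snd e) \<in> symedges es" "(snd e, fst e) \<in> symedges es"
    using assms by (auto simp: symedges_def)
  then show ?thesis unfolding component_def by (auto intro: rtrancl_into_rtrancl)
qed

text \<open>A path that starts at \<open>v\<close> never leaves the component, so all of its edges
  survive the filter.\<close>

lemma conn_component:
  "conn (component es v) (filter (\<lambda>e. fst e \<in> component es v) es)"
proof -
  let ?B = "component es v"
  let ?es = "filter (\<lambda>e. fst e \<in> ?B) es"
  have *: "(v, u) \<in> (symedges ?es)\<^sup>*" if "u \<in> ?B" for u
  proof -
    have "(v, u) \<in> (symedges es)\<^sup>*" using that by (simp add: component_def)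
    then show ?thesis
    proof induction
      case (step y z)
      then have "y \<in> ?B" "z \<in> ?B" by (auto simp: component_def intro: rtrancl_into_rtrancl)
      then have "(y, z) \<in> symedges ?es" using step(2) by (auto simp: symedges_def)
      then show ?case using step by simp
    qed simp
  qed
  show ?thesis unfolding conn_def
  proof (intro ballI)
    fix a b assume "a \<in> ?B" "b \<in> ?B"
    then have "(a, v) \<in> (symedges ?es)\<^sup>*" "(v, b) \<in> (symedges ?es)\<^sup>*"
      using symD[OF sym_symedges *[of a]] *[of b] by blast+
    then show "(a, b) \<in> (symedges ?es)\<^sup>*" by simp
  qed
qed

text \<open>Recognises the component from the two parts of an edge list: a set that contains
  \<open>v\<close>, is connected by its own edges and is not crossed by any edge. It serves to
  compute the fibres of the decomposition.\<close>

lemma component_eq: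
  assumes B: "v \<in> B" "conn B (filter (\<lambda>e. fst e \<in> B) es)"
    and closed: "\<And>e. e \<in> set es \<Longrightarrow> fst e \<in> B \<longleftrightarrow> snd e \<in> B"
  shows "component es v = B"
proof
  show "component es v \<subseteq> B"
  proof
    fix u assume "u \<in> component es v"
    then have "(v, u) \<in> (symedges es)\<^sup>*" by (simp add: component_def)
    then show "u \<in> B" by induction (use B closed in \<open>force simp: symedges_def\<close>)+
  qed
  show "B \<subseteq> component es v"
  proof
    fix u assume "u \<in> B"
    then have "(v, u) \<in> (symedges (filter (\<lambda>e. fst e \<in> B) es))\<^sup>*" using B by (auto simp: conn_def)
    moreover have "symedges (filter (\<lambda>e. fst e \<in> B) es) \<subseteq> symedges es" by (auto simp: symedges_def)
    ultimately show "u \<in> component es v" unfolding component_def using rtrancl_mono by blast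
  qed
qed

lemma symedges_map: "(u, v) \<in> (symedges es)\<^sup>* \<Longrightarrow> (f u, f v) \<in> (symedges (map (map_prod f f) es))\<^sup>*"
proof (induction rule: rtrancl_induct)
  case (step y z)
  then have "(f y, f z) \<in> symedges (map (map_prod f f) es)" by (force simp: symedges_def)
  then show ?case using step by simp
qed simp

lemma conn_map:
  assumes "inj_on f K" "set es \<subseteq> K \<times> K"
  shows "conn (f ` K) (map (map_prod f f) es) \<longleftrightarrow> conn K es"
proof
  assume c: "conn (f ` K) (map (map_prod f f) es)"
  let ?g = "inv_into K f"
  have es: "map (map_prod ?g ?g) (map (map_prod f f) es) = es"
    unfolding map_map by (rule map_idI) (use assms in \<open>auto simp: inv_into_f_f\<close>)
  show "conn K es" unfolding conn_def
  proof (intro ballI)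
    fix u v assume uv: "u \<in> K" "v \<in> K"
    then have "(f u, f v) \<in> (symedges (map (map_prod f f) es))\<^sup>*" using c by (auto simp: conn_def)
    from symedges_map[OF this, of ?g] show "(u, v) \<in> (symedges es)\<^sup>*"
      unfolding es using uv assms by (simp add: inv_into_f_f)
  qed
next
  assume "conn K es"
  then show "conn (f ` K) (map (map_prod f f) es)" by (auto simp: conn_def intro: symedges_map)
qed

text \<open>Edge lists with prescribed parts inside and outside a vertex set are the interleavings
  of the two parts, and these are counted by a binomial coefficient.\<close>

lemma filter_eq_shuffles:
  assumes "\<forall>x\<in>set xs. P x" "\<forall>x\<in>set ys. \<not> P x"
  shows "{zs. filter P zs = xs \<and> filter (\<lambda>x. \<not> P x) zs = ys} = shuffles xs ys"
proof (intro set_eqI iffI)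
  fix zs assume "zs \<in> {zs. filter P zs = xs \<and> filter (\<lambda>x. \<not> P x) zs = ys}"
  then show "zs \<in> shuffles xs ys" using partition_in_shuffles[of zs P] by auto
next
  fix zs assume zs: "zs \<in> shuffles xs ys"
  have "filter P zs \<in> filter P ` shuffles xs ys" "filter (\<lambda>x. \<not> P x) zs \<in> filter (\<lambda>x. \<not> P x) ` shuffles xs ys"
    using zs by auto
  moreover have "filter P xs = xs" "filter P ys = []" "filter (\<lambda>x. \<not> P x) xs = []" "filter (\<lambda>x. \<not> P x) ys = ys"
    using assms by (auto simp: filter_empty_conv)
  ultimately show "zs \<in> {zs. filter P zs = xs \<and> filter (\<lambda>x. \<not> P x) zs = ys}"
    unfolding filter_shuffles by simp
qed

text \<open>The properties of weights from which the passage to connected lists follows.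
  \<open>F_zero\<close> is the geometric input: it bounds the number of edges.\<close>

locale edge_weight =
  fixes F :: "nat set \<Rightarrow> (nat \<times> nat) list \<Rightarrow> 'r::comm_ring_1" and cs :: "complex \<Rightarrow> 'r"
  assumes F_mset: "mset es = mset es' \<Longrightarrow> F K es = F K es'"
    and F_append: "finite K \<Longrightarrow> finite L \<Longrightarrow> K \<inter> L = {} \<Longrightarrow> set es \<subseteq> K \<times> K \<Longrightarrow> set es' \<subseteq> L \<times> L \<Longrightarrow>
      F (K \<union> L) (es @ es') = F K es * F L es'"
    and F_relabel: "finite K \<Longrightarrow> inj_on f K \<Longrightarrow> set es \<subseteq> K \<times> K \<Longrightarrow> F (f ` K) (map (map_prod f f) es) = F K es"
    and F_zero: "finite K \<Longrightarrow> set es \<subseteq> K \<times> K \<Longrightarrow> length es > card K \<Longrightarrow> F K es = 0"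
    and F_empty: "F {} [] = 1"
    and cs_hom: "cs (a + b) = cs a + cs b" "cs (a * b) = cs a * cs b" "cs 1 = 1"
begin

lemma cs_of_nat: "cs (of_nat n) = of_nat n"
proof (induction n)
  case 0
  have "cs 0 + cs 0 = cs 0 + 0" by (simp flip: cs_hom)
  then show ?case by (metis add_left_imp_eq of_nat_0)
qed (simp add: cs_hom)

definition term_of :: "nat set \<Rightarrow> (nat \<times> nat) list \<Rightarrow> 'r" where
  "term_of K es = cs (1 / fact (length es)) * F K es"

text \<open>By \<open>F_zero\<close> the cut-off at \<open>card K\<close> edges is exact, so a
  finite sum replaces the sum over lists of all lengths.\<close>

definition Zsum :: "nat set \<Rightarrow> 'r" where
  "Zsum K = (\<Sum>es\<in>elists K (card K). term_of K es)"

definition Csum :: "nat set \<Rightarrow> 'r" where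
  "Csum K = (\<Sum>es\<in>{es \<in> elists K (card K). conn K es}. term_of K es)"

lemma Zsum_bound:
  assumes "finite K" "card K \<le> N"
  shows "Zsum K = (\<Sum>es\<in>elists K N. term_of K es)"
  unfolding Zsum_def using assms
  by (intro sum.mono_neutral_left finite_elists) (auto simp: elists_def term_of_def F_zero not_le)

lemma Csum_bound:
  assumes "finite K" "card K \<le> N"
  shows "Csum K = (\<Sum>es\<in>{es \<in> elists K N. conn K es}. term_of K es)"
proof -
  have "term_of K es = 0" if "es \<in> elists K N" "\<not> es \<in> elists K (card K)" for es
    using that F_zero[of K es] assms by (auto simp: elists_def term_of_def)
  moreover have "finite {es \<in> elists K N. conn K es}"
    using assms by (intro finite_subset[OF _ finite_elists[of K N]]) auto
  moreover have "elists K (card K) \<subseteq> elists K N" using assms by (auto simp: elists_def)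
  ultimately show ?thesis unfolding Csum_def by (intro sum.mono_neutral_left) auto
qed

text \<open>All binom(a + b, a) shuffles have the same term, and binom(a + b, a) / (a + b)! = 1/a! *
  1/b!. The factor 1/l! from the exponential of the propagator is thus what makes the terms
  multiplicative.\<close>

lemma sum_shuffles:
  assumes K: "finite K" "B \<subseteq> K" "set xs \<subseteq> B \<times> B" "set ys \<subseteq> (K - B) \<times> (K - B)"
  shows "(\<Sum>zs\<in>shuffles xs ys. term_of K zs) = term_of B xs * term_of (K - B) ys"
proof -
  let ?a = "length xs" and ?b = "length ys"
  have "term_of K zs = cs (1 / fact (?a + ?b)) * (F B xs * F (K - B) ys)" if "zs \<in> shuffles xs ys" for zs
  proof -
    have "mset zs = mset (xs @ ys)" using mset_shuffles[OF that] by simp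
    then have "F K zs = F (B \<union> (K - B)) (xs @ ys)" using K(2) by (simp add: F_mset Un_absorb1 Un_Diff_cancel)
    also have "\<dots> = F B xs * F (K - B) ys"
      using K finite_subset by (intro F_append) auto
    finally show ?thesis using length_shuffles[OF that] by (simp add: term_of_def)
  qed
  then have "(\<Sum>zs\<in>shuffles xs ys. term_of K zs)
      = of_nat (card (shuffles xs ys)) * (cs (1 / fact (?a + ?b)) * (F B xs * F (K - B) ys))" by simp
  also have "card (shuffles xs ys) = (?a + ?b) choose ?a"
    by (rule card_disjoint_shuffles) (use K in auto)
  also have "of_nat ((?a + ?b) choose ?a) * (cs (1 / fact (?a + ?b)) * (F B xs * F (K - B) ys))
      = cs (of_nat ((?a + ?b) choose ?a) * (1 / fact (?a + ?b))) * (F B xs * F (K - B) ys)"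
    by (simp only: cs_hom cs_of_nat mult.assoc)
  also have "of_nat ((?a + ?b) choose ?a) * (1 / fact (?a + ?b)) = (1 / fact ?a) * (1 / fact ?b :: complex)"
    by (simp add: binomial_fact)
  finally show ?thesis by (simp only: term_of_def cs_hom mult_ac)
qed

text \<open>A list is sent to the component of \<open>v0\<close>, its edges inside and its edges
  outside that component. The fibres of this map are sets of shuffles.\<close>

theorem component_recursion:
  assumes K: "finite K" "v0 \<in> K"
  shows "Zsum K = (\<Sum>B\<in>{B. v0 \<in> B \<and> B \<subseteq> K}. Csum B * Zsum (K - B))"
proof -
  let ?N = "card K"
  define \<pi> where "\<pi> es = (let B = component es v0 in
    (B, filter (\<lambda>e. fst e \<in> B) es, filter (\<lambda>e. \<not> fst e \<in> B) es))" for es :: "(nat \<times> nat) list"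
  let ?B = "{B. v0 \<in> B \<and> B \<subseteq> K}"
  let ?T = "SIGMA B:?B. {es \<in> elists B ?N. conn B es} \<times> elists (K - B) ?N"
  have finB: "finite ?B" using K by (auto intro: finite_subset[of _ "Pow K"])
  have fin: "finite B" if "B \<in> ?B" for B using that K finite_subset by auto
  have finT: "finite ?T" using finB fin K by (intro finite_SigmaI) auto
  have sub: "\<pi> ` elists K ?N \<subseteq> ?T"
  proof (rule image_subsetI)
    fix es assume es: "es \<in> elists K ?N"
    let ?C = "component es v0"
    have "v0 \<in> ?C" by (simp add: component_def)
    moreover have "?C \<subseteq> K" using es K by (intro component_subset) (auto simp: elists_def)
    moreover have "set (filter (\<lambda>e. fst e \<in> ?C) es) \<subseteq> ?C \<times> ?C"
      using component_edge[of _ es v0] by force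
    moreover have "set (filter (\<lambda>e. \<not> fst e \<in> ?C) es) \<subseteq> (K - ?C) \<times> (K - ?C)"
      using es component_edge[of _ es v0] by (force simp: elists_def)
    moreover have "length (filter (\<lambda>e. fst e \<in> ?C) es) \<le> ?N" "length (filter (\<lambda>e. \<not> fst e \<in> ?C) es) \<le> ?N"
      using es by (auto simp: elists_def intro: order_trans[OF length_filter_le])
    ultimately show "\<pi> es \<in> ?T" using conn_component by (auto simp: \<pi>_def Let_def elists_def)
  qed
  have fibre: "(\<Sum>es\<in>{es \<in> elists K ?N. \<pi> es = t}. term_of K es)
      = term_of (fst t) (fst (snd t)) * term_of (K - fst t) (snd (snd t))" if t: "t \<in> ?T" for t
  proof -
    obtain B xs ys where t': "t = (B, xs, ys)" by (cases t)
    have B: "v0 \<in> B" "B \<subseteq> K" and xs: "set xs \<subseteq> B \<times> B" "conn B xs"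
      and ys: "set ys \<subseteq> (K - B) \<times> (K - B)" using t by (auto simp: t' elists_def)
    have "\<pi> es = t \<longleftrightarrow> es \<in> shuffles xs ys" for es
    proof -
      have sh: "es \<in> shuffles xs ys \<longleftrightarrow> filter (\<lambda>e. fst e \<in> B) es = xs \<and> filter (\<lambda>e. \<not> fst e \<in> B) es = ys"
      proof -
        have "{zs. filter (\<lambda>e. fst e \<in> B) zs = xs \<and> filter (\<lambda>e. \<not> fst e \<in> B) zs = ys} = shuffles xs ys"
          by (rule filter_eq_shuffles) (use xs ys in auto)
        then show ?thesis by auto
      qed
      have "component es v0 = B" if f: "filter (\<lambda>e. fst e \<in> B) es = xs" "filter (\<lambda>e. \<not> fst e \<in> B) es = ys"
      proof (rule component_eq)
        fix e assume "e \<in> set es"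
        then have "e \<in> set xs \<or> e \<in> set ys" using f by (cases "fst e \<in> B") auto
        then show "fst e \<in> B \<longleftrightarrow> snd e \<in> B" using xs ys by auto
      qed (use B xs f in auto)
      then show ?thesis unfolding sh by (auto simp: \<pi>_def t' Let_def)
    qed
    moreover have "es \<in> elists K ?N \<longleftrightarrow> length xs + length ys \<le> ?N" if "es \<in> shuffles xs ys" for es
      using length_shuffles[OF that] set_shuffles[OF that] xs ys B by (auto simp: elists_def)
    ultimately have eq: "{es \<in> elists K ?N. \<pi> es = t} = (if length xs + length ys \<le> ?N then shuffles xs ys else {})"
      by auto
    show ?thesis
    proof (cases "length xs + length ys \<le> ?N")
      case True
      then show ?thesis unfolding eq using sum_shuffles[OF K(1) B(2) xs(1) ys] by (simp add: t')
    next
      \<comment> \<open>The fibre is empty because the cut-off excludes such long lists. The other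
        side vanishes too, since one of the two parts has more edges than vertices.\<close>
      case False
      have "card K = card B + card (K - B)"
        using K B by (metis card_Diff_subset card_mono finite_subset le_add_diff_inverse)
      then have "length xs > card B \<or> length ys > card (K - B)" using False by linarith
      then have "term_of B xs * term_of (K - B) ys = 0"
        using F_zero[of B xs] F_zero[of "K - B" ys] xs ys B K finite_subset[of B K] by (auto simp: term_of_def)
      then show ?thesis unfolding eq using False by (simp add: t')
    qed
  qed
  have "Zsum K = (\<Sum>t\<in>?T. \<Sum>es\<in>{es \<in> elists K ?N. \<pi> es = t}. term_of K es)"
    unfolding Zsum_def by (rule sum.group[symmetric]) (use K finT sub in auto)
  also have "\<dots> = (\<Sum>t\<in>?T. term_of (fst t) (fst (snd t)) * term_of (K - fst t) (snd (snd t)))"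
    by (rule sum.cong[OF refl fibre])
  also have "\<dots> = (\<Sum>B\<in>?B. \<Sum>p\<in>{es \<in> elists B ?N. conn B es} \<times> elists (K - B) ?N. term_of B (fst p) * term_of (K - B) (snd p))"
    using finB fin K by (subst sum.Sigma) (auto simp: case_prod_unfold)
  also have "\<dots> = (\<Sum>B\<in>?B. Csum B * Zsum (K - B))"
  proof (intro sum.cong refl)
    fix B assume B: "B \<in> ?B"
    have "card B \<le> ?N" "card (K - B) \<le> ?N" using B K by (auto intro: card_mono)
    then have "Csum B * Zsum (K - B) = (\<Sum>es\<in>{es \<in> elists B ?N. conn B es}. term_of B es) * (\<Sum>es\<in>elists (K - B) ?N. term_of (K - B) es)"
      using Csum_bound[of B ?N] Zsum_bound[of "K - B" ?N] fin[OF B] K by simp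
    then show "(\<Sum>p\<in>{es \<in> elists B ?N. conn B es} \<times> elists (K - B) ?N. term_of B (fst p) * term_of (K - B) (snd p)) = Csum B * Zsum (K - B)"
      by (simp add: sum_product sum.cartesian_product case_prod_unfold)
  qed
  finally show ?thesis .
qed

lemma elists_image:
  assumes "inj_on f K"
  shows "elists (f ` K) N = map (map_prod f f) ` elists K N"
proof (intro set_eqI iffI)
  fix es assume es: "es \<in> elists (f ` K) N"
  let ?g = "inv_into K f"
  have "map (map_prod f f) (map (map_prod ?g ?g) es) = es"
    unfolding map_map by (rule map_idI) (use es assms in \<open>force simp: elists_def f_inv_into_f\<close>)
  moreover have "map (map_prod ?g ?g) es \<in> elists K N" using es by (force simp: elists_def inv_into_into)
  ultimately show "es \<in> map (map_prod f f) ` elists K N" by (metis image_eqI)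
qed (force simp: elists_def)

lemma inj_on_map_elists:
  assumes "inj_on f K" shows "inj_on (map (map_prod f f)) (elists K N)"
proof (rule inj_on_mapI)
  have "inj_on (map_prod f f) (K \<times> K)" using assms by (rule map_prod_inj_on) (rule assms)
  then show "inj_on (map_prod f f) (\<Union> (set ` elists K N))"
    by (rule inj_on_subset) (auto simp: elists_def)
qed

lemma Zsum_Csum_relabel:
  assumes "finite K" "inj_on f K"
  shows "Zsum (f ` K) = Zsum K" "Csum (f ` K) = Csum K"
proof -
  have t: "term_of (f ` K) (map (map_prod f f) es) = term_of K es" if "es \<in> elists K N" for es N
    using that assms F_relabel by (simp add: term_of_def elists_def)
  have c: "card (f ` K) = card K" using assms by (simp add: card_image)
  show "Zsum (f ` K) = Zsum K"
    unfolding Zsum_def elists_image[OF assms(2)] c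
    by (subst sum.reindex[OF inj_on_map_elists[OF assms(2)]]) (simp add: t)
  have "{es \<in> elists (f ` K) (card K). conn (f ` K) es} = map (map_prod f f) ` {es \<in> elists K (card K). conn K es}"
    unfolding elists_image[OF assms(2)] using conn_map[OF assms(2)] by (auto simp: elists_def)
  moreover have "inj_on (map (map_prod f f)) {es \<in> elists K (card K). conn K es}"
    by (rule inj_on_subset[OF inj_on_map_elists[OF assms(2)]]) auto
  ultimately show "Csum (f ` K) = Csum K"
    unfolding Csum_def c by (simp only: sum.reindex comp_def) (intro sum.cong refl t[of _ "card K"], auto)
qed

lemma Zsum_Csum_card:
  assumes "finite K" shows "Zsum K = Zsum {..<card K}" "Csum K = Csum {..<card K}"
proof -
  obtain f where "bij_betw f {..<card K} K" using ex_bij_betw_nat_finite[OF assms] by (auto simp: lessThan_atLeast0)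
  then have "inj_on f {..<card K}" "K = f ` {..<card K}" by (auto simp: bij_betw_def)
  then show "Zsum K = Zsum {..<card K}" "Csum K = Csum {..<card K}"
    using Zsum_Csum_relabel[of "{..<card K}" f] by auto
qed

text \<open>The distinguished vertex is \<open>n\<close>. The other \<open>d\<close> vertices of its
  component are chosen among \<open>n\<close>, and by invariance under renaming only their number
  matters.\<close>

lemma Zsum_rec:
  "Zsum {..<Suc n} = (\<Sum>d\<le>n. of_nat (n choose d) * (Csum {..<Suc d} * Zsum {..<n - d}))"
proof -
  let ?K = "{..<Suc n}"
  let ?g = "\<lambda>d. Csum {..<Suc d} * Zsum {..<n - d}"
  have "Zsum ?K = (\<Sum>B\<in>{B. n \<in> B \<and> B \<subseteq> ?K}. Csum B * Zsum (?K - B))"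
    by (rule component_recursion) auto
  also have "\<dots> = (\<Sum>D\<in>Pow {..<n}. ?g (card D))"
  proof (rule sum.reindex_bij_witness[of _ "insert n" "\<lambda>B. B - {n}"])
    fix B assume B: "B \<in> {B. n \<in> B \<and> B \<subseteq> ?K}"
    then have f: "finite B" using finite_subset by auto
    have c: "card B = Suc (card (B - {n}))" using B f by (metis (no_types, lifting) card_Suc_Diff1 mem_Collect_eq)
    moreover have "card (?K - B) = Suc n - card B" using B f by (subst card_Diff_subset) auto
    ultimately show "?g (card (B - {n})) = Csum B * Zsum (?K - B)"
      using Zsum_Csum_card(2)[OF f] Zsum_Csum_card(1)[of "?K - B"] by simp
  qed (auto simp: less_Suc_eq)
  also have "\<dots> = (\<Sum>d\<le>n. \<Sum>D\<in>{D \<in> Pow {..<n}. card D = d}. ?g (card D))"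
    by (rule sum.group[symmetric]) (auto dest: card_mono[rotated])
  also have "\<dots> = (\<Sum>d\<le>n. of_nat (n choose d) * ?g d)"
  proof (intro sum.cong refl)
    fix d
    have "card {D \<in> Pow {..<n}. card D = d} = n choose d"
      using n_subsets[of "{..<n}" d] by (simp add: Pow_def)
    then show "(\<Sum>D\<in>{D \<in> Pow {..<n}. card D = d}. ?g (card D)) = of_nat (n choose d) * ?g d" by simp
  qed
  finally show ?thesis .
qed

lemma Zsum_0: "Zsum {} = 1"
proof -
  have "elists {} 0 = {[] :: (nat \<times> nat) list}" by (auto simp: elists_def)
  then show ?thesis by (simp add: Zsum_def term_of_def F_empty cs_hom)
qed

end

section \<open>The exponential series\<close>

text \<open>The form degree on the base.\<close>

definition deg :: "'n idx \<Rightarrow> nat" where "deg m = card (fst m)"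

lemma deg_splits: "(x, y) \<in> splits m \<Longrightarrow> deg m = deg x + deg y"
  for m :: "'n::finite idx"
  by (auto simp: deg_def splits_def idx_join_def idx_disj_def card_Un_disjoint)

text \<open>The derivation that scales by form degree. It kills degree 0 and is injective on
  positive degrees, so an equation between Euler derivatives can be solved degree by degree.\<close>

definition euler :: "('n, 'c::comm_ring_1) elt \<Rightarrow> ('n, 'c) elt" where
  "euler a = (\<lambda>m. of_nat (deg m) * a m)"

lemma euler_mult:
  fixes a b :: "('n::{finite,linorder}, 'c::comm_ring_1) elt"
  shows "euler (elt_mult a b) m = elt_mult (euler a) b m + elt_mult a (euler b) m"
proof -
  have "euler (elt_mult a b) m = (\<Sum>(x, y)\<in>splits m. idx_sgn x y * (of_nat (deg x) * a x) * b y + idx_sgn x y * a x * (of_nat (deg y) * b y))"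
    unfolding euler_def elt_mult_splits sum_distrib_left
    by (intro sum.cong refl) (auto dest: deg_splits simp: algebra_simps)
  then show ?thesis
    by (simp add: euler_def elt_mult_splits sum.distrib case_prod_unfold)
qed

lemma even_elt_euler: "even_elt a \<Longrightarrow> even_elt (euler a)"
  by (auto simp: even_elt_def euler_def)

text \<open>The power rule of a derivation; evenness lets \<open>euler a\<close> be moved to the
  front past the other factors \<open>a\<close>.\<close>

lemma euler_pow:
  fixes a :: "('n::{finite,linorder}, 'c::comm_ring_1) elt"
  assumes a: "even_elt a"
  shows "euler (elt_pow a (Suc k)) m = of_nat (Suc k) * elt_mult (euler a) (elt_pow a k) m"
proof (induction k arbitrary: m)
  case 0
  have "euler (mon {} {#} {}) = (\<lambda>m. 0 :: 'c)" by (auto simp: euler_def mon_def deg_def)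
  then show ?case by (simp add: elt_mult_one)
next
  case (Suc k)
  have e: "euler (elt_pow a (Suc k)) = (\<lambda>m. of_nat (Suc k) * elt_mult (euler a) (elt_pow a k) m)"
    using Suc by blast
  have "elt_mult a (euler (elt_pow a (Suc k))) m = of_nat (Suc k) * elt_mult a (elt_mult (euler a) (elt_pow a k)) m"
    unfolding e by (simp add: elt_mult_splits[of a] sum_distrib_left case_prod_unfold mult_ac)
  also have "elt_mult a (elt_mult (euler a) (elt_pow a k)) = elt_mult (euler a) (elt_pow a (Suc k))"
    using elt_mult_commute[OF a even_elt_euler[OF a]] by (simp flip: elt_mult_assoc)
  finally show ?case
    using euler_mult[of a "elt_pow a (Suc k)" m] by (simp add: algebra_simps)
qed

text \<open>Every factor has form degree at least 1, and degrees add.\<close>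

lemma elt_pow_eq_0:
  fixes a :: "('n::{finite,linorder}, 'c::comm_ring_1) elt"
  assumes a: "\<And>m. deg m = 0 \<Longrightarrow> a m = 0"
  shows "deg m < k \<Longrightarrow> elt_pow a k m = 0"
proof (induction k arbitrary: m)
  case (Suc k)
  have "idx_sgn x y * a x * elt_pow a k y = 0" if "(x, y) \<in> splits m" for x y
  proof (cases "deg x = 0")
    case False
    then have "deg y < k" using deg_splits[OF that] Suc.prems by simp
    then show ?thesis using Suc.IH by simp
  qed (simp add: a)
  then show ?case by (simp add: elt_mult_splits case_prod_unfold sum.neutral)
qed simp

lemma elt_exp_sum:
  fixes x :: "('n::{finite,linorder}, complex fls) elt"
  assumes "\<And>m. deg m = 0 \<Longrightarrow> x m = 0" "deg m \<le> N"
  shows "elt_exp x m = (\<Sum>l\<le>N. fls_const (1 / fact l) * elt_pow x l m)"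
proof -
  have "elt_pow x l m = 0" if "\<not> l \<le> N" for l
    using that assms by (intro elt_pow_eq_0) auto
  then show ?thesis unfolding elt_exp_def
    by (intro Sum_any.expand_superset) auto
qed

lemma elt_mult_cong:
  assumes "\<And>x y. (x, y) \<in> splits m \<Longrightarrow> a x * b y = a' x * b' y"
  shows "elt_mult a b m = elt_mult a' b' (m :: 'n::{finite,linorder} idx)"
  unfolding elt_mult_splits
  by (intro sum.cong refl) (auto simp: mult.assoc assms)

text \<open>In degree d > 0 the exponential is \<open>x\<close> plus terms that involve
  \<open>x\<close> only in degrees below d, so the exponential determines \<open>x\<close> by
  induction on the degree. This gives the uniqueness behind the \<open>THE\<close> in
  \<open>gamma_infinity\<close>.\<close>

theorem elt_exp_inj:
  fixes x y :: "('n::{finite,linorder}, complex fls) elt"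
  assumes x: "\<And>m. deg m = 0 \<Longrightarrow> x m = 0" and y: "\<And>m. deg m = 0 \<Longrightarrow> y m = 0"
    and eq: "elt_exp x = elt_exp y"
  shows "x = y"
proof
  fix m :: "'n idx"
  show "x m = y m"
  proof (induction "deg m" arbitrary: m rule: less_induct)
    case (less m)
    have IH: "x a = y a" if "deg a < deg m" for a using that less by blast
    have pow: "elt_pow x l a = elt_pow y l a" if "deg a < deg m" for l a
      using that
    proof (induction l arbitrary: a)
      case (Suc l)
      show ?case unfolding elt_pow.simps
        by (rule elt_mult_cong) (use Suc IH in \<open>auto dest!: deg_splits\<close>)
    qed simp
    \<comment> \<open>In a product of at least two factors, each vanishing in degree 0, only degrees
      below that of \<open>m\<close> can contribute, and the induction covers those.\<close>
    have pow2: "elt_pow x (Suc (Suc l)) m = elt_pow y (Suc (Suc l)) m" for l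
      unfolding elt_pow.simps(2)[of _ "Suc l"]
    proof (rule elt_mult_cong)
      fix a b assume ab: "(a, b) \<in> splits m"
      note d = deg_splits[OF ab]
      consider "deg a = 0" | "deg b = 0" | "deg a < deg m" "deg b < deg m" using d by linarith
      then show "x a * elt_pow x (Suc l) b = y a * elt_pow y (Suc l) b"
      proof cases
        case 2
        then have "elt_pow x (Suc l) b = 0" "elt_pow y (Suc l) b = 0"
          using elt_pow_eq_0[of x b "Suc l"] elt_pow_eq_0[of y b "Suc l"] x y by auto
        then show ?thesis by simp
      next
        case 3
        then show ?thesis by (simp only: IH pow)
      qed (simp add: x y)
    qed
    show ?case
    proof (cases "deg m = 0")
      case False
      then obtain n where n: "deg m = Suc n" by (cases "deg m") auto
      have E: "elt_exp u m = fls_const (1 / fact 0) * elt_pow u 0 m + (fls_const (1 / fact 1) * elt_pow u 1 m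
          + (\<Sum>l<n. fls_const (1 / fact (Suc (Suc l))) * elt_pow u (Suc (Suc l)) m))"
        if "\<And>m. deg m = 0 \<Longrightarrow> u m = 0" for u
      proof -
        have s: "(\<Sum>l\<le>Suc n. h l) = h 0 + (h 1 + (\<Sum>l<n. h (Suc (Suc l))))" for h :: "nat \<Rightarrow> complex fls"
          unfolding lessThan_Suc_atMost[symmetric] sum.lessThan_Suc_shift by simp
        show ?thesis using elt_exp_sum[where x = u and m = m and N = "Suc n", OF that] n unfolding s by simp
      qed
      have "elt_exp x m = elt_exp y m" using eq by simp
      then show ?thesis
        unfolding E[where u = x, OF x, simplified] E[where u = y, OF y, simplified] pow2[simplified]
        by (simp add: elt_mult_one)
    qed (use x y in auto)
  qed
qed

lemma of_nat_fls_cancel: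
  fixes x y :: "complex fls"
  assumes "of_nat (Suc n) * x = of_nat (Suc n) * y" shows "x = y"
proof -
  have "fls_const (1 / of_nat (Suc n)) * (of_nat (Suc n) * x) = x" for x :: "complex fls"
    by (simp add: fls_of_nat fls_const_mult_const flip: mult.assoc del: of_nat_Suc)
  then show ?thesis using assms by metis
qed

text \<open>As \<open>C n\<close> lives in form degree \<open>n\<close>, the series of all C_n / n!
  has a single term in each coefficient; this is \<open>c\<close>. The recursion is the Euler
  equation for the series of Z_n / n!, written coefficientwise, and \<open>Z 0\<close> is the
  initial value.\<close>

theorem elt_exp_eq:
  fixes C Z :: "nat \<Rightarrow> ('n::{finite,linorder}, complex fls) elt"
  assumes C: "\<And>n m. deg m \<noteq> n \<Longrightarrow> C n m = 0" "\<And>n. even_elt (C n)"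
    and Z: "\<And>n m. deg m \<noteq> n \<Longrightarrow> Z n m = 0" "Z 0 = mon {} {#} {}"
    and rec: "\<And>n m. Z (Suc n) m = (\<Sum>d\<le>n. of_nat (n choose d) * elt_mult (C (Suc d)) (Z (n - d)) m)"
    and c: "\<And>m. c m = (if deg m = 0 then 0 else fls_const (1 / fact (deg m)) * C (deg m) m)"
  shows "elt_exp c m = fls_const (1 / fact (deg m)) * Z (deg m) m"
proof -
  have c0: "c m = 0" if "deg m = 0" for m using that c by simp
  have ev: "even_elt c" using C(2) by (auto simp: even_elt_def c)
  define z where "z m = fls_const (1 / fact (deg m)) * Z (deg m) m" for m
  have Ez: "euler z m = elt_mult (euler c) z m" for m
  proof (cases "deg m")
    case 0
    have "euler c x = 0" if "(x, y) \<in> splits m" for x y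
      using deg_splits[OF that] 0 by (simp add: euler_def)
    then have "elt_mult (euler c) z m = 0"
      unfolding elt_mult_splits by (intro sum.neutral) auto
    then show ?thesis using 0 by (simp add: euler_def)
  next
    case (Suc k)
    \<comment> \<open>The Euler factor k + 1 turns 1/(k+1)! into 1/k!. Together with the binomial
      coefficient this splits into 1/j! and 1/(k-j)!, one factorial for each series.\<close>
    have f: "of_nat (Suc k) * fls_const (1 / fact (Suc k)) = (fls_const (1 / fact k) :: complex fls)" for k
      by (simp add: fls_of_nat fls_const_mult_const del: of_nat_Suc)
    have "euler z m = fls_const (1 / fact k) * Z (Suc k) m"
      unfolding euler_def z_def Suc by (simp only: f mult.assoc[symmetric])
    also have "\<dots> = (\<Sum>d\<le>k. \<Sum>(x, y)\<in>splits m. fls_const (1 / fact k) * of_nat (k choose d) * (idx_sgn x y * C (Suc d) x * Z (k - d) y))"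
      unfolding rec elt_mult_splits by (simp add: sum_distrib_left case_prod_unfold mult.assoc)
    also have "\<dots> = (\<Sum>(x, y)\<in>splits m. \<Sum>d\<le>k. fls_const (1 / fact k) * of_nat (k choose d) * (idx_sgn x y * C (Suc d) x * Z (k - d) y))"
      by (subst sum.swap) (simp add: case_prod_unfold)
    also have "\<dots> = elt_mult (euler c) z m"
      unfolding elt_mult_splits
    proof (intro sum.cong refl, clarify)
      fix x y :: "'n idx" assume xy: "(x, y) \<in> splits m"
      let ?f = "\<lambda>d. fls_const (1 / fact k) * of_nat (k choose d) * (idx_sgn x y * C (Suc d) x * Z (k - d) y)"
      note d = deg_splits[OF xy, unfolded Suc]
      show "(\<Sum>d\<le>k. ?f d) = idx_sgn x y * euler c x * z y"
      proof (cases "deg x")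
        case 0
        then show ?thesis using C(1) by (simp add: euler_def)
      next
        case dx: (Suc j)
        have j: "j \<le> k" "deg y = k - j" using d dx by auto
        have "(\<Sum>d\<le>k. ?f d) = (\<Sum>d\<le>k. if d = j then ?f j else 0)"
          using C(1) dx by (intro sum.cong refl) auto
        also have "\<dots> = ?f j" using j by simp
        also have "fls_const (1 / fact k) * of_nat (k choose j) = (fls_const (1 / fact j) * fls_const (1 / fact (k - j)) :: complex fls)"
          using j by (simp add: fls_of_nat fls_const_mult_const binomial_fact)
        also have "fls_const (1 / fact j) * fls_const (1 / fact (k - j)) * (idx_sgn x y * C (Suc j) x * Z (k - j) y)
            = idx_sgn x y * (fls_const (1 / fact j) * C (Suc j) x) * (fls_const (1 / fact (k - j)) * Z (k - j) y)"
          by (simp only: mult_ac)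
        also have "fls_const (1 / fact j) * C (Suc j) x = euler c x"
          unfolding euler_def c dx by (simp only: f mult.assoc[symmetric] nat.simps if_False)
        also have "fls_const (1 / fact (k - j)) * Z (k - j) y = z y"
          unfolding z_def j(2) ..
        finally show ?thesis .
      qed
    qed
    finally show ?thesis .
  qed
  have Ee: "euler (elt_exp c) m = elt_mult (euler c) (elt_exp c) m" for m
  proof -
    let ?n = "deg m"
    have st: "fls_const (1 / fact (Suc l)) * euler (elt_pow c (Suc l)) m = fls_const (1 / fact l) * elt_mult (euler c) (elt_pow c l) m" for l
      unfolding euler_pow[OF ev] mult.assoc[symmetric]
      by (simp add: fls_of_nat fls_const_mult_const del: of_nat_Suc)
    have "euler (elt_exp c) m = (\<Sum>l\<le>Suc ?n. fls_const (1 / fact l) * euler (elt_pow c l) m)"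
      unfolding euler_def using elt_exp_sum[where x = c and m = m and N = "Suc ?n", OF c0] by (simp only: sum_distrib_left le_SucI order_refl mult_ac)
    also have "\<dots> = fls_const (1 / fact 0) * euler (elt_pow c 0) m + (\<Sum>l\<le>?n. fls_const (1 / fact (Suc l)) * euler (elt_pow c (Suc l)) m)"
      by (simp only: sum.atMost_Suc_shift)
    also have "euler (elt_pow c 0) m = 0" by (auto simp: euler_def mon_def deg_def)
    also have "fls_const (1 / fact 0) * 0 + (\<Sum>l\<le>?n. fls_const (1 / fact (Suc l)) * euler (elt_pow c (Suc l)) m)
        = (\<Sum>l\<le>?n. fls_const (1 / fact l) * elt_mult (euler c) (elt_pow c l) m)"
      by (simp only: st mult_zero_right add_0_left)
    also have "\<dots> = (\<Sum>(x, y)\<in>splits m. idx_sgn x y * euler c x * (\<Sum>l\<le>?n. fls_const (1 / fact l) * elt_pow c l y))"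
      unfolding elt_mult_splits by (simp add: sum_distrib_left case_prod_unfold mult_ac) (rule sum.swap)
    also have "\<dots> = elt_mult (euler c) (elt_exp c) m"
      unfolding elt_mult_splits
    proof (intro sum.cong refl, clarify)
      fix x y :: "'n idx" assume "(x, y) \<in> splits m"
      then have "deg y \<le> ?n" using deg_splits by fastforce
      then show "idx_sgn x y * euler c x * (\<Sum>l\<le>?n. fls_const (1 / fact l) * elt_pow c l y) = idx_sgn x y * euler c x * elt_exp c y"
        using elt_exp_sum[where x = c and m = y and N = ?n, OF c0] by simp
    qed
    finally show ?thesis .
  qed
  \<comment> \<open>In \<open>euler c\<close> only positive degrees occur, so the right side of the
    common equation at \<open>m\<close> involves the unknown only in lower degrees; the left side is
    the unknown times the nonzero number \<open>deg m\<close>.\<close>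
  have "elt_exp c m = z m"
  proof (induction "deg m" arbitrary: m rule: less_induct)
    case (less m)
    show ?case
    proof (cases "deg m")
      case 0
      have "elt_exp c m = mon {} {#} {} m" using elt_exp_sum[where x = c and m = m and N = 0, OF c0] 0 by simp
      then show ?thesis by (simp add: z_def 0 Z(2))
    next
      case (Suc k)
      have "elt_mult (euler c) (elt_exp c) m = elt_mult (euler c) z m"
      proof (rule elt_mult_cong)
        fix x y assume xy: "(x, y) \<in> splits m"
        show "euler c x * elt_exp c y = euler c x * z y"
        proof (cases "deg x = 0")
          case False
          then have "deg y < deg m" using deg_splits[OF xy] by simp
          then show ?thesis using less by simp
        qed (simp add: euler_def)
      qed
      then have "euler (elt_exp c) m = euler z m" using Ez Ee by simp
      then show ?thesis unfolding euler_def Suc by (rule of_nat_fls_cancel)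
    qed
  qed
  then show ?thesis by (simp add: z_def)
qed

section \<open>The series of \<open>\<gamma>\<^sub>\<infinity>\<close>\<close>

definition bder :: "'n gen multiset \<Rightarrow> ('n::{finite,linorder}, complex) bv \<Rightarrow> ('n, complex) bv" where
  "bder L x = Abs_bv (ydrs L (Rep_bv x))"

lemma even_elt_ydrs: "even_elt a \<Longrightarrow> even_elt (ydrs L a)"
  by (induction L) (auto simp: ydrs_add_mset even_elt_def yder_def)

lemma Rep_bder: "Rep_bv (bder L x) = ydrs L (Rep_bv x)"
  unfolding bder_def by (rule Abs_bv_inverse) (simp add: even_elt_ydrs)

lemma ydrs_deg:
  assumes "\<And>m. deg m \<noteq> d \<Longrightarrow> a m = 0" shows "deg m \<noteq> d \<Longrightarrow> ydrs L a m = 0"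
proof (induction L arbitrary: m)
  case (add A L)
  obtain S M T where m: "m = (S, M, T)" by (cases m)
  show ?case using add.IH[of "(S, add_mset A M, T)"] add.prems
    by (simp add: ydrs_add_mset yder_def m deg_def)
qed (simp add: assms)

lemma Rep_prod_deg:
  fixes x :: "'v \<Rightarrow> ('n::{finite,linorder}, 'c::comm_ring_1) bv"
  assumes "finite K" "\<And>v m. v \<in> K \<Longrightarrow> deg m \<noteq> 1 \<Longrightarrow> Rep_bv (x v) m = 0"
  shows "deg m \<noteq> card K \<Longrightarrow> Rep_bv (prod x K) m = 0"
  using assms
proof (induction K arbitrary: m rule: finite_induct)
  case empty
  then show ?case by (auto simp: Rep_bv_ops mon_def deg_def)
next
  case (insert v K)
  have "idx_sgn a b * Rep_bv (x v) a * Rep_bv (prod x K) b = 0" if "(a, b) \<in> splits m" for a b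
  proof (cases "deg a = 1")
    case True
    then have "deg b \<noteq> card K" using deg_splits[OF that] insert by simp
    then show ?thesis using insert by simp
  qed (use insert in simp)
  then show ?case using insert by (simp add: Rep_bv_ops elt_mult_splits case_prod_unfold sum.neutral)
qed

text \<open>A certificate that \<open>config_integral\<close> may be applied termwise: at distinct
  points the function is a finite combination of products of propagator coefficients.\<close>

definition nice :: "'n::finite cmat \<Rightarrow> nat \<Rightarrow> ((nat \<Rightarrow> real) \<Rightarrow> complex) \<Rightarrow> bool" where
  "nice w k F \<longleftrightarrow> (\<exists>(X :: 'n ledge list set) c. finite X \<and> (\<forall>q\<in>X. ledges_in {..<k} q) \<and>
     (\<forall>\<theta>. inj_on \<theta> {..<k} \<longrightarrow> \<theta> ` {..<k} \<subseteq> {0..<1} \<longrightarrow> F \<theta> = (\<Sum>q\<in>X. c q * prod_list (map (pc w \<theta>) q))))"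

lemma config_integral_sum:
  fixes w :: "'n::finite cmat"
  assumes Y: "finite Y" "\<And>y. y \<in> Y \<Longrightarrow> nice w k (G y)"
    and F: "\<And>\<theta>. inj_on \<theta> {..<k} \<Longrightarrow> \<theta> ` {..<k} \<subseteq> {0..<1} \<Longrightarrow> F \<theta> = (\<Sum>y\<in>Y. d y * G y \<theta>)"
  shows "config_integral k F = (\<Sum>y\<in>Y. d y * config_integral k (G y))"
proof -
  have "\<forall>y\<in>Y. \<exists>X c. finite X \<and> (\<forall>q\<in>X. ledges_in {..<k} q) \<and>
     (\<forall>\<theta>. inj_on \<theta> {..<k} \<longrightarrow> \<theta> ` {..<k} \<subseteq> {0..<1} \<longrightarrow> G y \<theta> = (\<Sum>q\<in>X. c q * prod_list (map (pc w \<theta>) q)))"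
    using Y unfolding nice_def by blast
  then obtain X where "\<forall>y\<in>Y. \<exists>c. finite (X y) \<and> (\<forall>q\<in>X y. ledges_in {..<k} q) \<and>
     (\<forall>\<theta>. inj_on \<theta> {..<k} \<longrightarrow> \<theta> ` {..<k} \<subseteq> {0..<1} \<longrightarrow> G y \<theta> = (\<Sum>q\<in>X y. c q * prod_list (map (pc w \<theta>) q)))"
    by (rule bchoice[THEN exE])
  then obtain c where "\<forall>y\<in>Y. finite (X y) \<and> (\<forall>q\<in>X y. ledges_in {..<k} q) \<and>
     (\<forall>\<theta>. inj_on \<theta> {..<k} \<longrightarrow> \<theta> ` {..<k} \<subseteq> {0..<1} \<longrightarrow> G y \<theta> = (\<Sum>q\<in>X y. c y q * prod_list (map (pc w \<theta>) q)))"
    by (rule bchoice[THEN exE])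
  then have X: "\<And>y. y \<in> Y \<Longrightarrow> finite (X y)" "\<And>y q. y \<in> Y \<Longrightarrow> q \<in> X y \<Longrightarrow> ledges_in {..<k} q"
    and G: "\<And>y \<theta>. y \<in> Y \<Longrightarrow> inj_on \<theta> {..<k} \<Longrightarrow> \<theta> ` {..<k} \<subseteq> {0..<1} \<Longrightarrow> G y \<theta> = (\<Sum>q\<in>X y. c y q * prod_list (map (pc w \<theta>) q))"
    by blast+
  have "config_integral k F = (\<Sum>p\<in>Sigma Y X. (d (fst p) * c (fst p) (snd p)) * PInt w {..<k} (snd p))"
  proof (rule config_integral_eq_sum)
    show "finite (Sigma Y X)" using Y X by auto
    show "ledges_in {..<k} (snd p)" if "p \<in> Sigma Y X" for p using that X by auto
    fix \<theta> :: "nat \<Rightarrow> real" assume \<theta>: "inj_on \<theta> {..<k}" "\<theta> ` {..<k} \<subseteq> {0..<1}"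
    have "F \<theta> = (\<Sum>y\<in>Y. \<Sum>q\<in>X y. d y * c y q * prod_list (map (pc w \<theta>) q))"
      using F[OF \<theta>] G[OF _ \<theta>] by (simp add: sum_distrib_left mult.assoc)
    then show "F \<theta> = (\<Sum>p\<in>Sigma Y X. d (fst p) * c (fst p) (snd p) * prod_list (map (pc w \<theta>) (snd p)))"
      using Y X by (subst (asm) sum.Sigma) (auto simp: case_prod_unfold)
  qed
  also have "\<dots> = (\<Sum>y\<in>Y. \<Sum>q\<in>X y. d y * c y q * PInt w {..<k} q)"
    using Y X by (subst sum.Sigma) (auto simp: case_prod_unfold)
  also have "\<dots> = (\<Sum>y\<in>Y. d y * config_integral k (G y))"
  proof (intro sum.cong refl)
    fix y assume y: "y \<in> Y"
    have "config_integral k (G y) = (\<Sum>q\<in>X y. c y q * PInt w {..<k} q)"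
      by (rule config_integral_eq_sum) (use X G y in auto)
    then show "(\<Sum>q\<in>X y. d y * c y q * PInt w {..<k} q) = d y * config_integral k (G y)"
      by (simp add: sum_distrib_left mult.assoc)
  qed
  finally show ?thesis .
qed

text \<open>The expansion over labellings separates variables: the product of derivatives does not
  depend on \<theta>, and the propagator coefficients do not depend on the vertex labels.\<close>

lemma Mult_fold_pairop:
  fixes xs :: "('n::{finite,linorder}, complex) bv list"
  assumes es: "set es \<subseteq> {..<length xs} \<times> {..<length xs}"
  shows "Mult (length xs) (fold (pairop w \<theta>) es (tensor (map Rep_bv xs))) m
    = (\<Sum>q\<in>{q. map fst q = es}. Rep_bv (\<Prod>v<length xs. bder (lab q v) (xs ! v)) m * prod_list (map (pc w \<theta>) q))"
proof -
  let ?k = "length xs"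
  have "Mult ?k (fold lieop q (tensor (map Rep_bv xs))) m = Rep_bv (\<Prod>v<?k. bder (lab q v) (xs ! v)) m" if "map fst q = es" for q
  proof -
    have "fst (fst e) < ?k \<and> snd (fst e) < ?k" if "e \<in> set q" for e
      using that \<open>map fst q = es\<close> es by force
    then have "fold lieop q (tensor (map Rep_bv xs)) = tensor (map Rep_bv (map (\<lambda>v. bder (lab q v) (xs ! v)) [0..<?k]))"
      by (subst lieops_tensor) (auto simp: Rep_bder comp_def intro!: arg_cong[of _ _ tensor])
    then have "Mult ?k (fold lieop q (tensor (map Rep_bv xs))) = Rep_bv (prod_list (map (\<lambda>v. bder (lab q v) (xs ! v)) [0..<?k]))"
      using Mult_tensor[of "map (\<lambda>v. bder (lab q v) (xs ! v)) [0..<?k]"] by simp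
    also have "prod_list (map (\<lambda>v. bder (lab q v) (xs ! v)) [0..<?k]) = (\<Prod>v<?k. bder (lab q v) (xs ! v))"
      by (simp add: prod.distinct_set_conv_list[symmetric] lessThan_atLeast0)
    finally show ?thesis by simp
  qed
  then show ?thesis
    unfolding fold_pairop_labellings Mult_sum by (intro sum.cong refl) (simp add: mult.commute)
qed

lemma
  fixes xs :: "('n::{finite,linorder}, complex) bv list" and w :: "'n cmat"
  assumes k: "length xs = k" and es: "set es \<subseteq> {..<k} \<times> {..<k}"
  shows nice_Mult_fold_pairop: "nice w k (\<lambda>\<theta>. Mult k (fold (pairop w \<theta>) es (tensor (map Rep_bv xs))) m)"
    and config_integral_fold_pairop:
      "config_integral k (\<lambda>\<theta>. Mult k (fold (pairop w \<theta>) es (tensor (map Rep_bv xs))) m)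
        = Rep_bv (wgt cst w {..<k} es (\<lambda>v L. bder L (xs ! v))) m"
proof -
  have l: "ledges_in {..<k} q" if "q \<in> {q. map fst q = es}" for q :: "'n ledge list"
    using that es by (auto simp: ledges_in_def)
  note M = Mult_fold_pairop[of es xs w, unfolded k, OF es]
  show "nice w k (\<lambda>\<theta>. Mult k (fold (pairop w \<theta>) es (tensor (map Rep_bv xs))) m)"
    unfolding nice_def M using l
    by (intro exI[of _ "{q. map fst q = es}"] exI[of _ "\<lambda>q. Rep_bv (\<Prod>v<k. bder (lab q v) (xs ! v)) m"]) auto
  have "config_integral k (\<lambda>\<theta>. Mult k (fold (pairop w \<theta>) es (tensor (map Rep_bv xs))) m)
      = (\<Sum>q\<in>{q. map fst q = es}. Rep_bv (\<Prod>v<k. bder (lab q v) (xs ! v)) m * PInt w {..<k} q)"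
    by (rule config_integral_eq_sum[where q = "\<lambda>q. q"]) (use l M in auto)
  then show "config_integral k (\<lambda>\<theta>. Mult k (fold (pairop w \<theta>) es (tensor (map Rep_bv xs))) m)
      = Rep_bv (wgt cst w {..<k} es (\<lambda>v L. bder L (xs ! v))) m"
    by (simp add: wgt_def Rep_bv_sum Rep_cst_mult mult.commute)
qed

section \<open>Coefficients with respect to hbar\<close>

definition glists :: "nat \<Rightarrow> nat \<Rightarrow> nat list set" where
  "glists k N = {gs. length gs = k \<and> sum_list gs = N}"

lemma glists_Suc: "glists (Suc k) N = (\<lambda>(g, gs). g # gs) ` (SIGMA g:{..N}. glists k (N - g))"
proof (intro set_eqI iffI)
  fix gs assume "gs \<in> glists (Suc k) N"
  then obtain g hs where "gs = g # hs" "length hs = k" "g + sum_list hs = N"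
    by (cases gs) (auto simp: glists_def)
  then show "gs \<in> (\<lambda>(g, gs). g # gs) ` (SIGMA g:{..N}. glists k (N - g))"
    by (auto simp: glists_def image_iff)
qed (auto simp: glists_def)

lemma finite_glists [simp]: "finite (glists k N)"
  by (induction k arbitrary: N) (auto simp: glists_Suc, simp add: glists_def)

lemma sum_glists_Suc: "(\<Sum>gs\<in>glists (Suc k) N. f gs) = (\<Sum>g\<le>N. \<Sum>gs\<in>glists k (N - g). f (g # gs))"
  unfolding glists_Suc
  by (subst sum.reindex) (auto simp: inj_on_def sum.Sigma case_prod_unfold)

lemma fps_prod_nth_glists:
  fixes f :: "nat \<Rightarrow> 'r::comm_ring_1 fps"
  shows "fps_nth (\<Prod>v<k. f v) N = (\<Sum>gs\<in>glists k N. \<Prod>v<k. fps_nth (f v) (gs ! v))"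
proof (induction k arbitrary: f N)
  case 0
  have "glists 0 N = (if N = 0 then {[]} else {})" by (auto simp: glists_def)
  then show ?case by simp
next
  case (Suc k)
  show ?case
    unfolding prod.lessThan_Suc_shift sum_glists_Suc
    by (simp add: fps_mult_nth Suc sum_distrib_left atLeast0AtMost)
qed

lemma fps_nth_wsgn_mult: "fps_nth (wsgn A B * x) N = wsgn A B * fps_nth x N"
  for x :: "'c::comm_ring_1 fps"
proof -
  have "fps_nth ((- 1) ^ n * x) N = (- 1) ^ n * fps_nth x N" for n
    by (cases "even n") simp_all
  then show ?thesis by (simp add: wsgn_def)
qed

lemma fps_nth_tensor:
  fixes a :: "('n::{finite,linorder}, complex fps) elt"
  shows "fps_nth (tensor (replicate k a) p) N = (\<Sum>gs\<in>glists k N. tensor (map (\<lambda>g m. fps_nth (a m) g) gs) p)"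
proof (induction k arbitrary: p N)
  case 0
  have g: "glists 0 N = (if N = 0 then {[]} else {})" by (auto simp: glists_def)
  show ?case
  proof (cases p)
    case (Pair S ps)
    then show ?thesis by (cases ps) (auto simp: g)
  qed
next
  case (Suc k)
  obtain S qs where p: "p = (S, qs)" by (cases p)
  show ?case
  proof (cases qs)
    case Nil
    have "tensor (map (\<lambda>g m. fps_nth (a m) g) gs) (S, []) = 0" if "gs \<in> glists (Suc k) N" for gs
      using that by (cases gs) (auto simp: glists_def)
    then show ?thesis by (simp add: p Nil)
  next
    case (Cons q qs')
    have "fps_nth (tensor (replicate (Suc k) a) p) N = (\<Sum>A\<in>Pow S. \<Sum>g\<le>N. \<Sum>gs\<in>glists k (N - g).
        wsgn A (S - A) * fps_nth (a (A, fst q, snd q)) g * tensor (map (\<lambda>g m. fps_nth (a m) g) gs) (S - A, qs'))"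
      by (simp add: p Cons fps_sum_nth, simp only: mult.assoc fps_nth_wsgn_mult,
          simp add: fps_mult_nth Suc.IH sum_distrib_left atLeast0AtMost mult.assoc)
    also have "\<dots> = (\<Sum>g\<le>N. \<Sum>A\<in>Pow S. \<Sum>gs\<in>glists k (N - g).
        wsgn A (S - A) * fps_nth (a (A, fst q, snd q)) g * tensor (map (\<lambda>g m. fps_nth (a m) g) gs) (S - A, qs'))"
      by (rule sum.swap)
    also have "\<dots> = (\<Sum>g\<le>N. \<Sum>gs\<in>glists k (N - g). \<Sum>A\<in>Pow S.
        wsgn A (S - A) * fps_nth (a (A, fst q, snd q)) g * tensor (map (\<lambda>g m. fps_nth (a m) g) gs) (S - A, qs'))"
      by (intro sum.cong refl sum.swap)
    also have "\<dots> = (\<Sum>gs\<in>glists (Suc k) N. tensor (map (\<lambda>g m. fps_nth (a m) g) gs) p)"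
      unfolding sum_glists_Suc by (simp add: p Cons)
    finally show ?thesis .
  qed
qed

lemma fps_nth_Mult: "fps_nth (Mult k t m) N = Mult k (\<lambda>q. fps_nth (t q) N) m"
  for t :: "('n::{finite,linorder}, complex fps) tens"
proof -
  have "fps_nth (odd_sign Ts * x) N = odd_sign Ts * fps_nth x N" for Ts :: "'n gen set list" and x :: "complex fps"
    by (induction Ts arbitrary: x) (simp_all add: fps_nth_wsgn_mult mult.assoc)
  then show ?thesis by (cases m) (simp add: Mult_def fps_sum_nth)
qed

lemma PInt_Nil: "PInt w K [] = 1"
proof -
  interpret prob_space "torus K" by (rule prob_space_torus)
  show ?thesis by (simp add: PInt_def prob_space)
qed

lemma elists_edge_lists: "(\<Sum>es\<in>elists K N. f es) = (\<Sum>l\<le>N. \<Sum>es\<in>edge_lists K l. f es)" if "finite K"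
proof -
  have "(\<Sum>es\<in>elists K N. f es) = (\<Sum>l\<le>N. \<Sum>es\<in>{es \<in> elists K N. length es = l}. f es)"
    by (rule sum.group[symmetric]) (simp add: that, simp, auto simp: elists_def)
  also have "\<dots> = (\<Sum>l\<le>N. \<Sum>es\<in>edge_lists K l. f es)"
    by (intro sum.cong refl) (auto simp: elists_def edge_lists_def)
  finally show ?thesis .
qed

definition fcst :: "complex \<Rightarrow> ('n::{finite,linorder}, complex) bv fps" where
  "fcst c = fps_const (cst c)"

text \<open>Moves hbar inside the coefficients: the combinatorics takes place in power series over
  \<open>bv\<close>, whereas \<open>gamma_infinity\<close> is an element with coefficients in
  Laurent series.\<close>

definition fls_elt :: "('n::{finite,linorder}, complex) bv fps \<Rightarrow> ('n, complex fls) elt" where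
  "fls_elt x m = fps_to_fls (Abs_fps (\<lambda>N. Rep_bv (fps_nth x N) m))"

lemma fps_to_fls_sum: "fps_to_fls (\<Sum>x\<in>A. f x) = (\<Sum>x\<in>A. fps_to_fls (f x))"
  by (induction A rule: infinite_finite_induct) auto

lemma fls_elt_mult:
  fixes x y :: "('n::{finite,linorder}, complex) bv fps" and m :: "'n idx"
  shows "fls_elt (x * y) m = elt_mult (fls_elt x) (fls_elt y) m"
proof -
  have s: "(\<Sum>p\<in>A. wsgn (f p) (g p) * wsgn (f' p) (g' p) * fps_to_fls (h p) * fps_to_fls (h' p))
      = fps_to_fls (\<Sum>p\<in>A. wsgn (f p) (g p) * wsgn (f' p) (g' p) * h p * h' p)"
    for A :: "('n idx \<times> 'n idx) set" and f g f' g' :: "_ \<Rightarrow> 'n gen set" and h h' :: "_ \<Rightarrow> complex fps"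
  proof -
    have W: "fps_to_fls (wsgn X Y :: complex fps) = wsgn (X :: 'n gen set) Y" for X Y
      by (auto simp: wsgn_def fps_to_fls_power)
    show ?thesis by (simp add: fps_to_fls_sum fls_times_fps_to_fls W)
  qed
  have "Abs_fps (\<lambda>N. Rep_bv (fps_nth (x * y) N) m) = (\<Sum>p\<in>splits m. wsgn (fst (fst p)) (fst (snd p)) * wsgn (snd (snd (fst p))) (snd (snd (snd p)))
      * Abs_fps (\<lambda>N. Rep_bv (fps_nth x N) (fst p)) * Abs_fps (\<lambda>N. Rep_bv (fps_nth y N) (snd p)))"
  proof (rule fps_ext)
    fix N
    have "Rep_bv (fps_nth (x * y) N) m = (\<Sum>i\<le>N. \<Sum>p\<in>splits m. idx_sgn (fst p) (snd p) * Rep_bv (fps_nth x i) (fst p) * Rep_bv (fps_nth y (N - i)) (snd p))"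
      by (simp add: fps_mult_nth Rep_bv_sum Rep_bv_ops elt_mult_splits case_prod_unfold atLeast0AtMost)
    also have "\<dots> = (\<Sum>p\<in>splits m. \<Sum>i\<le>N. idx_sgn (fst p) (snd p) * Rep_bv (fps_nth x i) (fst p) * Rep_bv (fps_nth y (N - i)) (snd p))"
      by (rule sum.swap)
    finally show "fps_nth (Abs_fps (\<lambda>N. Rep_bv (fps_nth (x * y) N) m)) N
      = fps_nth (\<Sum>p\<in>splits m. wsgn (fst (fst p)) (fst (snd p)) * wsgn (snd (snd (fst p))) (snd (snd (snd p)))
        * Abs_fps (\<lambda>N. Rep_bv (fps_nth x N) (fst p)) * Abs_fps (\<lambda>N. Rep_bv (fps_nth y N) (snd p))) N"
      by (simp only: fps_sum_nth mult.assoc fps_nth_wsgn_mult fps_nth_Abs_fps idx_sgn_def)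
        (simp add: fps_mult_nth sum_distrib_left atLeast0AtMost mult.assoc)
  qed
  then show ?thesis
    unfolding elt_mult_splits fls_elt_def by (simp add: s case_prod_unfold idx_sgn_def)
qed

text \<open>\<open>A g\<close> is the coefficient of hbar^g in \<open>dTX\<close> of gamma. All that
  the expansion asks of the geometry is the form degree 1 and the vanishing under two barred
  derivatives.\<close>

locale one_form =
  fixes w :: "'n::{finite,linorder} cmat" and \<gamma> :: "('n, complex fps) elt" and A :: "nat \<Rightarrow> ('n, complex) bv"
  assumes A: "Rep_bv (A g) m = fps_nth (dTX \<gamma> m) g"
    and A_deg: "deg m \<noteq> 1 \<Longrightarrow> Rep_bv (A g) m = 0"
    and A_bars: "size (filter_mset (\<lambda>B. \<not> isl B) L) \<ge> 2 \<Longrightarrow> bder L (A g) = 0"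
begin

text \<open>The label is the same at every vertex, so weights are invariant under renaming. The
  power of hbar records the genus of the vertex.\<close>

definition Y :: "nat \<Rightarrow> 'n gen multiset \<Rightarrow> ('n, complex) bv fps" where
  "Y v L = Abs_fps (\<lambda>g. bder L (A g))"

text \<open>Each edge brings one hbar from the exponent hbar times the propagator, and one factor
  1/2 from the passage to ordered pairs.\<close>

definition F :: "nat set \<Rightarrow> (nat \<times> nat) list \<Rightarrow> ('n, complex) bv fps" where
  "F K es = fcst ((1 / 2) ^ length es) * fps_X ^ length es * wgt fcst w K es Y"

lemma fcst_hom: "fcst (a + b) = fcst a + fcst b" "fcst (a * b) = fcst a * fcst b" "fcst 1 = 1" "fcst 0 = 0"
  by (simp_all add: fcst_def cst_simps)

sublocale edge_weight F fcst
proof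
  fix es es' :: "(nat \<times> nat) list" and K L :: "nat set" and f :: "nat \<Rightarrow> nat"
  show "F K es = F K es'" if "mset es = mset es'"
    unfolding F_def wgt_mset[OF that] mset_eq_length[OF that] ..
  show "F (K \<union> L) (es @ es') = F K es * F L es'"
    if "finite K" "finite L" "K \<inter> L = {}" "set es \<subseteq> K \<times> K" "set es' \<subseteq> L \<times> L"
    unfolding F_def by (subst wgt_append) (use that in \<open>simp_all add: fcst_hom power_add mult_ac\<close>)
  show "F (f ` K) (map (map_prod f f) es) = F K es" if "finite K" "inj_on f K" "set es \<subseteq> K \<times> K"
  proof -
    have "(\<lambda>v. Y (f v)) = Y" by (simp add: fun_eq_iff Y_def)
    then show ?thesis unfolding F_def wgt_relabel[OF that(2,3)] by simp
  qed
  show "F K es = 0" if "finite K" "set es \<subseteq> K \<times> K" "length es > card K"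
  proof -
    have "wgt fcst w K es Y = 0"
      by (rule wgt_eq_0) (use that A_bars in \<open>auto simp: fcst_hom Y_def fps_eq_iff\<close>)
    then show ?thesis by (simp add: F_def)
  qed
  show "F {} [] = 1" by (simp add: F_def wgt_def PInt_Nil fcst_hom)
qed (simp_all add: fcst_hom)

lemma fps_nth_wgt:
  "fps_nth (wgt fcst w {..<k} es Y) N = (\<Sum>gs\<in>glists k N. wgt cst w {..<k} es (\<lambda>v L. bder L (A (gs ! v))))"
proof -
  have "fps_nth (wgt fcst w {..<k} es Y) N = (\<Sum>q\<in>{q. map fst q = es}. \<Sum>gs\<in>glists k N. cst (PInt w {..<k} q) * (\<Prod>v<k. bder (lab q v) (A (gs ! v))))"
    by (simp add: wgt_def fps_sum_nth fcst_def fps_prod_nth_glists Y_def sum_distrib_left)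
  also have "\<dots> = (\<Sum>gs\<in>glists k N. \<Sum>q\<in>{q. map fst q = es}. cst (PInt w {..<k} q) * (\<Prod>v<k. bder (lab q v) (A (gs ! v))))"
    by (rule sum.swap)
  finally show ?thesis by (simp add: wgt_def)
qed

lemma fps_nth_term_of:
  "fps_nth (term_of {..<k} es) N = (if length es \<le> N then
     cst (1 / fact (length es) * (1 / 2) ^ length es) *
       (\<Sum>gs\<in>glists k (N - length es). wgt cst w {..<k} es (\<lambda>v L. bder L (A (gs ! v)))) else 0)"
proof -
  have "term_of {..<k} es = fps_const (cst (1 / fact (length es) * (1 / 2) ^ length es)) * (fps_X ^ length es * wgt fcst w {..<k} es Y)"
    unfolding term_of_def F_def fcst_def cst_simps by (simp add: mult.assoc flip: fps_const_mult)
  then show ?thesis by (simp add: fps_X_power_mult_nth fps_nth_wgt not_le)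
qed

lemma wgt_deg: "deg m \<noteq> k \<Longrightarrow> Rep_bv (wgt cst w {..<k} es (\<lambda>v L. bder L (A (gs ! v)))) m = 0"
proof -
  assume m: "deg m \<noteq> k"
  have "Rep_bv (\<Prod>v<k. bder (lab q v) (A (gs ! v))) m = 0" for q
    by (rule Rep_prod_deg) (use m ydrs_deg[of 1, OF A_deg] in \<open>auto simp: Rep_bder\<close>)
  then show ?thesis by (simp add: wgt_def Rep_bv_sum Rep_cst_mult)
qed

text \<open>The exponent hbar^N is shared between the edges, one power each, and the genera of the
  vertices; this is the product of power series hidden in \<open>Zsum\<close>.\<close>

lemma config_integral_exp_dP:
  "config_integral k (\<lambda>\<theta>. fps_nth (Mult k (exp_dP w k \<theta> (tensor (replicate k (dTX \<gamma>)))) m) N)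
    = Rep_bv (fps_nth (Zsum {..<k}) N) m"
proof -
  let ?Y = "SIGMA es:elists {..<k} N. glists k (N - length es)"
  let ?d = "\<lambda>es. 1 / fact (length es) * (1 / 2) ^ length es :: complex"
  let ?xs = "\<lambda>gs. map A gs"
  have finY: "finite ?Y" by auto
  have R: "map (\<lambda>g m. fps_nth (dTX \<gamma> m) g) gs = map Rep_bv (?xs gs)" for gs
    by (simp add: fun_eq_iff A)
  have "config_integral k (\<lambda>\<theta>. fps_nth (Mult k (exp_dP w k \<theta> (tensor (replicate k (dTX \<gamma>)))) m) N)
      = (\<Sum>y\<in>?Y. ?d (fst y) * config_integral k (\<lambda>\<theta>. Mult k (fold (pairop w \<theta>) (fst y) (tensor (map Rep_bv (?xs (snd y))))) m))"
  proof (rule config_integral_sum[OF finY])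
    show "nice w k (\<lambda>\<theta>. Mult k (fold (pairop w \<theta>) (fst y) (tensor (map Rep_bv (?xs (snd y))))) m)" if "y \<in> ?Y" for y
      by (rule nice_Mult_fold_pairop) (use that in \<open>auto simp: glists_def elists_def\<close>)
  next
    fix \<theta> :: "nat \<Rightarrow> real" assume \<theta>: "inj_on \<theta> {..<k}" "\<theta> ` {..<k} \<subseteq> {0..<1}"
    let ?T = "\<lambda>es gs. fold (pairop w \<theta>) es (tensor (map Rep_bv (?xs gs)))"
    have t: "(\<lambda>q. fps_nth (tensor (replicate k (dTX \<gamma>)) q) M) = (\<lambda>q. \<Sum>gs\<in>glists k M. 1 * tensor (map Rep_bv (?xs gs)) q)" for M
      unfolding fps_nth_tensor R by simp
    have "(\<lambda>q. fps_nth (exp_dP w k \<theta> (tensor (replicate k (dTX \<gamma>))) q) N)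
        = (\<lambda>q. \<Sum>l\<le>N. \<Sum>es\<in>edge_lists {..<k} l. \<Sum>gs\<in>glists k (N - l). 1 / fact l * (1 / 2) ^ l * ?T es gs q)"
      unfolding exp_dP_def t dP_funpow[OF \<theta>] fold_pairop_sum
      by (simp add: sum_distrib_left mult.assoc)
    also have "\<dots> = (\<lambda>q. \<Sum>es\<in>elists {..<k} N. \<Sum>gs\<in>glists k (N - length es). ?d es * ?T es gs q)"
      unfolding elists_edge_lists[OF finite_lessThan]
      by (intro ext sum.cong refl) (auto simp: edge_lists_def)
    also have "\<dots> = (\<lambda>q. \<Sum>y\<in>?Y. ?d (fst y) * ?T (fst y) (snd y) q)"
      by (simp add: sum.Sigma case_prod_unfold)
    finally show "fps_nth (Mult k (exp_dP w k \<theta> (tensor (replicate k (dTX \<gamma>)))) m) N = (\<Sum>y\<in>?Y. ?d (fst y) * Mult k (?T (fst y) (snd y)) m)"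
      unfolding fps_nth_Mult by (simp only: Mult_sum)
  qed
  also have "\<dots> = (\<Sum>y\<in>?Y. ?d (fst y) * Rep_bv (wgt cst w {..<k} (fst y) (\<lambda>v L. bder L (A (snd y ! v)))) m)"
  proof (intro sum.cong refl arg_cong2[of _ _ _ _ "(*)"])
    fix y assume y: "y \<in> ?Y"
    have "config_integral k (\<lambda>\<theta>. Mult k (fold (pairop w \<theta>) (fst y) (tensor (map Rep_bv (?xs (snd y))))) m)
        = Rep_bv (wgt cst w {..<k} (fst y) (\<lambda>v L. bder L (?xs (snd y) ! v))) m"
      by (rule config_integral_fold_pairop) (use y in \<open>auto simp: glists_def elists_def\<close>)
    also have "wgt cst w {..<k} (fst y) (\<lambda>v L. bder L (?xs (snd y) ! v)) = wgt cst w {..<k} (fst y) (\<lambda>v L. bder L (A (snd y ! v)))"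
      unfolding wgt_def using y by (intro sum.cong refl arg_cong2[of _ _ _ _ "(*)"] prod.cong) (auto simp: glists_def)
    finally show "config_integral k (\<lambda>\<theta>. Mult k (fold (pairop w \<theta>) (fst y) (tensor (map Rep_bv (?xs (snd y))))) m)
        = Rep_bv (wgt cst w {..<k} (fst y) (\<lambda>v L. bder L (A (snd y ! v)))) m" .
  qed
  also have "\<dots> = (\<Sum>es\<in>elists {..<k} N. Rep_bv (fps_nth (term_of {..<k} es) N) m)"
  proof -
    have "(\<Sum>es\<in>elists {..<k} N. Rep_bv (fps_nth (term_of {..<k} es) N) m)
        = (\<Sum>es\<in>elists {..<k} N. \<Sum>gs\<in>glists k (N - length es). ?d es * Rep_bv (wgt cst w {..<k} es (\<lambda>v L. bder L (A (gs ! v)))) m)"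
      by (intro sum.cong refl) (simp add: fps_nth_term_of elists_def Rep_cst_mult Rep_bv_sum sum_distrib_left)
    then show ?thesis by (simp add: sum.Sigma case_prod_unfold)
  qed
  \<comment> \<open>Lists longer than \<open>N\<close> do not reach hbar^N. Enlarging the bound is
    therefore harmless, and a bound of at least \<open>k\<close> is what \<open>Zsum_bound\<close>
    requires.\<close>
  also have "\<dots> = (\<Sum>es\<in>elists {..<k} (max N k). Rep_bv (fps_nth (term_of {..<k} es) N) m)"
  proof (rule sum.mono_neutral_left)
    show "finite (elists {..<k} (max N k))" by simp
  qed (auto simp: elists_def fps_nth_term_of Rep_bv_ops)
  also have "\<dots> = Rep_bv (fps_nth (Zsum {..<k}) N) m"
    using Zsum_bound[of "{..<k}" "max N k"] by (simp add: fps_sum_nth Rep_bv_sum)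
  finally show ?thesis .
qed

lemma Zsum_Csum_deg:
  assumes "deg m \<noteq> k"
  shows "Rep_bv (fps_nth (Zsum {..<k}) N) m = 0" "Rep_bv (fps_nth (Csum {..<k}) N) m = 0"
proof -
  have "Rep_bv (fps_nth (term_of {..<k} es) N) m = 0" for es
    using wgt_deg[OF assms] by (simp add: fps_nth_term_of Rep_cst_mult Rep_bv_sum Rep_bv_ops(1))
  then show "Rep_bv (fps_nth (Zsum {..<k}) N) m = 0" "Rep_bv (fps_nth (Csum {..<k}) N) m = 0"
    by (simp_all add: Zsum_def Csum_def fps_sum_nth Rep_bv_sum)
qed

section \<open>The logarithm of the series\<close>

definition Zn :: "nat \<Rightarrow> ('n, complex fls) elt" where
  "Zn n m = fls_X_inv ^ n * fls_elt (Zsum {..<n}) m"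

definition Cn :: "nat \<Rightarrow> ('n, complex fls) elt" where
  "Cn n m = fls_X_inv ^ n * fls_elt (Csum {..<n}) m"

text \<open>Degree 0 is set to 0 by hand: the empty list on the empty vertex set satisfies
  \<open>conn\<close>, so \<open>Csum {}\<close> is 1, but the logarithm must have positive form
  degree.\<close>

definition cn :: "('n, complex fls) elt" where
  "cn m = (if deg m = 0 then 0 else fls_const (1 / fact (deg m)) * Cn (deg m) m)"

lemma fls_elt_0: "(\<And>N. Rep_bv (fps_nth x N) m = 0) \<Longrightarrow> fls_elt x m = 0"
proof -
  assume "\<And>N. Rep_bv (fps_nth x N) m = 0"
  then have "Abs_fps (\<lambda>N. Rep_bv (fps_nth x N) m) = 0" by (intro fps_ext) simp
  then show ?thesis by (simp add: fls_elt_def)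
qed

text \<open>With one form degree for each vertex, the sum over \<open>k\<close> collapses to
  \<open>k = deg m\<close>.\<close>

lemma exp_gamma_infinity_eq: "exp_gamma_infinity w \<gamma> m = fls_const (1 / fact (deg m)) * Zn (deg m) m"
proof -
  have "exp_gamma_infinity w \<gamma> m = Sum_any (\<lambda>k. fls_const (1 / fact k) * Zn k m)"
    unfolding exp_gamma_infinity_def Zn_def config_integral_exp_dP fls_elt_def by (simp add: mult.assoc)
  also have "\<dots> = (\<Sum>k\<in>{deg m}. fls_const (1 / fact k) * Zn k m)"
    by (rule Sum_any.expand_superset) (auto simp: Zn_def intro!: fls_elt_0 Zsum_Csum_deg)
  finally show ?thesis by simp
qed

lemma elt_exp_cn: "elt_exp cn = exp_gamma_infinity w \<gamma>"
proof
  fix m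
  have "elt_exp cn m = fls_const (1 / fact (deg m)) * Zn (deg m) m"
  proof (rule elt_exp_eq)
    show "deg m \<noteq> n \<Longrightarrow> Cn n m = 0" for n m by (auto simp: Cn_def intro!: fls_elt_0 Zsum_Csum_deg)
    show "deg m \<noteq> n \<Longrightarrow> Zn n m = 0" for n m by (auto simp: Zn_def intro!: fls_elt_0 Zsum_Csum_deg)
    show "even_elt (Cn n)" for n
    proof -
      have "Rep_bv x m = 0" if "odd (card (fst m) + card (snd (snd m)))" for x :: "('n, complex) bv" and m
        using even_Rep_bv[of x] that unfolding even_elt_def by blast
      then show ?thesis unfolding even_elt_def Cn_def by (intro allI impI) (simp add: fls_elt_0)
    qed
    show "Zn 0 = mon {} {#} {}"
    proof
      fix m :: "'n idx"
      have "fls_elt 1 m = mon {} {#} {} m"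
      proof -
        have "Abs_fps (\<lambda>N. Rep_bv (fps_nth (1 :: ('n, complex) bv fps) N) m) = mon {} {#} {} m"
          by (rule fps_ext) (auto simp: Rep_bv_ops mon_def)
        then show ?thesis by (auto simp: fls_elt_def mon_def)
      qed
      then show "Zn 0 m = mon {} {#} {} m" by (simp add: Zn_def Zsum_0)
    qed
    show "Zn (Suc n) m = (\<Sum>d\<le>n. of_nat (n choose d) * elt_mult (Cn (Suc d)) (Zn (n - d)) m)" for n m
    proof -
      have lin: "fls_elt (\<Sum>d\<le>n. of_nat (c d) * x d) m = (\<Sum>d\<le>n. of_nat (c d) * fls_elt (x d) m)" for c and x :: "nat \<Rightarrow> ('n, complex) bv fps"
      proof -
        have r: "Rep_bv (of_nat j * u) m = of_nat j * Rep_bv u m" for j and u :: "('n, complex) bv"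
          by (induction j) (simp_all add: Rep_bv_ops(1,3) algebra_simps)
        have "Abs_fps (\<lambda>N. Rep_bv (fps_nth (\<Sum>d\<le>n. of_nat (c d) * x d) N) m) = (\<Sum>d\<le>n. of_nat (c d) * Abs_fps (\<lambda>N. Rep_bv (fps_nth (x d) N) m))"
          by (rule fps_ext) (simp add: fps_sum_nth Rep_bv_sum r fps_mult_of_nat_nth)
        then show ?thesis by (simp add: fls_elt_def fps_to_fls_sum fls_times_fps_to_fls)
      qed
      have "elt_mult (Cn (Suc d)) (Zn (n - d)) m = fls_X_inv ^ Suc n * fls_elt (Csum {..<Suc d} * Zsum {..<n - d}) m" if "d \<le> n" for d
      proof -
        have "elt_mult (Cn (Suc d)) (Zn (n - d)) m = fls_X_inv ^ Suc d * fls_X_inv ^ (n - d) * elt_mult (fls_elt (Csum {..<Suc d})) (fls_elt (Zsum {..<n - d})) m"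
          by (simp add: elt_mult_splits Cn_def Zn_def sum_distrib_left case_prod_unfold mult_ac)
        also have "fls_X_inv ^ Suc d * fls_X_inv ^ (n - d) = (fls_X_inv ^ Suc n :: complex fls)"
          using that by (simp flip: power_add)
        finally show ?thesis by (simp add: fls_elt_mult)
      qed
      then show ?thesis unfolding Zn_def[of "Suc n"] Zsum_rec lin by (simp add: sum_distrib_left mult_ac)
    qed
    show "cn m = (if deg m = 0 then 0 else fls_const (1 / fact (deg m)) * Cn (deg m) m)" for m by (rule cn_def)
  qed
  then show "elt_exp cn m = exp_gamma_infinity w \<gamma> m" by (simp add: exp_gamma_infinity_eq)
qed

text \<open>\<open>elt_exp_cn\<close> shows that hbar times \<open>cn\<close> has the required
  exponential, and \<open>elt_exp_inj\<close> excludes every other element of positive form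
  degree.\<close>

lemma gamma_infinity_eq: "gamma_infinity w \<gamma> m = fls_X * cn m"
proof -
  have X: "fls_X_inv * (fls_X * x) = x" "fls_X * (fls_X_inv * x) = x" for x :: "complex fls"
    by (simp_all add: fls_X_times_conv_shift fls_X_inv_times_conv_shift)
  have "gamma_infinity w \<gamma> = (\<lambda>m. fls_X * cn m)"
    unfolding gamma_infinity_def
  proof (rule the_equality)
    show "(\<forall>M T. fls_X * cn ({}, M, T) = 0) \<and> elt_exp (\<lambda>m. fls_X_inv * (fls_X * cn m)) = exp_gamma_infinity w \<gamma>"
    proof
      show "\<forall>M T. fls_X * cn ({}, M, T) = 0" by (simp add: cn_def deg_def)
      show "elt_exp (\<lambda>m. fls_X_inv * (fls_X * cn m)) = exp_gamma_infinity w \<gamma>" by (simp only: X elt_exp_cn)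
    qed
  next
    fix x assume x: "(\<forall>M T. x ({}, M, T) = 0) \<and> elt_exp (\<lambda>m. fls_X_inv * x m) = exp_gamma_infinity w \<gamma>"
    have "(\<lambda>m. fls_X_inv * x m) = cn"
    proof (rule elt_exp_inj)
      show "elt_exp (\<lambda>m. fls_X_inv * x m) = elt_exp cn" using x elt_exp_cn by simp
      show "fls_X_inv * x m = 0" if "deg m = 0" for m
        using that x by (cases m) (simp add: deg_def)
    qed (simp add: cn_def)
    then have "x m = fls_X * cn m" for m using X(2)[of "x m"] by (metis (no_types, lifting))
    then show "x = (\<lambda>m. fls_X * cn m)" by blast
  qed
  then show ?thesis by simp
qed

text \<open>The prefactor is hbar * hbar^(-k) with k = \<open>deg m\<close>, so hbar^n comes from
  the exponent n + k - 1 in \<open>Csum\<close>. For l edges and total vertex genus s this exponent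
  is l + s, hence n = (l - k + 1) + s, the genus of a connected graph.\<close>

theorem fls_nth_gamma_infinity:
  "fls_nth (gamma_infinity w \<gamma> m) n = (if deg m = 0 \<or> n + int (deg m) < 1 then 0 else
     1 / fact (deg m) * Rep_bv (fps_nth (Csum {..<deg m}) (nat (n + int (deg m) - 1))) m)"
proof (cases "deg m = 0")
  case False
  have "fls_nth (gamma_infinity w \<gamma> m) n = 1 / fact (deg m) * fls_nth (fls_X_inv ^ deg m * fls_elt (Csum {..<deg m}) m) (n - 1)"
    using False by (simp add: gamma_infinity_eq cn_def Cn_def fls_X_times_conv_shift)
  also have "fls_nth (fls_X_inv ^ deg m * fls_elt (Csum {..<deg m}) m) (n - 1) = fls_nth (fls_elt (Csum {..<deg m}) m) (n - 1 + int (deg m))"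
    by (simp add: fls_X_inv_power_times_conv_shift)
  also have "\<dots> = (if n - 1 + int (deg m) < 0 then 0 else Rep_bv (fps_nth (Csum {..<deg m}) (nat (n - 1 + int (deg m)))) m)"
    by (simp add: fls_elt_def fps_to_fls_nth)
  finally show ?thesis using False by (simp add: algebra_simps)
qed (simp add: gamma_infinity_eq cn_def)

end

section \<open>Presentations of graphs\<close>

text \<open>
  A presentation lists the vertices, one half-edge of every internal edge and the tails of a graph; its type
  \<open>(gs, es, us)\<close> consists of the genera, the ends of the edges and the vertices of the tails.
\<close>

definition pres :: "('v, 'h) graph \<Rightarrow> 'v list \<Rightarrow> 'h list \<Rightarrow> 'h list \<Rightarrow>
    nat list \<Rightarrow> (nat \<times> nat) list \<Rightarrow> nat list \<Rightarrow> bool" where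
  "pres G vs L ts gs es us \<longleftrightarrow> distinct vs \<and> set vs = gverts G \<and>
     distinct (L @ map (gflip G) L @ ts) \<and> set (L @ map (gflip G) L @ ts) = ghalfs G \<and>
     (\<forall>h\<in>set ts. gflip G h = h) \<and>
     set es \<subseteq> {..<length vs} \<times> {..<length vs} \<and> set us \<subseteq> {..<length vs} \<and>
     map (ggenus G) vs = gs \<and> map (gattach G) L = map (\<lambda>e. vs ! fst e) es \<and>
     map (\<lambda>h. gattach G (gflip G h)) L = map (\<lambda>e. vs ! snd e) es \<and> map (gattach G) ts = map ((!) vs) us"

lemma pres_lengths:
  assumes "pres G vs L ts gs es us"
  shows "length gs = length vs" "length es = length L" "length us = length ts" "length vs = card (gverts G)"
  using assms unfolding pres_def by (metis length_map distinct_card)+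

lemma ex_map_eq: "distinct xs \<Longrightarrow> length xs = length ys \<Longrightarrow> \<exists>f. map f xs = ys"
proof (induction xs arbitrary: ys)
  case (Cons x xs)
  then obtain y ys' where ys: "ys = y # ys'" "length xs = length ys'" by (cases ys) auto
  then obtain f where "map f xs = ys'" using Cons by auto
  then have "map (f(x := y)) (x # xs) = ys" using Cons.prems ys by (auto intro: map_cong)
  then show ?case by blast
qed simp

lemma bij_betw_lists: "distinct xs \<Longrightarrow> distinct (map f xs) \<Longrightarrow> bij_betw f (set xs) (set (map f xs))"
  by (simp add: bij_betw_def distinct_map)

text \<open>The vertex lists and the half-edge lists are matched entry by entry; equal types say
  exactly that this matching respects attachments and genera.\<close>

lemma pres_iso:
  assumes G: "is_graph G" "pres G vs L ts gs es us" and H: "is_graph H" "pres H vs' L' ts' gs es us"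
  shows "\<exists>f \<phi>. is_graph_iso G H f \<phi> \<and> map f vs = vs' \<and> map \<phi> L = L' \<and> map \<phi> ts = ts'"
proof -
  note lG = pres_lengths[OF G(2)] and lH = pres_lengths[OF H(2)]
  obtain f where f: "map f vs = vs'"
    using ex_map_eq[of vs vs'] G H lG lH by (auto simp: pres_def)
  \<comment> \<open>Including the opposite half-edges in the order of \<open>L\<close> makes the
    matching commute with the flips.\<close>
  obtain \<phi> where \<phi>: "map \<phi> (L @ map (gflip G) L @ ts) = L' @ map (gflip H) L' @ ts'"
    using ex_map_eq[of "L @ map (gflip G) L @ ts" "L' @ map (gflip H) L' @ ts'"] G H lG lH by (auto simp: pres_def)
  have len: "length (map \<phi> L) = length L'" "length (map \<phi> (map (gflip G) L)) = length (map (gflip H) L')"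
    using lG lH by simp_all
  have p1: "map \<phi> L = L'" using \<phi> len by (simp add: append_eq_append_conv)
  have p2: "map \<phi> (map (gflip G) L) = map (gflip H) L'" "map \<phi> ts = ts'"
    using \<phi> len by (simp_all add: append_eq_append_conv)
  have vsn: "f (vs ! i) = vs' ! i" if "i < length vs" for i using f that by (metis nth_map)
  have es: "fst e < length vs" "snd e < length vs" if "e \<in> set es" for e using G that by (auto simp: pres_def)
  have att1: "map (gattach H) (map \<phi> L) = map f (map (gattach G) L)"
  proof -
    have "map (gattach H) (map \<phi> L) = map (\<lambda>e. vs' ! fst e) es" using H by (simp add: p1 pres_def del: map_map)
    also have "\<dots> = map f (map (\<lambda>e. vs ! fst e) es)" using vsn es by simp
    also have "map (\<lambda>e. vs ! fst e) es = map (gattach G) L" using G by (simp add: pres_def)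
    finally show ?thesis .
  qed
  have att2: "map (gattach H) (map \<phi> (map (gflip G) L)) = map f (map (gattach G) (map (gflip G) L))"
  proof -
    have "map (gattach H) (map \<phi> (map (gflip G) L)) = map (\<lambda>e. vs' ! snd e) es"
      using H unfolding p2 by (simp add: pres_def comp_def)
    also have "\<dots> = map f (map (\<lambda>e. vs ! snd e) es)" using vsn es by simp
    also have "map (\<lambda>e. vs ! snd e) es = map (gattach G) (map (gflip G) L)" using G by (simp add: pres_def comp_def)
    finally show ?thesis .
  qed
  have att3: "map (gattach H) (map \<phi> ts) = map f (map (gattach G) ts)"
  proof -
    have "map (gattach H) (map \<phi> ts) = map ((!) vs') us" using H unfolding p2 by (simp add: pres_def)
    also have "\<dots> = map f (map ((!) vs) us)" using vsn G by (auto simp: pres_def subset_iff)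
    also have "map ((!) vs) us = map (gattach G) ts" using G by (simp add: pres_def)
    finally show ?thesis .
  qed
  have halfs: "ghalfs G = set L \<union> gflip G ` set L \<union> set ts" using G by (auto simp: pres_def)
  have fl: "\<phi> (gflip G h) = gflip H (\<phi> h)" if "h \<in> set L" for h
  proof -
    have "map (\<lambda>h. \<phi> (gflip G h)) L = map (\<lambda>h. gflip H (\<phi> h)) L"
      using p1 p2(1) by (simp add: comp_def) (metis (no_types, lifting) map_map comp_def map_eq_conv)
    then show ?thesis using that by simp
  qed
  have \<phi>L: "\<phi> h \<in> ghalfs H" if "h \<in> set L" for h
  proof -
    have "\<phi> h \<in> set L'" using that p1 by auto
    then show ?thesis using H(2) by (auto simp: pres_def)
  qed
  have "is_graph_iso G H f \<phi>" unfolding is_graph_iso_def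
  proof (intro conjI ballI)
    show "bij_betw f (gverts G) (gverts H)"
      using bij_betw_lists[of vs f] G H f by (simp add: pres_def)
    show "bij_betw \<phi> (ghalfs G) (ghalfs H)"
      using bij_betw_lists[of "L @ map (gflip G) L @ ts" \<phi>] G H \<phi> unfolding pres_def by metis
    fix v assume "v \<in> gverts G"
    then have "v \<in> set vs" using G by (simp add: pres_def)
    moreover have "map (\<lambda>v. ggenus H (f v)) vs = map (ggenus G) vs" using G H f by (auto simp: pres_def)
    ultimately show "ggenus H (f v) = ggenus G v" by simp
  next
    fix h assume "h \<in> ghalfs G"
    then consider "h \<in> set L" | h' where "h' \<in> set L" "h = gflip G h'" | "h \<in> set ts" using halfs by auto
    then show "gattach H (\<phi> h) = f (gattach G h)"
      by cases (use att1 att2 att3 in auto)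
  next
    fix h assume "h \<in> ghalfs G"
    then consider "h \<in> set L" | h' where "h' \<in> set L" "h = gflip G h'" | "h \<in> set ts" using halfs by auto
    then show "gflip H (\<phi> h) = \<phi> (gflip G h)"
    proof cases
      case 2
      then have "gflip G h = h'" using G halfs by (auto simp: is_graph_def)
      moreover have "gflip H (gflip H (\<phi> h')) = \<phi> h'" using H(1) \<phi>L[OF 2(1)] by (auto simp: is_graph_def)
      ultimately show ?thesis using fl[OF 2(1)] 2 by simp
    next
      case 3
      then have "\<phi> h \<in> set ts'" using p2 by auto
      then show ?thesis using 3 G H by (auto simp: pres_def)
    qed (use fl in simp)
  qed
  then show ?thesis using f p1 p2 by blast
qed

lemma iso_pres:
  assumes "is_graph G" "pres G vs L ts gs es us" "is_graph_iso G H f \<phi>"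
  shows "pres H (map f vs) (map \<phi> L) (map \<phi> ts) gs es us"
proof -
  let ?HL = "L @ map (gflip G) L @ ts"
  have iso: "bij_betw f (gverts G) (gverts H)" "bij_betw \<phi> (ghalfs G) (ghalfs H)"
    "\<And>v. v \<in> gverts G \<Longrightarrow> ggenus H (f v) = ggenus G v"
    "\<And>h. h \<in> ghalfs G \<Longrightarrow> gattach H (\<phi> h) = f (gattach G h)" "\<And>h. h \<in> ghalfs G \<Longrightarrow> gflip H (\<phi> h) = \<phi> (gflip G h)"
    using assms(3) by (auto simp: is_graph_iso_def)
  have P: "distinct vs" "set vs = gverts G" "distinct ?HL" "set ?HL = ghalfs G" "\<And>h. h \<in> set ts \<Longrightarrow> gflip G h = h"
    "set es \<subseteq> {..<length vs} \<times> {..<length vs}" "set us \<subseteq> {..<length vs}"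
    "map (ggenus G) vs = gs" "map (gattach G) L = map (\<lambda>e. vs ! fst e) es"
    "map (\<lambda>h. gattach G (gflip G h)) L = map (\<lambda>e. vs ! snd e) es" "map (gattach G) ts = map ((!) vs) us"
    using assms(2) unfolding pres_def by blast+
  have sub: "set L \<subseteq> ghalfs G" "set ts \<subseteq> ghalfs G" "gflip G ` set L \<subseteq> ghalfs G" using P(4) by auto
  have HL: "map \<phi> L @ map (gflip H) (map \<phi> L) @ map \<phi> ts = map \<phi> ?HL"
    using iso(5) sub by (simp add: subset_iff)
  have a1: "map (gattach H) (map \<phi> L) = map f (map (gattach G) L)" using iso(4) sub by (simp add: subset_iff)
  have a2: "map (\<lambda>h. gattach H (gflip H h)) (map \<phi> L) = map f (map (\<lambda>h. gattach G (gflip G h)) L)"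
    using iso(4,5) sub by (simp add: subset_iff image_subset_iff)
  have a3: "map (gattach H) (map \<phi> ts) = map f (map (gattach G) ts)" using iso(4) sub by (simp add: subset_iff)
  show ?thesis unfolding pres_def
  proof (intro conjI)
    show "distinct (map f vs)" "set (map f vs) = gverts H"
      using iso(1) P(1,2) by (auto simp: distinct_map bij_betw_def)
    show "distinct (map \<phi> L @ map (gflip H) (map \<phi> L) @ map \<phi> ts)"
      unfolding HL using P(3) iso(2) P(4) by (metis bij_betw_def distinct_map)
    show "set (map \<phi> L @ map (gflip H) (map \<phi> L) @ map \<phi> ts) = ghalfs H"
      unfolding HL using iso(2) P(4) by (metis bij_betw_def list.set_map)
    show "\<forall>h\<in>set (map \<phi> ts). gflip H h = h" using iso(5) P(5) sub by auto
    show "set es \<subseteq> {..<length (map f vs)} \<times> {..<length (map f vs)}" "set us \<subseteq> {..<length (map f vs)}"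
      using P(6,7) by simp_all
    show "map (ggenus H) (map f vs) = gs" using iso(3) P(2,8) by auto
    show "map (gattach H) (map \<phi> L) = map (\<lambda>e. map f vs ! fst e) es"
      unfolding a1 P(9) using P(6) by (auto simp: subset_iff)
    show "map (\<lambda>h. gattach H (gflip H h)) (map \<phi> L) = map (\<lambda>e. map f vs ! snd e) es"
      unfolding a2 P(10) using P(6) by (auto simp: subset_iff)
    show "map (gattach H) (map \<phi> ts) = map ((!) (map f vs)) us"
      unfolding a3 P(11) using P(7) by (auto simp: subset_iff)
  qed
qed

text \<open>Automorphisms act simply transitively on the presentations of a fixed type: transitively
  by \<open>pres_iso\<close> with both graphs equal, and freely because the lists and the flip
  exhaust the graph.\<close>

lemma card_pres_eq_num_aut:
  assumes G: "is_graph G" "pres G vs L ts gs es us"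
  shows "card {(vs, L, ts). pres G vs L ts gs es us} = num_aut G"
proof -
  let ?A = "{(f, \<phi>). f permutes gverts G \<and> \<phi> permutes ghalfs G \<and> is_graph_iso G G f \<phi>}"
  let ?m = "\<lambda>(f, \<phi>). (map f vs, map \<phi> L, map \<phi> ts)"
  have vs: "set vs = gverts G" and hs: "ghalfs G = set L \<union> gflip G ` set L \<union> set ts"
    using G(2) by (auto simp: pres_def)
  have inj: "inj_on ?m ?A"
  proof (rule inj_onI, clarify)
    fix f \<phi> f' \<phi>'
    assume p: "f permutes gverts G" "\<phi> permutes ghalfs G" "f' permutes gverts G" "\<phi>' permutes ghalfs G"
      and iso: "is_graph_iso G G f \<phi>" "is_graph_iso G G f' \<phi>'"
      and eq: "map f vs = map f' vs" "map \<phi> L = map \<phi>' L" "map \<phi> ts = map \<phi>' ts"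
    have "f v = f' v" for v
      using eq(1) vs p(1,3) by (cases "v \<in> gverts G") (auto simp: permutes_not_in)
    moreover have "\<phi> h = \<phi>' h" for h
    proof (cases "h \<in> ghalfs G")
      case True
      then consider "h \<in> set L" | h' where "h' \<in> set L" "h = gflip G h'" | "h \<in> set ts" using hs by auto
      then show ?thesis
      proof cases
        case 2
        then have "h' \<in> ghalfs G" "\<phi> h' = \<phi>' h'" using hs eq by auto
        then show ?thesis using iso 2 by (simp add: is_graph_iso_def) (metis)
      qed (use eq in auto)
    qed (use p in \<open>simp add: permutes_not_in\<close>)
    ultimately show "f = f' \<and> \<phi> = \<phi>'" by auto
  qed
  have im: "?m ` ?A = {(vs, L, ts). pres G vs L ts gs es us}"
  proof (intro set_eqI iffI)
    fix x assume "x \<in> ?m ` ?A"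
    then show "x \<in> {(vs, L, ts). pres G vs L ts gs es us}" using iso_pres[OF G] by auto
  next
    fix x assume "x \<in> {(vs, L, ts). pres G vs L ts gs es us}"
    then obtain vs' L' ts' where x: "x = (vs', L', ts')" "pres G vs' L' ts' gs es us" by auto
    obtain f \<phi> where iso: "is_graph_iso G G f \<phi>" and m: "map f vs = vs'" "map \<phi> L = L'" "map \<phi> ts = ts'"
      using pres_iso[OF G G(1) x(2)] by blast
    \<comment> \<open>\<open>num_aut\<close> counts maps that are the identity outside the graph,
      whereas \<open>pres_iso\<close> leaves the values there arbitrary.\<close>
    define f' \<phi>' where "f' = (\<lambda>v. if v \<in> gverts G then f v else v)" and "\<phi>' = (\<lambda>h. if h \<in> ghalfs G then \<phi> h else h)"
    have b: "bij_betw f' (gverts G) (gverts G)" "bij_betw \<phi>' (ghalfs G) (ghalfs G)"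
      using iso bij_betw_cong[of "gverts G" f f'] bij_betw_cong[of "ghalfs G" \<phi> \<phi>']
      by (auto simp: is_graph_iso_def f'_def \<phi>'_def)
    have "f' permutes gverts G" "\<phi>' permutes ghalfs G"
      using b by (auto intro!: bij_imp_permutes simp: f'_def \<phi>'_def)
    moreover have "is_graph_iso G G f' \<phi>'"
      using iso b G(1) unfolding is_graph_iso_def is_graph_def by (auto simp: f'_def \<phi>'_def)
    moreover have "map f' vs = vs'" "map \<phi>' L = L'" "map \<phi>' ts = ts'"
      using m vs hs by (auto simp: f'_def \<phi>'_def)
    ultimately show "x \<in> ?m ` ?A" unfolding x(1) by (intro image_eqI[of _ _ "(f', \<phi>')"]) auto
  qed
  show ?thesis unfolding im[symmetric] card_image[OF inj] num_aut_def ..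
qed

section \<open>Counting the presentations of a graph\<close>

definition orientations :: "('h \<Rightarrow> 'h) \<Rightarrow> 'h set \<Rightarrow> 'h list set" where
  "orientations \<sigma> I = {L. distinct (L @ map \<sigma> L) \<and> set (L @ map \<sigma> L) = I}"

text \<open>The first entry is any of the 2E half-edges; removing its orbit leaves the same problem
  for E - 1. The product 2E (2E - 2) ... 2 is E! 2^E.\<close>

lemma card_orientations:
  assumes "finite I" "card I = 2 * E" "\<And>h. h \<in> I \<Longrightarrow> \<sigma> h \<in> I \<and> \<sigma> (\<sigma> h) = h \<and> \<sigma> h \<noteq> h"
  shows "finite (orientations \<sigma> I) \<and> card (orientations \<sigma> I) = fact E * 2 ^ E"
  using assms
proof (induction E arbitrary: I)
  case 0
  then have "orientations \<sigma> I = {[]}" by (auto simp: orientations_def)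
  then show ?case by simp
next
  case (Suc E)
  let ?J = "\<lambda>h. I - {h, \<sigma> h}"
  have J: "finite (?J h)" "card (?J h) = 2 * E" "\<And>x. x \<in> ?J h \<Longrightarrow> \<sigma> x \<in> ?J h \<and> \<sigma> (\<sigma> x) = x \<and> \<sigma> x \<noteq> x" if h: "h \<in> I" for h
  proof -
    have hh: "\<sigma> h \<in> I" "\<sigma> (\<sigma> h) = h" "\<sigma> h \<noteq> h" using Suc.prems h by auto
    show "finite (?J h)" using Suc.prems by simp
    have "card {h, \<sigma> h} = 2" using hh(3) by (simp add: card_insert_if)
    then show "card (?J h) = 2 * E" using Suc.prems h hh(1) by (subst card_Diff_subset) auto
    fix x assume x: "x \<in> ?J h"
    then have "\<sigma> x \<in> I" "\<sigma> (\<sigma> x) = x" "\<sigma> x \<noteq> x" using Suc.prems by auto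
    moreover have "\<sigma> x \<noteq> h" using x calculation(2) by auto
    moreover have "\<sigma> x \<noteq> \<sigma> h" using x hh(2) calculation(2) by (metis DiffD2 insertI1)
    ultimately show "\<sigma> x \<in> ?J h \<and> \<sigma> (\<sigma> x) = x \<and> \<sigma> x \<noteq> x" by simp
  qed
  have eq: "orientations \<sigma> I = (\<Union>h\<in>I. (#) h ` orientations \<sigma> (?J h))"
  proof (intro set_eqI iffI)
    fix L assume L: "L \<in> orientations \<sigma> I"
    have "I \<noteq> {}" using Suc.prems by auto
    then obtain h L' where hL: "L = h # L'" using L by (cases L) (auto simp: orientations_def)
    then have "L' \<in> orientations \<sigma> (?J h)" "h \<in> I" using L by (auto simp: orientations_def)
    then show "L \<in> (\<Union>h\<in>I. (#) h ` orientations \<sigma> (?J h))" using hL by auto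
  next
    fix L assume "L \<in> (\<Union>h\<in>I. (#) h ` orientations \<sigma> (?J h))"
    then obtain h L' where h: "h \<in> I" "L = h # L'" "L' \<in> orientations \<sigma> (?J h)" by auto
    then have "\<sigma> h \<in> I" "\<sigma> h \<noteq> h" using Suc.prems by auto
    moreover have "set L' \<union> \<sigma> ` set L' = ?J h" using h(3) by (auto simp: orientations_def)
    ultimately show "L \<in> orientations \<sigma> I" using h by (auto simp: orientations_def)
  qed
  have fin: "finite (orientations \<sigma> (?J h))" "card (orientations \<sigma> (?J h)) = fact E * 2 ^ E" if "h \<in> I" for h
    using Suc.IH[OF J(1)[OF that] J(2)[OF that] J(3)[OF that]] by auto
  have "card (orientations \<sigma> I) = (\<Sum>h\<in>I. card ((#) h ` orientations \<sigma> (?J h)))"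
    unfolding eq using Suc.prems(1) fin by (intro card_UN_disjoint) auto
  also have "\<dots> = (\<Sum>h\<in>I. fact E * 2 ^ E)"
    using fin by (intro sum.cong refl) (simp add: card_image)
  also have "\<dots> = fact (Suc E) * 2 ^ Suc E" using Suc.prems(2) by (simp add: algebra_simps)
  finally show ?case using fin Suc.prems(1) by (simp add: eq)
qed

definition ptypes :: "('v, 'h) graph \<Rightarrow> (nat list \<times> (nat \<times> nat) list \<times> nat list) set" where
  "ptypes G = {(gs, es, us). \<exists>vs L ts. pres G vs L ts gs es us}"

lemma ex_nth_list: "set xs \<subseteq> set vs \<Longrightarrow> \<exists>ns. set ns \<subseteq> {..<length vs} \<and> xs = map ((!) vs) ns"
proof (induction xs)
  case (Cons x xs)
  then obtain js where js: "set js \<subseteq> {..<length vs}" "xs = map ((!) vs) js" by auto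
  obtain i where "i < length vs" "x = vs ! i" using Cons.prems by (auto simp: in_set_conv_nth)
  then show ?case using js by (intro exI[of _ "i # js"]) auto
qed simp

lemma inj_map_nth:
  assumes "distinct vs" "set ns \<subseteq> {..<length vs}" "set js \<subseteq> {..<length vs}" "map ((!) vs) ns = map ((!) vs) js"
  shows "ns = js"
  using assms by (intro map_inj_on[of "(!) vs"]) (auto simp: inj_on_def nth_eq_iff_index_eq subset_iff)

text \<open>The vertices are listed without repetition, so each end of an edge and each tail has
  exactly one position in \<open>vs\<close>.\<close>

lemma ex1_pres:
  assumes G: "is_graph G" and N: "(vs, L, ts) \<in> permutations_of_set (gverts G) \<times>
    orientations (gflip G) {h \<in> ghalfs G. gflip G h \<noteq> h} \<times> permutations_of_set {h \<in> ghalfs G. gflip G h = h}"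
  shows "\<exists>!x. pres G vs L ts (fst x) (fst (snd x)) (snd (snd x))"
proof -
  let ?V = "gverts G" and ?I = "{h \<in> ghalfs G. gflip G h \<noteq> h}" and ?T = "{h \<in> ghalfs G. gflip G h = h}"
  have vs: "distinct vs" "set vs = ?V" and L: "distinct (L @ map (gflip G) L)" "set L \<union> gflip G ` set L = ?I"
    and ts: "distinct ts" "set ts = ?T"
    using N by (auto simp: permutations_of_set_def orientations_def)
  have sub: "set (map (gattach G) L) \<subseteq> set vs" "set (map (\<lambda>h. gattach G (gflip G h)) L) \<subseteq> set vs" "set (map (gattach G) ts) \<subseteq> set vs"
    using G L ts vs by (auto simp: is_graph_def)
  obtain as where as: "set as \<subseteq> {..<length vs}" "map (gattach G) L = map ((!) vs) as" using ex_nth_list[OF sub(1)] by auto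
  obtain bs where bs: "set bs \<subseteq> {..<length vs}" "map (\<lambda>h. gattach G (gflip G h)) L = map ((!) vs) bs" using ex_nth_list[OF sub(2)] by auto
  obtain us where us: "set us \<subseteq> {..<length vs}" "map (gattach G) ts = map ((!) vs) us" using ex_nth_list[OF sub(3)] by auto
  have len: "length as = length bs" using as(2) bs(2) by (metis length_map)
  have dd: "distinct (L @ map (gflip G) L @ ts)" "set (L @ map (gflip G) L @ ts) = ghalfs G"
  proof -
    have "set ts \<inter> (set L \<union> gflip G ` set L) = {}" using L(2) ts(2) by auto
    then show "distinct (L @ map (gflip G) L @ ts)" using L(1) ts(1) by auto
    have "set (L @ map (gflip G) L @ ts) = ?I \<union> ?T" using L(2) ts(2) by auto
    then show "set (L @ map (gflip G) L @ ts) = ghalfs G" by auto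
  qed
  have "set (zip as bs) \<subseteq> {..<length vs} \<times> {..<length vs}"
    using as(1) bs(1) set_zip_leftD set_zip_rightD by fastforce
  moreover have "map (\<lambda>e. vs ! fst e) (zip as bs) = map ((!) vs) (map fst (zip as bs))"
    "map (\<lambda>e. vs ! snd e) (zip as bs) = map ((!) vs) (map snd (zip as bs))" by simp_all
  ultimately have P: "pres G vs L ts (map (ggenus G) vs) (zip as bs) us"
    unfolding pres_def using vs dd ts us as(2) bs(2) len by simp
  show ?thesis
  proof (rule ex1I[of _ "(map (ggenus G) vs, zip as bs, us)"])
    fix x assume "pres G vs L ts (fst x) (fst (snd x)) (snd (snd x))"
    moreover obtain gs' es' us' where x: "x = (gs', es', us')" by (cases x)
    ultimately have Q: "pres G vs L ts gs' es' us'" by simp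
    have es': "set (map fst es') \<subseteq> {..<length vs}" "set (map snd es') \<subseteq> {..<length vs}" using Q by (auto simp: pres_def)
    have "map ((!) vs) (map fst es') = map ((!) vs) as" "map ((!) vs) (map snd es') = map ((!) vs) bs"
      using Q as(2) bs(2) by (simp_all add: pres_def comp_def)
    then have "map fst es' = as" "map snd es' = bs"
      using inj_map_nth[OF vs(1)] es' as(1) bs(1) by blast+
    then have "es' = zip as bs" by (metis zip_map_fst_snd)
    moreover have "us' = us" using Q us by (intro inj_map_nth[OF vs(1)]) (auto simp: pres_def)
    moreover have "gs' = map (ggenus G) vs" using Q by (simp add: pres_def)
    ultimately show "x = (map (ggenus G) vs, zip as bs, us)" using x by simp
  qed (use P in simp)
qed

text \<open>Double counting: \<open>X\<close> sends a choice of the three lists to its type, and by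
  \<open>card_pres_eq_num_aut\<close> all of its fibres have \<open>num_aut G\<close>
  elements.\<close>

lemma card_ptypes:
  assumes G: "is_graph G" and p: "pres G vs0 L0 ts0 gs0 es0 us0"
  shows "finite (ptypes G)"
    and "card (ptypes G) * num_aut G = fact (length gs0) * (fact (length es0) * 2 ^ length es0) * fact (length us0)"
proof -
  let ?V = "gverts G" and ?I = "{h \<in> ghalfs G. gflip G h \<noteq> h}" and ?T = "{h \<in> ghalfs G. gflip G h = h}"
  let ?N = "permutations_of_set ?V \<times> orientations (gflip G) ?I \<times> permutations_of_set ?T"
  have fin: "finite ?V" "finite ?I" "finite ?T" using G by (auto simp: is_graph_def)
  have inv: "gflip G h \<in> ?I \<and> gflip G (gflip G h) = h \<and> gflip G h \<noteq> h" if "h \<in> ?I" for h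
    using that G by (auto simp: is_graph_def)
  have N: "(vs, L, ts) \<in> ?N" if "pres G vs L ts gs es us" for vs L ts gs es us
  proof -
    have h: "ghalfs G = set L \<union> gflip G ` set L \<union> set ts" and d: "distinct (L @ map (gflip G) L)" "distinct ts"
      "\<And>h. h \<in> set ts \<Longrightarrow> gflip G h = h" "set ts \<inter> (set L \<union> gflip G ` set L) = {}"
      using that by (auto simp: pres_def)
    have nf: "gflip G h \<noteq> h" if "h \<in> set L" for h using d(1) that by (auto simp: disjoint_iff image_iff) metis
    have nf': "gflip G h \<noteq> h" if hL: "h \<in> gflip G ` set L" for h
    proof -
      obtain x where x: "h = gflip G x" "x \<in> set L" using hL by auto
      then have "gflip G h = x" using G h by (auto simp: is_graph_def)
      then show ?thesis using nf x by metis
    qed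
    have IT: "set L \<union> gflip G ` set L = ?I" "set ts = ?T" using h d(3) nf nf' by blast+
    have "vs \<in> permutations_of_set ?V" using that by (simp add: permutations_of_set_def pres_def)
    moreover have "L \<in> orientations (gflip G) ?I"
      unfolding orientations_def mem_Collect_eq set_append set_map using d(1) IT(1) by blast
    moreover have "ts \<in> permutations_of_set ?T"
      unfolding permutations_of_set_def mem_Collect_eq using d(2) IT(2) by blast
    ultimately show ?thesis by blast
  qed
  have ex: "\<exists>!x. pres G vs L ts (fst x) (fst (snd x)) (snd (snd x))" if "(vs, L, ts) \<in> ?N" for vs L ts
    by (rule ex1_pres[OF G that])
  have cI: "card ?I = 2 * length L0" and cT: "card ?T = length ts0" and cV: "card ?V = length vs0"
  proof -
    have n0: "(vs0, L0, ts0) \<in> ?N" by (rule N[OF p])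
    then have "?I = set (L0 @ map (gflip G) L0)" "distinct (L0 @ map (gflip G) L0)" by (auto simp: orientations_def)
    then show "card ?I = 2 * length L0" by (metis distinct_card length_append length_map mult_2)
    have "set ts0 = ?T" "distinct ts0" "set vs0 = ?V" "distinct vs0" using n0 by (auto simp: permutations_of_set_def)
    then show "card ?T = length ts0" "card ?V = length vs0" by (metis distinct_card)+
  qed
  note o = card_orientations[OF fin(2) cI inv]
  have finN: "finite ?N" using fin o by auto
  have cN: "card ?N = fact (length gs0) * (fact (length es0) * 2 ^ length es0) * fact (length us0)"
    using fin o cT cV pres_lengths[OF p] by (simp add: card_cartesian_product)
  define X where "X \<nu> = (THE x. pres G (fst \<nu>) (fst (snd \<nu>)) (snd (snd \<nu>)) (fst x) (fst (snd x)) (snd (snd x)))" for \<nu>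
  have X: "X (vs, L, ts) = (gs, es, us) \<longleftrightarrow> pres G vs L ts gs es us" if "(vs, L, ts) \<in> ?N" for vs L ts gs es us
  proof
    assume "X (vs, L, ts) = (gs, es, us)"
    then show "pres G vs L ts gs es us" using theI'[OF ex[OF that]] by (simp add: X_def)
  next
    assume "pres G vs L ts gs es us"
    then show "X (vs, L, ts) = (gs, es, us)" unfolding X_def by (simp add: the1_equality[OF ex[OF that]])
  qed
  have im: "X ` ?N = ptypes G"
  proof (intro set_eqI iffI)
    fix x assume "x \<in> X ` ?N"
    then obtain vs L ts where "(vs, L, ts) \<in> ?N" "X (vs, L, ts) = x" by auto
    then show "x \<in> ptypes G" using X by (cases x) (auto simp: ptypes_def)
  next
    fix x assume "x \<in> ptypes G"
    then obtain vs L ts gs es us where x: "x = (gs, es, us)" "pres G vs L ts gs es us" by (auto simp: ptypes_def)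
    have "X (vs, L, ts) = x" using X[OF N[OF x(2)], of gs es us] x by blast
    then show "x \<in> X ` ?N" using N[OF x(2)] by (rule image_eqI[OF sym])
  qed
  show f: "finite (ptypes G)" unfolding im[symmetric] using finN by simp
  have "card ?N = (\<Sum>x\<in>ptypes G. card {\<nu> \<in> ?N. X \<nu> = x})"
    using sum.group[OF finN f, of X "\<lambda>_. 1 :: nat"] im by simp
  also have "\<dots> = (\<Sum>x\<in>ptypes G. num_aut G)"
  proof (intro sum.cong refl)
    fix x assume "x \<in> ptypes G"
    then obtain vs L ts gs es us where x: "x = (gs, es, us)" "pres G vs L ts gs es us" by (auto simp: ptypes_def)
    have "{\<nu> \<in> ?N. X \<nu> = x} = {(vs, L, ts). pres G vs L ts gs es us}"
    proof (intro set_eqI iffI)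
      fix \<nu> assume "\<nu> \<in> {\<nu> \<in> ?N. X \<nu> = x}"
      moreover obtain vs L ts where "\<nu> = (vs, L, ts)" by (cases \<nu>)
      ultimately show "\<nu> \<in> {(vs, L, ts). pres G vs L ts gs es us}" using X x(1) by blast
    next
      fix \<nu> assume "\<nu> \<in> {(vs, L, ts). pres G vs L ts gs es us}"
      then obtain vs L ts where \<nu>: "\<nu> = (vs, L, ts)" "pres G vs L ts gs es us" by blast
      then show "\<nu> \<in> {\<nu> \<in> ?N. X \<nu> = x}" using X[OF N[OF \<nu>(2)], of gs es us] N[OF \<nu>(2)] x(1) by blast
    qed
    then show "card {\<nu> \<in> ?N. X \<nu> = x} = num_aut G" using card_pres_eq_num_aut[OF G x(2)] by simp
  qed
  finally show "card (ptypes G) * num_aut G = fact (length gs0) * (fact (length es0) * 2 ^ length es0) * fact (length us0)"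
    using cN by simp
qed

lemma orientations_nonempty:
  assumes "finite I" "\<And>h. h \<in> I \<Longrightarrow> \<sigma> h \<in> I \<and> \<sigma> (\<sigma> h) = h \<and> \<sigma> h \<noteq> h"
  shows "orientations \<sigma> I \<noteq> {}"
  using assms
proof (induction I rule: finite_psubset_induct)
  case (psubset I)
  show ?case
  proof (cases "I = {}")
    case True
    then have "[] \<in> orientations \<sigma> I" by (simp add: orientations_def)
    then show ?thesis by blast
  next
    case False
    then obtain h where h: "h \<in> I" by blast
    let ?J = "I - {h, \<sigma> h}"
    have hh: "\<sigma> h \<in> I" "\<sigma> (\<sigma> h) = h" "\<sigma> h \<noteq> h" using psubset.prems[OF h] by auto
    have "\<sigma> x \<in> ?J \<and> \<sigma> (\<sigma> x) = x \<and> \<sigma> x \<noteq> x" if x: "x \<in> ?J" for x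
    proof -
      have a: "\<sigma> x \<in> I" "\<sigma> (\<sigma> x) = x" "\<sigma> x \<noteq> x" using x psubset.prems by auto
      have "\<sigma> x \<noteq> h" using x a(2) by auto
      moreover have "\<sigma> x \<noteq> \<sigma> h" using x hh(2) a(2) by (metis DiffD2 insertI1)
      ultimately show ?thesis using a by simp
    qed
    moreover have "?J \<subset> I" using h by blast
    ultimately obtain L where L: "L \<in> orientations \<sigma> ?J" using psubset.IH[of ?J] by blast
    then have "set L \<union> \<sigma> ` set L = ?J" by (auto simp: orientations_def)
    then have "h # L \<in> orientations \<sigma> I" using L h hh by (auto simp: orientations_def)
    then show ?thesis by blast
  qed
qed

lemma ex_pres:
  assumes G: "is_graph G"
  obtains vs L ts gs es us where "pres G vs L ts gs es us"
proof -
  let ?I = "{h \<in> ghalfs G. gflip G h \<noteq> h}" and ?T = "{h \<in> ghalfs G. gflip G h = h}"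
  have fin: "finite (gverts G)" "finite ?I" "finite ?T" using G by (auto simp: is_graph_def)
  have "orientations (gflip G) ?I \<noteq> {}"
    by (rule orientations_nonempty[OF fin(2)]) (use G in \<open>auto simp: is_graph_def\<close>)
  then obtain L where "L \<in> orientations (gflip G) ?I" by blast
  moreover obtain vs where "vs \<in> permutations_of_set (gverts G)"
    using finite_distinct_list[OF fin(1)] by (auto simp: permutations_of_set_def)
  moreover obtain ts where "ts \<in> permutations_of_set ?T"
    using finite_distinct_list[OF fin(3)] by (auto simp: permutations_of_set_def)
  ultimately obtain x where "pres G vs L ts (fst x) (fst (snd x)) (snd (snd x))"
    using ex1_pres[OF G, of vs L ts] by blast
  then show thesis by (rule that)
qed

text \<open>With E edges, the half-edges below E are the first ends, those from E to 2E - 1 the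
  second ends, and the rest are tails. It shows that every admissible type is realised by a graph on
  natural numbers.\<close>

definition std_graph :: "nat list \<Rightarrow> (nat \<times> nat) list \<Rightarrow> nat list \<Rightarrow> (nat, nat) graph" where
  "std_graph gs es us = \<lparr>gverts = {..<length gs}, ggenus = (!) gs, ghalfs = {..<2 * length es + length us},
     gattach = (!) (map fst es @ map snd es @ us),
     gflip = (\<lambda>h. if h < length es then h + length es else if h < 2 * length es then h - length es else h)\<rparr>"

lemma std_graph:
  assumes "set es \<subseteq> {..<length gs} \<times> {..<length gs}" "set us \<subseteq> {..<length gs}"
  shows "is_graph (std_graph gs es us)"
    and "pres (std_graph gs es us) [0..<length gs] [0..<length es] [2 * length es..<2 * length es + length us] gs es us"
proof -
  let ?E = "length es" and ?t = "length us" and ?k = "length gs"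
  have at: "(map fst es @ map snd es @ us) ! h < ?k" if "h < 2 * ?E + ?t" for h
  proof -
    have "(map fst es @ map snd es @ us) ! h \<in> set (map fst es @ map snd es @ us)" using that by (intro nth_mem) simp
    then show ?thesis using assms by auto
  qed
  show "is_graph (std_graph gs es us)"
    using at by (auto simp: is_graph_def std_graph_def)
  have fl: "map (gflip (std_graph gs es us)) [0..<?E] = [?E..<2 * ?E]"
    by (intro nth_equalityI) (auto simp: std_graph_def)
  have e: "[0..<?E] @ [?E..<2 * ?E] @ [2 * ?E..<2 * ?E + ?t] = [0..<2 * ?E + ?t]"
    using upt_add_eq_append[of 0 "2 * ?E" ?t] upt_add_eq_append[of 0 ?E ?E] by (simp add: mult_2)
  have ge: "fst (es ! i) < ?k" "snd (es ! i) < ?k" if "i < ?E" for i using assms(1) nth_mem[OF that] by force+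
  have gt: "us ! i < ?k" if "i < ?t" for i using assms(2) nth_mem[OF that] by force
  show "pres (std_graph gs es us) [0..<?k] [0..<?E] [2 * ?E..<2 * ?E + ?t] gs es us"
    unfolding pres_def fl e
  proof (intro conjI)
    show "map (gattach (std_graph gs es us)) [0..<?E] = map (\<lambda>e. [0..<?k] ! fst e) es"
      using ge by (intro nth_equalityI) (auto simp: std_graph_def nth_append)
    show "map (\<lambda>h. gattach (std_graph gs es us) (gflip (std_graph gs es us) h)) [0..<?E] = map (\<lambda>e. [0..<?k] ! snd e) es"
      using ge by (intro nth_equalityI) (auto simp: std_graph_def nth_append)
    show "map (gattach (std_graph gs es us)) [2 * ?E..<2 * ?E + ?t] = map ((!) [0..<?k]) us"
      using gt by (intro nth_equalityI) (auto simp: std_graph_def nth_append)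
    show "map (ggenus (std_graph gs es us)) [0..<?k] = gs" by (simp add: std_graph_def map_nth)
  qed (use assms in \<open>auto simp: std_graph_def\<close>)
qed

text \<open>The adjacency relation of the graph and the symmetrised edge list differ only in
  diagonal pairs, which come from tails and do not affect the reflexive closure.\<close>

lemma pres_connected:
  assumes G: "is_graph G" and p: "pres G vs L ts gs es us"
  shows "connected_graph G \<longleftrightarrow> length gs > 0 \<and> conn {..<length gs} es"
proof -
  let ?k = "length gs" and ?f = "(!) vs"
  let ?r = "{(gattach G h, gattach G (gflip G h)) | h. h \<in> ghalfs G}"
  let ?es = "map (map_prod ?f ?f) es"
  note l = pres_lengths[OF p]
  have hs: "ghalfs G = set L \<union> gflip G ` set L \<union> set ts" and V: "set vs = gverts G" "distinct vs"
    and es: "set es \<subseteq> {..<?k} \<times> {..<?k}" using p l by (auto simp: pres_def)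
  have "?es = zip (map (\<lambda>e. vs ! fst e) es) (map (\<lambda>e. vs ! snd e) es)"
    by (simp add: zip_map_map map_prod_def case_prod_unfold zip_same_conv_map)
  also have "\<dots> = zip (map (gattach G) L) (map (\<lambda>h. gattach G (gflip G h)) L)"
    using p by (simp add: pres_def)
  also have "\<dots> = map (\<lambda>h. (gattach G h, gattach G (gflip G h))) L" by (simp add: zip_map_map zip_same_conv_map)
  finally have e: "set ?es = (\<lambda>h. (gattach G h, gattach G (gflip G h))) ` set L" by (simp only: set_map)
  have ff: "gflip G (gflip G h) = h" if "h \<in> set L" for h using that G hs by (auto simp: is_graph_def)
  have s1: "symedges ?es \<subseteq> ?r"
  proof
    fix x assume "x \<in> symedges ?es"
    then obtain h where h: "h \<in> set L" and x: "x = (gattach G h, gattach G (gflip G h)) \<or> x = (gattach G (gflip G h), gattach G h)"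
      unfolding symedges_def e by auto
    have hG: "h \<in> ghalfs G" "gflip G h \<in> ghalfs G" using h hs by auto
    from x show "x \<in> ?r"
    proof
      assume "x = (gattach G (gflip G h), gattach G h)"
      then have "x = (gattach G (gflip G h), gattach G (gflip G (gflip G h)))" using ff[OF h] by simp
      then show ?thesis using hG by blast
    qed (use hG in blast)
  qed
  have s2: "?r \<subseteq> symedges ?es \<union> Id"
  proof
    fix x assume "x \<in> ?r"
    then obtain h where h: "h \<in> ghalfs G" and x: "x = (gattach G h, gattach G (gflip G h))" by auto
    then consider "h \<in> set L" | h' where "h' \<in> set L" "h = gflip G h'" | "h \<in> set ts" using hs by auto
    then show "x \<in> symedges ?es \<union> Id"
    proof cases
      case 1
      then have "x \<in> set ?es" unfolding e x by blast
      then show ?thesis by (simp add: symedges_def)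
    next
      case 2
      then have "x = (gattach G (gflip G h'), gattach G h')" using x ff by simp
      moreover have "(gattach G h', gattach G (gflip G h')) \<in> set ?es" unfolding e using 2 by blast
      ultimately show ?thesis by (simp add: symedges_def)
    next
      case 3
      then have "gflip G h = h" using p by (auto simp: pres_def)
      then show ?thesis using x by simp
    qed
  qed
  have r: "?r\<^sup>* = (symedges ?es)\<^sup>*"
  proof
    show "?r\<^sup>* \<subseteq> (symedges ?es)\<^sup>*" using rtrancl_mono[OF s2] by simp
    show "(symedges ?es)\<^sup>* \<subseteq> ?r\<^sup>*" by (rule rtrancl_mono[OF s1])
  qed
  have inj: "inj_on ?f {..<?k}" and im: "?f ` {..<?k} = gverts G"
    using V l(1) by (auto simp: inj_on_def nth_eq_iff_index_eq set_conv_nth)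
  have "connected_graph G \<longleftrightarrow> gverts G \<noteq> {} \<and> conn (gverts G) ?es"
    unfolding connected_graph_def r conn_def ..
  also have "conn (gverts G) ?es \<longleftrightarrow> conn {..<?k} es"
    using conn_map[OF inj es] by (simp only: im)
  also have "gverts G \<noteq> {} \<longleftrightarrow> ?k > 0" using V l(1) by auto
  finally show ?thesis .
qed

section \<open>The first Betti number\<close>

interpretation fv: vector_space "\<lambda>(r::real) (c :: 'h \<Rightarrow> real) h. r * c h"
  by unfold_locales (auto simp: fun_eq_iff algebra_simps)

text \<open>\<open>dim\<close> also yields 0 in infinite dimension, so statements on dimension carry
  a finite basis along.\<close>

definition has_dim :: "('h \<Rightarrow> real) set \<Rightarrow> nat \<Rightarrow> bool" where
  "has_dim S d \<longleftrightarrow> (\<exists>B. finite B \<and> B \<subseteq> S \<and> fv.independent B \<and> S \<subseteq> fv.span B \<and> card B = d)"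

lemma has_dim_dim: "has_dim S d \<Longrightarrow> fv.dim S = d"
  unfolding has_dim_def using fv.basis_card_eq_dim by metis

lemma has_dim_subset:
  assumes "has_dim S d" "T \<subseteq> S"
  shows "has_dim T (fv.dim T)"
proof -
  obtain B where B: "finite B" "S \<subseteq> fv.span B" using assms by (auto simp: has_dim_def)
  obtain C where C: "C \<subseteq> T" "fv.independent C" "T \<subseteq> fv.span C" "card C = fv.dim T"
    using fv.basis_exists by metis
  have "C \<subseteq> fv.span B" using C(1) assms(2) B(2) by blast
  then have "finite C" using fv.independent_span_bound[OF B(1) C(2)] by simp
  then show ?thesis unfolding has_dim_def using C by blast
qed

text \<open>Rank and nullity for one linear functional: a vector \<open>s\<close> on which it does
  not vanish spans a complement of the kernel.\<close>

lemma has_dim_kernel: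
  fixes f :: "('h \<Rightarrow> real) \<Rightarrow> real"
  assumes S: "fv.subspace S" and f: "\<And>x y. f (x + y) = f x + f y" "\<And>r x. f (\<lambda>h. r * x h) = r * f x"
    and s: "s \<in> S" "f s \<noteq> 0" and d: "has_dim {x \<in> S. f x = 0} d"
  shows "has_dim S (Suc d)"
proof -
  obtain B where B: "finite B" "B \<subseteq> {x \<in> S. f x = 0}" "fv.independent B" "{x \<in> S. f x = 0} \<subseteq> fv.span B" "card B = d"
    using d by (auto simp: has_dim_def)
  have f0: "f 0 = 0" using f(1)[of 0 0] by simp
  have "fv.subspace {x. f x = 0}"
    unfolding fv.subspace_def using f f0 by auto
  then have "fv.span B \<subseteq> {x. f x = 0}" using B(2) by (intro fv.span_minimal) auto
  then have ns: "s \<notin> fv.span B" using s by auto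
  then have "s \<notin> B" using fv.span_base by blast
  moreover have "fv.independent (insert s B)" using B(3) ns by (simp add: fv.independent_insert)
  moreover have "S \<subseteq> fv.span (insert s B)"
  proof
    fix x assume x: "x \<in> S"
    \<comment> \<open>Subtracting this multiple of \<open>s\<close> from \<open>x\<close> lands in
      the kernel.\<close>
    let ?r = "f x / f s"
    let ?y = "x + (\<lambda>h. (- ?r) * s h)"
    have "?y \<in> S" using S x s unfolding fv.subspace_def by blast
    moreover have "f ?y = 0" unfolding f using s by simp
    ultimately have "?y \<in> fv.span (insert s B)" using B(4) fv.span_mono[of B "insert s B"] by blast
    moreover have "(\<lambda>h. ?r * s h) \<in> fv.span (insert s B)" by (intro fv.span_scale fv.span_base) simp
    ultimately have "?y + (\<lambda>h. ?r * s h) \<in> fv.span (insert s B)" by (rule fv.span_add)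
    moreover have "?y + (\<lambda>h. ?r * s h) = x" by (simp add: fun_eq_iff)
    ultimately show "x \<in> fv.span (insert s B)" by metis
  qed
  ultimately show ?thesis unfolding has_dim_def using B s(1) by (intro exI[of _ "insert s B"]) auto
qed

section \<open>Chains, boundaries and cycles\<close>

definition chains :: "('v, 'h) graph \<Rightarrow> ('h \<Rightarrow> real) set" where
  "chains G = {c. (\<forall>h. h \<notin> ghalfs G \<longrightarrow> c h = 0) \<and> (\<forall>h\<in>ghalfs G. c (gflip G h) = - c h)}"

definition bd :: "('v, 'h) graph \<Rightarrow> 'v \<Rightarrow> ('h \<Rightarrow> real) \<Rightarrow> real" where
  "bd G v c = (\<Sum>h\<in>{h \<in> ghalfs G. gattach G h = v}. c h)"

definition edge_chain :: "('v, 'h) graph \<Rightarrow> 'h \<Rightarrow> 'h \<Rightarrow> real" where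
  "edge_chain G h x = of_bool (x = h) - of_bool (x = gflip G h)"

lemma bd_linear: "bd G v (x + y) = bd G v x + bd G v y" "bd G v (\<lambda>h. r * x h) = r * bd G v x"
  by (simp_all add: bd_def sum.distrib sum_distrib_left)

lemma edge_chain:
  assumes "is_graph G" "h \<in> ghalfs G"
  shows "edge_chain G h \<in> chains G"
    and "bd G v (edge_chain G h) = of_bool (gattach G h = v) - of_bool (gattach G (gflip G h) = v)"
proof -
  have G: "finite (ghalfs G)" "\<And>h. h \<in> ghalfs G \<Longrightarrow> gflip G h \<in> ghalfs G \<and> gflip G (gflip G h) = h"
    using assms(1) by (auto simp: is_graph_def)
  have "gflip G x = h \<longleftrightarrow> x = gflip G h" "gflip G x = gflip G h \<longleftrightarrow> x = h" if "x \<in> ghalfs G" for x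
    using G(2)[OF that] G(2)[OF assms(2)] by metis+
  then show "edge_chain G h \<in> chains G"
    using G(2)[OF assms(2)] assms(2) by (auto simp: chains_def edge_chain_def)
  have fin: "finite {h \<in> ghalfs G. gattach G h = v}" using G(1) by simp
  have ind: "(\<Sum>x\<in>{h \<in> ghalfs G. gattach G h = v}. of_bool (x = y)) = (of_bool (gattach G y = v) :: real)" if "y \<in> ghalfs G" for y
    using fin that by (simp add: of_bool_def)
  show "bd G v (edge_chain G h) = of_bool (gattach G h = v) - of_bool (gattach G (gflip G h) = v)"
    unfolding bd_def edge_chain_def sum_subtractf using ind[OF assms(2)] ind[of "gflip G h"] G(2)[OF assms(2)] by simp
qed

lemma chains_add: "x \<in> chains G \<Longrightarrow> y \<in> chains G \<Longrightarrow> x + y \<in> chains G"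
  and chains_scale: "x \<in> chains G \<Longrightarrow> (\<lambda>h. r * x h) \<in> chains G"
  and chains_0: "0 \<in> chains G"
  by (auto simp: chains_def)

text \<open>The edges along a path are added up, and their boundaries telescope to the two end
  points.\<close>

lemma path_chain:
  assumes G: "is_graph G" and uv: "(u, v) \<in> {(gattach G h, gattach G (gflip G h)) | h. h \<in> ghalfs G}\<^sup>*"
  shows "\<exists>c\<in>chains G. \<forall>x. bd G x c = of_bool (u = x) - of_bool (v = x)"
  using uv
proof induction
  case base
  show ?case by (intro bexI[of _ 0] chains_0) (simp add: bd_def)
next
  case (step y z)
  then obtain h where h: "h \<in> ghalfs G" "y = gattach G h" "z = gattach G (gflip G h)" by auto
  obtain c where c: "c \<in> chains G" "\<And>x. bd G x c = of_bool (u = x) - of_bool (y = x)" using step by auto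
  have "bd G x (c + edge_chain G h) = of_bool (u = x) - of_bool (z = x)" for x
    unfolding bd_linear(1) c(2) edge_chain(2)[OF G h(1)] h(2,3) by simp
  then show ?case using chains_add[OF c(1) edge_chain(1)[OF G h(1)]] by blast
qed

text \<open>The values on \<open>L\<close> are free coordinates: antisymmetry determines a chain on
  the opposite half-edges and makes it vanish on tails. The induction frees one coordinate at a
  time, with \<open>edge_chain\<close> as the new basis vector.\<close>

lemma has_dim_chains:
  assumes G: "is_graph G" and p: "pres G vs L ts gs es us"
  shows "has_dim (chains G) (length L)"
proof -
  have hs: "ghalfs G = set L \<union> gflip G ` set L \<union> set ts" and d: "distinct L" "set L \<inter> gflip G ` set L = {}"
    and ts: "\<And>h. h \<in> set ts \<Longrightarrow> gflip G h = h"
    using p by (auto simp: pres_def)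
  let ?A = "\<lambda>J. {c \<in> chains G. \<forall>h\<in>set L - J. c h = 0}"
  have "has_dim (?A J) (card J)" if "J \<subseteq> set L" for J
    using finite_subset[OF that finite_set] that
  proof (induction J rule: finite_induct)
    case empty
    have "c = 0" if "c \<in> ?A {}" for c
    proof
      fix h
      show "c h = 0 h"
      proof (cases "h \<in> ghalfs G")
        case True
        then consider "h \<in> set L" | h' where "h' \<in> set L" "h = gflip G h'" | "h \<in> set ts" using hs by auto
        then show ?thesis
        proof cases
          case 2
          then have "c h = - c h'" using that hs by (auto simp: chains_def)
          then show ?thesis using 2 that by simp
        next
          case 3
          then have "c (gflip G h) = - c h" using that True by (auto simp: chains_def)
          then show ?thesis using ts[OF 3] by simp
        qed (use that in auto)
      qed (use that in \<open>auto simp: chains_def\<close>)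
    qed
    then show ?case unfolding has_dim_def by (intro exI[of _ "{}"]) (auto simp: fv.independent_empty)
  next
    case (insert h J)
    have h: "h \<in> set L" "h \<in> ghalfs G" using insert hs by auto
    have e: "edge_chain G h x = 0" if "x \<in> set L" "x \<noteq> h" for x
      using that d h by (auto simp: edge_chain_def)
    have "edge_chain G h h = 1" using d h by (auto simp: edge_chain_def)
    have "has_dim (?A (insert h J)) (Suc (card J))"
    proof (rule has_dim_kernel[of _ "\<lambda>c. c h" "edge_chain G h"])
      show "fv.subspace (?A (insert h J))"
        unfolding fv.subspace_def by (auto intro: chains_add chains_scale chains_0)
      show "edge_chain G h \<in> ?A (insert h J)" using edge_chain(1)[OF G h(2)] e by auto
      show "edge_chain G h h \<noteq> 0" using \<open>edge_chain G h h = 1\<close> by simp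
      have "{x \<in> ?A (insert h J). x h = 0} = ?A J" using h insert by auto
      then show "has_dim {x \<in> ?A (insert h J). x h = 0} (card J)" using insert by simp
    qed auto
    then show ?case using insert by simp
  qed
  from this[of "set L"] show ?thesis using distinct_card[OF d(1)] by simp
qed

text \<open>Starting from chains without boundary away from a root \<open>r\<close>, the conditions
  at the other vertices are released one at a time. Each release raises the dimension by 1, because
  connectedness provides a chain with boundary v - r. The total is l = b_1 + (k - 1).\<close>

theorem betti1_connected:
  assumes G: "is_graph G" and p: "pres G vs L ts gs es us" and c: "connected_graph G"
  shows "betti1 G + length gs = length es + 1"
proof -
  let ?V = "gverts G"
  obtain r where r: "r \<in> ?V" using c by (auto simp: connected_graph_def)
  have finV: "finite ?V" and finH: "finite (ghalfs G)"
    and fl: "\<And>h. h \<in> ghalfs G \<Longrightarrow> gflip G h \<in> ghalfs G \<and> gflip G (gflip G h) = h \<and> gattach G h \<in> ?V"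
    using G by (auto simp: is_graph_def)
  define Z where "Z W = {c \<in> chains G. \<forall>v\<in>W. bd G v c = 0}" for W
  have dimA: "has_dim (chains G) (length L)" by (rule has_dim_chains[OF G p])
  let ?d = "fv.dim (Z (?V - {r}))"
  have d: "has_dim (Z (?V - {r})) ?d" by (rule has_dim_subset[OF dimA]) (auto simp: Z_def)
  have "has_dim (Z (?V - {r} - J)) (?d + card J)" if "J \<subseteq> ?V - {r}" for J
    using finite_subset[OF that finite_Diff[OF finV]] that
  proof (induction J rule: finite_induct)
    case (insert v J)
    let ?W = "?V - {r} - insert v J"
    have v: "v \<in> ?V" "v \<noteq> r" using insert by auto
    have "(v, r) \<in> {(gattach G h, gattach G (gflip G h)) | h. h \<in> ghalfs G}\<^sup>*"
      using c v(1) r unfolding connected_graph_def by blast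
    from path_chain[OF G this] obtain s
      where s: "s \<in> chains G" "\<And>x. bd G x s = of_bool (v = x) - of_bool (r = x)" by blast
    have "has_dim (Z ?W) (Suc (?d + card J))"
    proof (rule has_dim_kernel[of _ "bd G v" s])
      have "bd G x 0 = 0" for x by (simp add: bd_def)
      then show "fv.subspace (Z ?W)"
        unfolding fv.subspace_def Z_def
        by (intro conjI ballI allI; clarsimp simp del: plus_fun_apply)
          (simp_all only: bd_linear chains_add chains_scale chains_0, simp_all)
      show "s \<in> Z ?W" using s by (auto simp: Z_def)
      show "bd G v s \<noteq> 0" using s v by simp
      have "{x \<in> Z ?W. bd G v x = 0} = Z (?V - {r} - J)" using insert v by (auto simp: Z_def)
      then show "has_dim {x \<in> Z ?W. bd G v x = 0} (?d + card J)" using insert by simp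
    qed (rule bd_linear)+
    then show ?case using insert by simp
  qed (use d in simp)
  from this[of "?V - {r}"] have "has_dim (Z {}) (?d + (card ?V - 1))" using r by simp
  then have "fv.dim (Z {}) = ?d + (card ?V - 1)" by (rule has_dim_dim)
  moreover have "Z {} = chains G" by (simp add: Z_def)
  ultimately have "length L = ?d + (card ?V - 1)" using has_dim_dim[OF dimA] by simp
  moreover have "card ?V > 0" using r finV by (auto simp: card_gt_0_iff)
  moreover have "Z (?V - {r}) = cycle_space G"
  proof -
    \<comment> \<open>The boundaries at all vertices add up to the sum of \<open>x\<close> over all
      half-edges, which is 0 by antisymmetry; so the condition at the root follows from the
      others.\<close>
    have "bd G r x = 0" if x: "x \<in> Z (?V - {r})" for x
    proof -
      have "(\<Sum>h\<in>ghalfs G. x h) = (\<Sum>h\<in>ghalfs G. x (gflip G h))"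
        by (rule sum.reindex_bij_witness[of _ "gflip G" "gflip G"]) (use fl in auto)
      also have "\<dots> = (\<Sum>h\<in>ghalfs G. - x h)" using x by (intro sum.cong) (auto simp: Z_def chains_def)
      finally have "(\<Sum>h\<in>ghalfs G. x h) = 0" by (simp add: sum_negf)
      moreover have "(\<Sum>v\<in>?V. bd G v x) = (\<Sum>h\<in>ghalfs G. x h)"
        unfolding bd_def by (rule sum.group) (use finV finH fl in auto)
      moreover have "(\<Sum>v\<in>?V. bd G v x) = bd G r x + (\<Sum>v\<in>?V - {r}. bd G v x)"
        using r finV by (simp add: sum.remove)
      moreover have "(\<Sum>v\<in>?V - {r}. bd G v x) = 0" using x by (intro sum.neutral) (auto simp: Z_def)
      ultimately show ?thesis by simp
    qed
    then show ?thesis by (auto simp: Z_def cycle_space_def chains_def bd_def)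
  qed
  ultimately show ?thesis using pres_lengths[OF p] by (simp add: betti1_def)
qed

section \<open>Feynman weights\<close>

text \<open>Odd variables are included because \<open>dTX\<close> turns a y into a dy. A vertex of
  valency d with e derivatives contributes d - e to this degree, which is its number of
  tails.\<close>

definition tdeg :: "'n idx \<Rightarrow> nat" where
  "tdeg m = size (fst (snd m)) + card (snd (snd m))"

definition tailpart :: "nat \<Rightarrow> ('n::{finite,linorder}, complex) bv \<Rightarrow> ('n, complex) bv" where
  "tailpart t x = Abs_bv (\<lambda>m. if tdeg m = t then Rep_bv x m else 0)"

lemma Rep_tailpart: "Rep_bv (tailpart t x) = (\<lambda>m. if tdeg m = t then Rep_bv x m else 0)"
  unfolding tailpart_def by (rule Abs_bv_inverse) (use even_Rep_bv[of x] in \<open>auto simp: even_elt_def\<close>)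

lemma tdeg_splits: "(x, y) \<in> splits m \<Longrightarrow> tdeg m = tdeg x + tdeg y"
  for m :: "'n::finite idx"
  by (auto simp: tdeg_def splits_def idx_join_def idx_disj_def card_Un_disjoint)

text \<open>Grading by \<open>tdeg\<close> is recorded by a ring homomorphism into power series.\<close>

definition tails :: "('n::{finite,linorder}, complex) bv \<Rightarrow> ('n, complex) bv fps" where
  "tails x = Abs_fps (\<lambda>t. tailpart t x)"

lemma tails_mult: "tails (x * y) = tails x * tails y"
proof (rule fps_ext, rule bv_eqI)
  fix t m
  have "Rep_bv (fps_nth (tails x * tails y) t) m
      = (\<Sum>i\<le>t. \<Sum>(a, b)\<in>splits m. idx_sgn a b * Rep_bv (tailpart i x) a * Rep_bv (tailpart (t - i) y) b)"
    by (simp add: fps_mult_nth tails_def Rep_bv_sum Rep_bv_ops elt_mult_splits atLeast0AtMost)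
  also have "\<dots> = (\<Sum>p\<in>splits m. \<Sum>i\<le>t. idx_sgn (fst p) (snd p) * Rep_bv (tailpart i x) (fst p) * Rep_bv (tailpart (t - i) y) (snd p))"
    by (subst sum.swap) (simp add: case_prod_unfold)
  also have "\<dots> = (\<Sum>p\<in>splits m. if tdeg m = t then idx_sgn (fst p) (snd p) * Rep_bv x (fst p) * Rep_bv y (snd p) else 0)"
  proof (intro sum.cong refl)
    fix p assume p: "p \<in> splits m"
    let ?f = "\<lambda>i. idx_sgn (fst p) (snd p) * Rep_bv (tailpart i x) (fst p) * Rep_bv (tailpart (t - i) y) (snd p)"
    have d: "tdeg m = tdeg (fst p) + tdeg (snd p)" using p tdeg_splits[of "fst p" "snd p" m] by simp
    have "(\<Sum>i\<le>t. ?f i) = (\<Sum>i\<le>t. if i = tdeg (fst p) then ?f (tdeg (fst p)) else 0)"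
      by (intro sum.cong refl) (auto simp: Rep_tailpart)
    also have "\<dots> = (if tdeg (fst p) \<le> t then ?f (tdeg (fst p)) else 0)" by simp
    also have "\<dots> = (if tdeg m = t then idx_sgn (fst p) (snd p) * Rep_bv x (fst p) * Rep_bv y (snd p) else 0)"
      using d by (auto simp: Rep_tailpart)
    finally show "(\<Sum>i\<le>t. ?f i) = (if tdeg m = t then idx_sgn (fst p) (snd p) * Rep_bv x (fst p) * Rep_bv y (snd p) else 0)" .
  qed
  also have "\<dots> = Rep_bv (fps_nth (tails (x * y)) t) m"
    by (simp add: tails_def Rep_tailpart Rep_bv_ops elt_mult_splits case_prod_unfold)
  finally show "Rep_bv (fps_nth (tails (x * y)) t) m = Rep_bv (fps_nth (tails x * tails y) t) m" by simp
qed

lemma tails_1: "tails 1 = 1"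
  by (rule fps_ext, rule bv_eqI) (auto simp: tails_def Rep_tailpart Rep_bv_ops mon_def tdeg_def)

lemma tails_prod: "tails (\<Prod>v\<in>K. x v) = (\<Prod>v\<in>K. tails (x v))"
  by (induction K rule: infinite_finite_induct) (simp_all add: tails_1 tails_mult)

text \<open>The coefficient of a product of power series is a sum over distributions of the exponent
  among the factors; a distribution of the tails is encoded as a multiset of vertices.\<close>

lemma Rep_prod_tailparts:
  assumes "finite K"
  shows "Rep_bv (\<Prod>v\<in>K. x v) m = (\<Sum>X\<in>multisets_of_size K (tdeg m). Rep_bv (\<Prod>v\<in>K. tailpart (count X v) (x v)) m)"
proof -
  have "Rep_bv (\<Prod>v\<in>K. x v) m = Rep_bv (fps_nth (tails (\<Prod>v\<in>K. x v)) (tdeg m)) m"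
    by (simp add: tails_def Rep_tailpart)
  then show ?thesis
    by (simp add: tails_prod fps_prod_nth'[OF assms] Rep_bv_sum) (simp add: tails_def)
qed

definition degr :: "(nat \<times> nat) list \<Rightarrow> nat \<Rightarrow> nat" where
  "degr es v = length (filter (\<lambda>e. fst e = v) es) + length (filter (\<lambda>e. snd e = v) es)"

lemma size_lab: "size (lab q v) = degr (map fst q) v"
  by (induction q) (auto simp: lab_def degr_def)

lemma wgt_cong:
  assumes "\<And>v L. v \<in> K \<Longrightarrow> size L = degr es v \<Longrightarrow> Y v L = Y' v L"
  shows "wgt cs w K es Y = wgt cs w K es Y'"
  unfolding wgt_def using assms by (intro sum.cong refl arg_cong2[of _ _ _ _ "(*)"] prod.cong) (auto simp: size_lab)

lemma wgt_loop:
  assumes "cs 0 = 0" "e \<in> set es" "fst e = snd e"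
  shows "wgt cs w K es Y = 0"
  unfolding wgt_def
proof (intro sum.neutral ballI)
  fix q :: "'b ledge list" assume "q \<in> {q. map fst q = es}"
  then have "e \<in> fst ` set q" using assms(2) by auto
  then obtain x where x: "x \<in> set q" "fst x = e" by auto
  then have "pc w \<theta> x = 0" for \<theta> using assms(3) by (simp add: pc_def)
  then have "prod_list (map (pc w \<theta>) q) = 0" for \<theta> using x(1) by (force simp: prod_list_zero_iff)
  then show "cs (PInt w K q) * (\<Prod>v\<in>K. Y v (lab q v)) = 0" by (simp add: PInt_def assms(1))
qed

lemma lieop_commute: "lieop e (lieop e' t) = lieop e' (lieop e t)"
  unfolding lieop_def by (simp only: lie_commute)

text \<open>Lets the product over the set of internal edges, a \<open>Finite_Set.fold\<close>, be
  computed along a list.\<close>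

lemma pairop_commute: "pairop w \<theta> e (pairop w \<theta> e' t) = pairop w \<theta> e' (pairop w \<theta> e t)"
proof
  fix q
  have *: "pairop w \<theta> e (pairop w \<theta> e' t) q = (\<Sum>l'\<in>UNIV. \<Sum>l\<in>UNIV. pc w \<theta> (e', l') * (pc w \<theta> (e, l) * lieop (e, l) (lieop (e', l') t) q))"
    for e e'
    unfolding pairop_def[of w \<theta> e'] pairop_sum by (simp add: pairop_def sum_distrib_left)
  show "pairop w \<theta> e (pairop w \<theta> e' t) q = pairop w \<theta> e' (pairop w \<theta> e t) q"
    unfolding * by (subst sum.swap) (simp add: lieop_commute[of "(e, _)"] mult_ac)
qed

lemma config_integral_cong:
  fixes w :: "'n::finite cmat"
  assumes "nice w k G" "\<And>\<theta>. inj_on \<theta> {..<k} \<Longrightarrow> \<theta> ` {..<k} \<subseteq> {0..<1} \<Longrightarrow> F \<theta> = G \<theta>"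
  shows "config_integral k F = config_integral k G"
  using config_integral_sum[of "{()}" w k "\<lambda>_. G" F "\<lambda>_. 1"] assms by simp

section \<open>From presentations to Feynman weights\<close>

lemma ydrs_restrict_size:
  "ydrs L (\<lambda>m. if size (fst (snd m)) + 1 = d then a m else 0)
    = (\<lambda>m. if size (fst (snd m)) + size L + 1 = d then ydrs L a m else 0)"
proof (induction L)
  case (add B L)
  then show ?case by (auto simp: ydrs_add_mset yder_def fun_eq_iff)
qed (auto simp: fun_eq_iff)

lemma ydrs_supp_T:
  assumes "\<And>m. card (snd (snd m)) \<noteq> 1 \<Longrightarrow> a m = 0" shows "card (snd (snd m)) \<noteq> 1 \<Longrightarrow> ydrs L a m = 0"
proof (induction L arbitrary: m)
  case (add B L)
  obtain S M T where m: "m = (S, M, T)" by (cases m)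
  show ?case using add.IH[of "(S, add_mset B M, T)"] add.prems by (simp add: ydrs_add_mset yder_def m)
qed (simp add: assms)

lemma pres_valency:
  assumes G: "is_graph G" and p: "pres G vs L ts gs es us" and v: "v < length gs"
  shows "valency G (vs ! v) = degr es v + count (mset us) v"
    and "num_tails G (vs ! v) = count (mset us) v"
proof -
  have hs: "set (L @ map (gflip G) L @ ts) = ghalfs G" and d: "distinct (L @ map (gflip G) L @ ts)"
    and vs: "distinct vs" and es: "set es \<subseteq> {..<length vs} \<times> {..<length vs}" "set us \<subseteq> {..<length vs}"
    and att: "map (gattach G) L = map (\<lambda>e. vs ! fst e) es" "map (\<lambda>h. gattach G (gflip G h)) L = map (\<lambda>e. vs ! snd e) es"
      "map (gattach G) ts = map ((!) vs) us" and ts: "\<And>h. h \<in> set ts \<Longrightarrow> gflip G h = h"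
    using p by (auto simp: pres_def)
  have lv: "v < length vs" using v pres_lengths[OF p] by simp
  have vi: "vs ! i = vs ! v \<longleftrightarrow> i = v" if "i < length vs" for i using that lv vs by (simp add: nth_eq_iff_index_eq)
  have cnt: "length (filter (\<lambda>h. f h = y) xs) = length (filter (\<lambda>z. z = y) (map f xs))" for f y and xs :: "'z list"
    by (simp add: filter_map comp_def)
  have c1: "length (filter (\<lambda>h. gattach G h = vs ! v) L) = length (filter (\<lambda>e. fst e = v) es)"
  proof -
    have "length (filter (\<lambda>h. gattach G h = vs ! v) L) = length (filter (\<lambda>z. z = vs ! v) (map (\<lambda>e. vs ! fst e) es))"
      unfolding att(1)[symmetric] by (rule cnt)
    also have "\<dots> = length (filter (\<lambda>e. fst e = v) es)"
      unfolding filter_map comp_def length_map using vi es by (intro arg_cong[of _ _ length] filter_cong) auto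
    finally show ?thesis .
  qed
  have c2: "length (filter (\<lambda>h. gattach G (gflip G h) = vs ! v) L) = length (filter (\<lambda>e. snd e = v) es)"
  proof -
    have "length (filter (\<lambda>h. gattach G (gflip G h) = vs ! v) L) = length (filter (\<lambda>z. z = vs ! v) (map (\<lambda>e. vs ! snd e) es))"
      unfolding att(2)[symmetric] by (rule cnt)
    also have "\<dots> = length (filter (\<lambda>e. snd e = v) es)"
      unfolding filter_map comp_def length_map using vi es by (intro arg_cong[of _ _ length] filter_cong) auto
    finally show ?thesis .
  qed
  have c3: "length (filter (\<lambda>h. gattach G h = vs ! v) ts) = count (mset us) v"
  proof -
    have "length (filter (\<lambda>h. gattach G h = vs ! v) ts) = length (filter (\<lambda>z. z = vs ! v) (map ((!) vs) us))"
      unfolding att(3)[symmetric] by (rule cnt)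
    also have "\<dots> = length (filter (\<lambda>i. i = v) us)"
      unfolding filter_map comp_def length_map using vi es(2) by (intro arg_cong[of _ _ length] filter_cong) auto
    also have "\<dots> = count (mset us) v" by (induction us) auto
    finally show ?thesis .
  qed
  have "valency G (vs ! v) = length (filter (\<lambda>h. gattach G h = vs ! v) (L @ map (gflip G) L @ ts))"
    unfolding valency_def distinct_length_filter[OF d] hs by (rule arg_cong[of _ _ card]) auto
  also have "\<dots> = degr es v + count (mset us) v"
    using c1 c2 c3 by (simp add: degr_def filter_map comp_def)
  finally show "valency G (vs ! v) = degr es v + count (mset us) v" .
  have nt: "gflip G h \<noteq> h" if "h \<in> set L \<union> gflip G ` set L" for h
  proof -
    have "set L \<inter> gflip G ` set L = {}" using d by auto
    then have a: "gflip G x \<noteq> x" if "x \<in> set L" for x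
      using imageI[OF that, of "gflip G"] that by (metis disjoint_iff)
    have b: "gflip G (gflip G x) = x" if "x \<in> set L" for x using G hs that by (auto simp: is_graph_def)
    from that show ?thesis
    proof
      assume "h \<in> gflip G ` set L"
      then obtain x where "x \<in> set L" "h = gflip G x" by blast
      then show ?thesis using a[of x] b[of x] by simp
    qed (rule a)
  qed
  have "{h \<in> ghalfs G. gattach G h = vs ! v \<and> gflip G h = h} = {h. gattach G h = vs ! v} \<inter> set ts"
    using hs ts nt by auto
  then have "num_tails G (vs ! v) = length (filter (\<lambda>h. gattach G h = vs ! v) ts)"
    unfolding num_tails_def using distinct_length_filter[of ts "\<lambda>h. gattach G h = vs ! v"] d by simp
  then show "num_tails G (vs ! v) = count (mset us) v" using c3 by simp
qed

locale bv_one_form = one_form +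
  assumes A_T: "card (snd (snd m)) \<noteq> 1 \<Longrightarrow> Rep_bv (A g) m = 0"
begin

definition partA :: "nat \<Rightarrow> nat \<Rightarrow> ('a, complex) bv" where
  "partA g d = Abs_bv (dTX (gamma_part \<gamma> g d))"

text \<open>The odd variable uses up one y, so degree d in gamma becomes degree d - 1 in the
  remaining even variables.\<close>

lemma dTX_gamma_part:
  "dTX (gamma_part \<gamma> g d) = (\<lambda>m. if size (fst (snd m)) + 1 = d then Rep_bv (A g) m else 0)"
proof
  fix m :: "'a idx"
  obtain S M T where m: "m = (S, M, T)" by (cases m)
  have "Rep_bv (A g) m = (\<Sum>B\<in>T. wsgn {B} (T - {B}) * of_nat (count M B + 1) * fps_nth (\<gamma> (S, add_mset B M, T - {B})) g)"
    unfolding A m dTX_def prod.case fps_sum_nth mult.assoc fps_nth_wsgn_mult fps_mult_of_nat_nth ..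
  then show "dTX (gamma_part \<gamma> g d) m = (if size (fst (snd m)) + 1 = d then Rep_bv (A g) m else 0)"
    by (simp add: m dTX_def gamma_part_def)
qed

lemma Rep_partA: "Rep_bv (partA g d) = dTX (gamma_part \<gamma> g d)"
  unfolding partA_def by (rule Abs_bv_inverse)
    (use even_Rep_bv[of "A g"] in \<open>auto simp: even_elt_def dTX_gamma_part\<close>)

text \<open>Translates a fixed valency into a fixed number of tails: of \<open>t + size L\<close>
  variables the derivatives remove \<open>size L\<close>.\<close>

lemma bder_partA: "bder L (partA g (t + size L)) = tailpart t (bder L (A g))"
proof (rule bv_eqI)
  fix m
  have "ydrs L (Rep_bv (A g)) m = 0" if "card (snd (snd m)) \<noteq> 1" by (rule ydrs_supp_T[OF A_T that])
  moreover have "Rep_bv (bder L (partA g (t + size L))) m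
      = (if size (fst (snd m)) + size L + 1 = t + size L then ydrs L (Rep_bv (A g)) m else 0)"
    unfolding Rep_bder Rep_partA dTX_gamma_part ydrs_restrict_size ..
  ultimately show "Rep_bv (bder L (partA g (t + size L))) m = Rep_bv (tailpart t (bder L (A g))) m"
    by (cases "card (snd (snd m)) = 1") (auto simp: Rep_bder Rep_tailpart tdeg_def)
qed

text \<open>\<open>X\<close> lists the tails by vertex. At each vertex \<open>size L\<close> counts
  the ends of edges, so the index of \<open>partA\<close> is the valency.\<close>

definition gwgt :: "nat list \<Rightarrow> (nat \<times> nat) list \<Rightarrow> nat multiset \<Rightarrow> ('a, complex) bv" where
  "gwgt gs es X = wgt cst w {..<length gs} es (\<lambda>v L. bder L (partA (gs ! v) (count X v + size L)))"

text \<open>At \<open>m\<close> a product of full labels sees exactly the distributions of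
  \<open>tdeg m\<close> tails among the vertices; this introduces tails into the expansion.\<close>

lemma wgt_eq_sum_gwgt:
  "Rep_bv (wgt cst w {..<length gs} es (\<lambda>v L. bder L (A (gs ! v)))) m
    = (\<Sum>X\<in>multisets_of_size {..<length gs} (tdeg m). Rep_bv (gwgt gs es X) m)"
proof -
  let ?K = "{..<length gs}"
  have "Rep_bv (wgt cst w ?K es (\<lambda>v L. bder L (A (gs ! v)))) m
    = (\<Sum>q\<in>{q. map fst q = es}. \<Sum>X\<in>multisets_of_size ?K (tdeg m).
        PInt w ?K q * Rep_bv (\<Prod>v\<in>?K. tailpart (count X v) (bder (lab q v) (A (gs ! v)))) m)"
    by (simp add: wgt_def Rep_bv_sum Rep_cst_mult Rep_prod_tailparts sum_distrib_left)
  also have "\<dots> = (\<Sum>X\<in>multisets_of_size ?K (tdeg m). \<Sum>q\<in>{q. map fst q = es}.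
        PInt w ?K q * Rep_bv (\<Prod>v\<in>?K. tailpart (count X v) (bder (lab q v) (A (gs ! v)))) m)"
    by (rule sum.swap)
  finally show ?thesis by (simp add: gwgt_def wgt_def Rep_bv_sum Rep_cst_mult bder_partA)
qed

lemma gwgt_many_edges:
  assumes "set es \<subseteq> {..<length gs} \<times> {..<length gs}" "length es > length gs"
  shows "gwgt gs es X = 0"
  unfolding gwgt_def bder_partA
  by (rule wgt_eq_0) (use assms A_bars in \<open>auto simp: cst_simps intro!: bv_eqI simp: Rep_tailpart Rep_bv_ops\<close>)

text \<open>Every vertex contributes form degree 1 and every tail contributes 1 to
  \<open>tdeg\<close>. A nonzero coefficient thus fixes the numbers of vertices and tails, which
  makes the graph sum finite coefficientwise.\<close>

lemma gwgt_supp: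
  assumes "Rep_bv (gwgt gs es X) m \<noteq> 0"
  shows "deg m = length gs" "X \<in> multisets_of_size {..<length gs} t \<Longrightarrow> tdeg m = t"
proof -
  let ?K = "{..<length gs}"
  have ne: "\<exists>q. Rep_bv (\<Prod>v\<in>?K. tailpart (count X v) (bder (lab q v) (A (gs ! v)))) m \<noteq> 0"
  proof (rule ccontr)
    assume "\<not> ?thesis"
    then have "Rep_bv (gwgt gs es X) m = 0"
      by (simp add: gwgt_def bder_partA wgt_def Rep_bv_sum Rep_cst_mult)
    then show False using assms by simp
  qed
  then obtain q where q: "Rep_bv (\<Prod>v\<in>?K. tailpart (count X v) (bder (lab q v) (A (gs ! v)))) m \<noteq> 0" by blast
  have "Rep_bv (tailpart (count X v) (bder (lab q v) (A (gs ! v)))) m = 0" if "deg m \<noteq> 1" for v and m :: "'a idx"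
    using ydrs_deg[of 1, OF A_deg that] by (simp add: Rep_tailpart Rep_bder)
  with Rep_prod_deg[of ?K "\<lambda>v. tailpart (count X v) (bder (lab q v) (A (gs ! v)))" m] q
  show "deg m = length gs" by fastforce
  assume X: "X \<in> multisets_of_size ?K t"
  have "Rep_bv (prod x K) m = 0" if "tdeg m \<noteq> (\<Sum>v\<in>K. n v)" "finite K" "\<And>v m. tdeg m \<noteq> n v \<Longrightarrow> Rep_bv (x v) m = 0"
    for x :: "nat \<Rightarrow> ('a, complex) bv" and n :: "nat \<Rightarrow> nat" and K and m :: "'a idx"
    using that(2,1,3)
  proof (induction K arbitrary: m rule: finite_induct)
    case empty
    then show ?case by (auto simp: Rep_bv_ops mon_def tdeg_def)
  next
    case (insert v K)
    have "idx_sgn a b * Rep_bv (x v) a * Rep_bv (prod x K) b = 0" if "(a, b) \<in> splits m" for a b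
    proof (cases "tdeg a = n v")
      case True
      then have "tdeg b \<noteq> (\<Sum>v\<in>K. n v)" using tdeg_splits[OF that] insert by simp
      then show ?thesis using insert by simp
    qed (use insert in simp)
    then show ?case using insert by (simp add: Rep_bv_ops elt_mult_splits case_prod_unfold sum.neutral)
  qed
  note pz = this
  have "tdeg m = (\<Sum>v\<in>?K. count X v)"
  proof (rule ccontr)
    assume ne: "tdeg m \<noteq> (\<Sum>v\<in>?K. count X v)"
    have "Rep_bv (\<Prod>v\<in>?K. tailpart (count X v) (bder (lab q v) (A (gs ! v)))) m = 0"
      by (rule pz[OF ne]) (auto simp: Rep_tailpart)
    then show False using q by simp
  qed
  also have "\<dots> = (\<Sum>v\<in>set_mset X. count X v)"
    by (rule sum.mono_neutral_right) (use X in \<open>auto simp: multisets_of_size_def not_in_iff\<close>)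
  also have "\<dots> = size X" by (simp add: size_multiset_overloaded_eq)
  finally show "tdeg m = t" using X by (simp add: multisets_of_size_def)
qed

text \<open>The right side does not mention \<open>num\<close>: weights of edge lists are invariant
  under renaming the vertices, and at distinct points edge operators do not see the
  orientation.\<close>

theorem feynman_weight_pres:
  assumes G: "is_graph G" and p: "pres G vs L ts gs es us" and num: "numbering G num"
  shows "feynman_weight w \<gamma> G num m = (\<Prod>v<length gs. fact (count (mset us) v)) * Rep_bv (gwgt gs es (mset us)) m"
proof -
  let ?k = "length gs"
  define \<pi> where "\<pi> i = num (vs ! i)" for i
  have k: "card (gverts G) = ?k" "length vs = ?k" using pres_lengths[OF p] by simp_all
  have hs: "set (L @ map (gflip G) L @ ts) = ghalfs G" and d: "distinct (L @ map (gflip G) L @ ts)"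
    and vs: "distinct vs" "set vs = gverts G" and es: "set es \<subseteq> {..<?k} \<times> {..<?k}"
    and att: "map (gattach G) L = map (\<lambda>e. vs ! fst e) es" "map (\<lambda>h. gattach G (gflip G h)) L = map (\<lambda>e. vs ! snd e) es"
    and gs: "map (ggenus G) vs = gs" and ts: "\<And>h. h \<in> set ts \<Longrightarrow> gflip G h = h"
    using p k by (auto simp: pres_def)
  have ff: "gflip G (gflip G h) = h" "gflip G h \<in> ghalfs G" "gattach G h \<in> gverts G" if "h \<in> ghalfs G" for h
    using that G by (auto simp: is_graph_def)
  have Lh: "set L \<subseteq> ghalfs G" using hs by auto
  have bn: "bij_betw num (gverts G) {..<?k}" using num k by (simp add: numbering_def)
  have bvs: "bij_betw ((!) vs) {..<?k} (gverts G)" using bij_betw_nth[OF vs(1)] vs(2) k by (simp add: lessThan_atLeast0)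
  have b\<pi>: "bij_betw \<pi> {..<?k} {..<?k}" using bij_betw_trans[OF bvs bn] by (simp add: \<pi>_def[abs_def] comp_def)
  let ?pe = "\<lambda>h. (num (gattach G h), num (gattach G (gflip G h)))"
  have ES: "map ?pe L = map (map_prod \<pi> \<pi>) es"
  proof (intro nth_equalityI)
    show "length (map ?pe L) = length (map (map_prod \<pi> \<pi>) es)" using pres_lengths[OF p] by simp
    fix i assume "i < length (map ?pe L)"
    then have i: "i < length L" "i < length es" using pres_lengths[OF p] by auto
    have "gattach G (L ! i) = vs ! fst (es ! i)" using arg_cong[OF att(1), of "\<lambda>l. l ! i"] i by simp
    moreover have "gattach G (gflip G (L ! i)) = vs ! snd (es ! i)" using arg_cong[OF att(2), of "\<lambda>l. l ! i"] i by simp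
    ultimately show "map ?pe L ! i = map (map_prod \<pi> \<pi>) es ! i" using i by (cases "es ! i") (simp add: \<pi>_def)
  qed
  define xs where "xs = map (\<lambda>\<alpha>. let v = inv_into (gverts G) num \<alpha> in partA (ggenus G v) (valency G v)) [0..<?k]"
  have xs: "xs ! \<pi> v = partA (gs ! v) (count (mset us) v + degr es v)" if v: "v < ?k" for v
  proof -
    have "\<pi> v < ?k" using b\<pi> v by (auto simp: bij_betw_def)
    moreover have "inv_into (gverts G) num (\<pi> v) = vs ! v"
      unfolding \<pi>_def using bn bvs v by (intro inv_into_f_f) (auto simp: bij_betw_def)
    moreover have "ggenus G (vs ! v) = gs ! v" using gs v k by (metis nth_map)
    ultimately show ?thesis using pres_valency[OF G p v] by (simp add: xs_def Let_def add.commute)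
  qed
  have lxs: "length xs = ?k" by (simp add: xs_def)
  have esp: "set (map (map_prod \<pi> \<pi>) es) \<subseteq> {..<?k} \<times> {..<?k}" using es b\<pi> by (force simp: bij_betw_def)
  have Wx: "wgt cst w {..<?k} (map (map_prod \<pi> \<pi>) es) (\<lambda>v L. bder L (xs ! v)) = gwgt gs es (mset us)"
  proof -
    have "wgt cst w (\<pi> ` {..<?k}) (map (map_prod \<pi> \<pi>) es) (\<lambda>v L. bder L (xs ! v)) = wgt cst w {..<?k} es (\<lambda>v L. bder L (xs ! \<pi> v))"
      by (rule wgt_relabel) (use b\<pi> es in \<open>auto simp: bij_betw_def\<close>)
    also have "\<dots> = gwgt gs es (mset us)" unfolding gwgt_def by (rule wgt_cong) (simp add: xs)
    finally show ?thesis using b\<pi> by (simp add: bij_betw_def)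
  qed
  have tails: "(\<Prod>v\<in>gverts G. fact (num_tails G v)) = (\<Prod>v<?k. fact (count (mset us) v) :: complex)"
    using prod.reindex_bij_betw[OF bvs, of "\<lambda>v. fact (num_tails G v) :: complex"] pres_valency(2)[OF G p] by simp
  show ?thesis
  \<comment> \<open>A loop makes the Feynman weight 0 by convention and the weight of the edge list
    0 because \<open>pc\<close> vanishes on loops.\<close>
  proof (cases "\<exists>h\<in>ghalfs G. gflip G h \<noteq> h \<and> gattach G (gflip G h) = gattach G h")
    case True
    then obtain h where h: "h \<in> ghalfs G" "gflip G h \<noteq> h" "gattach G (gflip G h) = gattach G h" by blast
    have "\<exists>h\<in>set L. gattach G (gflip G h) = gattach G h"
    proof -
      from h consider "h \<in> set L" | h' where "h' \<in> set L" "h = gflip G h'" using hs ts by auto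
      then show ?thesis
      proof cases
        case 2
        then have "gflip G h = h'" using ff Lh by auto
        then show ?thesis using 2 h by (intro bexI[of _ h']) auto
      qed (use h in blast)
    qed
    then obtain h' where h': "h' \<in> set L" "gattach G (gflip G h') = gattach G h'" by blast
    then obtain i where i: "i < length L" "L ! i = h'" by (auto simp: in_set_conv_nth)
    then have "vs ! fst (es ! i) = vs ! snd (es ! i)"
      using arg_cong[OF att(1), of "\<lambda>l. l ! i"] arg_cong[OF att(2), of "\<lambda>l. l ! i"] h' pres_lengths[OF p] by simp
    moreover have e: "es ! i \<in> set es" using i pres_lengths[OF p] by simp
    moreover have "fst (es ! i) < length vs" "snd (es ! i) < length vs"
      using subsetD[OF es e] k by (auto simp: mem_Times_iff)
    ultimately have "fst (es ! i) = snd (es ! i)" using nth_eq_iff_index_eq[OF vs(1)] by blast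
    then have "gwgt gs es (mset us) = 0" unfolding gwgt_def using e by (intro wgt_loop) (auto simp: cst_simps)
    then show ?thesis using True by (simp add: feynman_weight_def Rep_bv_ops(1))
  next
    case False
    let ?E = "\<lambda>h. {h, gflip G h}"
    have "set L \<inter> gflip G ` set L = {}" using d by auto
    then have nf: "gflip G h \<noteq> h" if "h \<in> set L" for h
      using imageI[OF that, of "gflip G"] that by (metis disjoint_iff)
    have ie: "internal_edges G = set (map ?E L)"
    proof (intro set_eqI iffI)
      fix e assume "e \<in> internal_edges G"
      then obtain h where h: "e = ?E h" "h \<in> ghalfs G" "gflip G h \<noteq> h" by (auto simp: internal_edges_def)
      then consider "h \<in> set L" | h' where "h' \<in> set L" "h = gflip G h'" using hs ts by auto
      then show "e \<in> set (map ?E L)"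
      proof cases
        case 2
        then have "e = ?E h'" using h ff Lh by auto
        then show ?thesis using 2 by simp
      qed (use h in simp)
    next
      fix e assume "e \<in> set (map ?E L)"
      then show "e \<in> internal_edges G" using nf Lh by (auto simp: internal_edges_def)
    qed
    have dE: "distinct (map ?E L)"
      unfolding distinct_map
    proof (intro conjI inj_onI)
      show "distinct L" using d by simp
      fix h h' assume "h \<in> set L" "h' \<in> set L" "?E h = ?E h'"
      then show "h = h'" using d by (auto simp: doubleton_eq_iff disjoint_iff)
    qed
    \<comment> \<open>\<open>edge_dP\<close> orders the ends by their numbers, whereas the
      presentation orients edges arbitrarily; \<open>pairop_swap\<close> reconciles the two at
      distinct points.\<close>
    have eP: "edge_dP w \<theta> G num (?E h) = pairop w \<theta> (?pe h)"
      if \<theta>: "inj_on \<theta> {..<?k}" "\<theta> ` {..<?k} \<subseteq> {0..<1}" and h: "h \<in> set L" for \<theta> h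
    proof -
      let ?a = "num (gattach G h)" and ?b = "num (gattach G (gflip G h))"
      have hG: "h \<in> ghalfs G" "gflip G h \<in> ghalfs G" using h Lh ff by auto
      have "gattach G (gflip G h) \<noteq> gattach G h" using False hG nf[OF h] by blast
      then have ab: "?a \<noteq> ?b" using bn ff(3) hG by (metis bij_betw_def inj_on_eq_iff)
      have abk: "?a < ?k" "?b < ?k" using bn ff(3)[OF hG(1)] ff(3)[OF hG(2)] by (auto simp: bij_betw_def)
      have "\<theta> ?a \<noteq> \<theta> ?b" using \<theta>(1) ab abk by (auto dest: inj_onD)
      moreover have "\<theta> ?a \<in> {0..<1}" "\<theta> ?b \<in> {0..<1}" using \<theta>(2) abk by blast+
      ultimately have sw: "pairop w \<theta> (?a, ?b) = pairop w \<theta> (?b, ?a)" by (rule pairop_swap)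
      have "edge_dP w \<theta> G num (?E h) = dP_pair w \<theta> (min ?a ?b) (max ?a ?b)"
        by (simp add: edge_dP_def)
      also have "\<dots> = pairop w \<theta> (min ?a ?b, max ?a ?b)" using ab by (subst pairop_eq_dP_pair) (auto simp: min_def max_def)
      also have "\<dots> = pairop w \<theta> (?a, ?b)" using sw by (auto simp: min_def max_def)
      finally show ?thesis .
    qed
    have fold: "Finite_Set.fold (edge_dP w \<theta> G num) t (internal_edges G) = fold (pairop w \<theta>) (map (map_prod \<pi> \<pi>) es) t"
      if \<theta>: "inj_on \<theta> {..<?k}" "\<theta> ` {..<?k} \<subseteq> {0..<1}" for \<theta> t
    proof -
      interpret comp_fun_commute_on "internal_edges G" "edge_dP w \<theta> G num"
        by standard (auto simp: ie eP[OF \<theta>] fun_eq_iff pairop_commute)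
      have "Finite_Set.fold (edge_dP w \<theta> G num) t (internal_edges G) = fold (edge_dP w \<theta> G num) (map ?E L) t"
        using fold_set_fold_remdups[of "map ?E L" t] ie dE by (simp add: distinct_remdups_id)
      also have "\<dots> = fold (pairop w \<theta>) (map ?pe L) t"
        unfolding fold_map by (rule fold_cong) (auto simp: eP[OF \<theta>] comp_def)
      finally show ?thesis by (simp only: ES)
    qed
    have R: "map (\<lambda>\<alpha>. let v = inv_into (gverts G) num \<alpha> in dTX (gamma_part \<gamma> (ggenus G v) (valency G v))) [0..<?k] = map Rep_bv xs"
      by (simp add: xs_def Let_def Rep_partA)
    have "config_integral ?k (\<lambda>\<theta>. Mult ?k (Finite_Set.fold (edge_dP w \<theta> G num) (tensor (map Rep_bv xs)) (internal_edges G)) m)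
        = config_integral ?k (\<lambda>\<theta>. Mult ?k (fold (pairop w \<theta>) (map (map_prod \<pi> \<pi>) es) (tensor (map Rep_bv xs))) m)"
      by (rule config_integral_cong[OF nice_Mult_fold_pairop[OF lxs esp]]) (simp add: fold)
    also have "\<dots> = Rep_bv (gwgt gs es (mset us)) m"
      using config_integral_fold_pairop[OF lxs esp, of w m] Wx by simp
    finally have "feynman_weight w \<gamma> G num m = (\<Prod>v\<in>gverts G. fact (num_tails G v)) * Rep_bv (gwgt gs es (mset us)) m"
      unfolding feynman_weight_def k R using False by (simp only: if_False)
    then show ?thesis by (simp only: tails)
  qed
qed

end

section \<open>The support of \<open>\<gamma>\<close>\<close>

lemma wirt_zero:
  assumes "open U" "z \<in> U" "\<And>w. w \<in> U \<Longrightarrow> h w = 0"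
  shows "wirt B h z = 0"
proof -
  have "((\<lambda>_. 0 :: complex) has_derivative (\<lambda>_. 0)) (at z)" by simp
  then have "(h has_derivative (\<lambda>_. 0)) (at z)"
    by (rule has_derivative_transform_within_open[OF _ assms(1,2)]) (simp add: assms(3))
  then have "frechet_derivative h (at z) = (\<lambda>_. 0)" by (rule frechet_derivative_at[symmetric])
  then show ?thesis by (cases B) simp_all
qed

lemma wirt_cmult:
  assumes "h differentiable (at z)"
  shows "wirt B (\<lambda>w. k * h w) z = k * wirt B h z"
proof -
  have "(h has_derivative frechet_derivative h (at z)) (at z)" using assms frechet_derivative_works by blast
  then have "((\<lambda>w. k * h w) has_derivative (\<lambda>v. k * frechet_derivative h (at z) v)) (at z)"
    by (rule has_derivative_mult_right)
  then have "frechet_derivative (\<lambda>w. k * h w) (at z) = (\<lambda>v. k * frechet_derivative h (at z) v)"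
    by (rule frechet_derivative_at[symmetric])
  then show ?thesis by (cases B) (simp_all add: algebra_simps)
qed

section \<open>The metric and its mixed Christoffel symbols\<close>

definition posdef :: "'n::finite cmat \<Rightarrow> bool" where
  "posdef h \<longleftrightarrow> (\<forall>v. v \<noteq> 0 \<longrightarrow> 0 < Re (\<Sum>i\<in>UNIV. \<Sum>j\<in>UNIV. h $ i $ j * v $ i * cnj (v $ j)))"

text \<open>Pairing the equations with the conjugate of \<open>v\<close> shows that the Hermitian
  form vanishes at \<open>v\<close>.\<close>

lemma posdef_left_kernel:
  fixes h :: "'n::finite cmat"
  assumes "posdef h" "\<And>j. (\<Sum>i\<in>UNIV. h $ i $ j * v i) = 0"
  shows "v i = 0"
proof (rule ccontr)
  assume "v i \<noteq> 0"
  let ?v = "\<chi> i. v i"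
  have "?v \<noteq> 0" using \<open>v i \<noteq> 0\<close> by (auto simp: vec_eq_iff)
  then have "0 < Re (\<Sum>i\<in>UNIV. \<Sum>j\<in>UNIV. h $ i $ j * ?v $ i * cnj (?v $ j))" using assms(1) unfolding posdef_def by blast
  also have "(\<Sum>i\<in>UNIV. \<Sum>j\<in>UNIV. h $ i $ j * ?v $ i * cnj (?v $ j)) = (\<Sum>j\<in>UNIV. \<Sum>i\<in>UNIV. h $ i $ j * v i * cnj (v j))"
    by (subst sum.swap) simp
  also have "\<dots> = (\<Sum>j\<in>UNIV. (\<Sum>i\<in>UNIV. h $ i $ j * v i) * cnj (v j))" by (simp add: sum_distrib_right)
  also have "\<dots> = 0" by (simp add: assms(2))
  finally show False by simp
qed

lemma posdef_right_kernel:
  fixes h :: "'n::finite cmat"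
  assumes "posdef h" "\<And>i. (\<Sum>j\<in>UNIV. h $ i $ j * u j) = 0"
  shows "u j = 0"
proof (rule ccontr)
  assume "u j \<noteq> 0"
  let ?v = "\<chi> i. cnj (u i)"
  have "?v \<noteq> 0" using \<open>u j \<noteq> 0\<close> by (auto simp: vec_eq_iff)
  then have "0 < Re (\<Sum>i\<in>UNIV. \<Sum>j\<in>UNIV. h $ i $ j * ?v $ i * cnj (?v $ j))" using assms(1) unfolding posdef_def by blast
  also have "(\<Sum>i\<in>UNIV. \<Sum>j\<in>UNIV. h $ i $ j * ?v $ i * cnj (?v $ j)) = (\<Sum>i\<in>UNIV. (\<Sum>j\<in>UNIV. h $ i $ j * u j) * cnj (u i))"
    by (simp add: sum_distrib_left mult_ac)
  also have "\<dots> = 0" by (simp add: assms(2))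
  finally show False by simp
qed

lemma cmetric_simps [simp]:
  fixes h :: "'n::finite cmat"
  shows
  "cmetric h $ Inl i $ Inr j = h $ i $ j" "cmetric h $ Inr j $ Inl i = h $ i $ j"
  "cmetric h $ Inl i $ Inl k = 0" "cmetric h $ Inr j $ Inr k = 0"
  by (simp_all add: cmetric_def)

text \<open>The matrix is block antidiagonal with blocks h and its transpose, so a kernel vector
  splits into a right and a left kernel vector of h.\<close>

lemma invertible_cmetric:
  fixes h :: "'n::finite cmat"
  assumes "posdef h" shows "invertible (cmetric h)"
proof -
  have "x = 0" if x: "cmetric h *v x = 0" for x :: "complex^('n gen)"
  proof -
    have e: "(\<Sum>B\<in>UNIV. cmetric h $ C $ B * x $ B) = 0" for C
      using x by (simp add: vec_eq_iff matrix_vector_mult_def)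
    have "(\<Sum>j\<in>UNIV. h $ i $ j * x $ Inr j) = 0" for i
      using e[of "Inl i"] by (simp add: sum_UNIV_gen)
    then have r: "x $ Inr j = 0" for j by (rule posdef_right_kernel[OF assms])
    have "(\<Sum>i\<in>UNIV. h $ i $ j * x $ Inl i) = 0" for j
      using e[of "Inr j"] by (simp add: sum_UNIV_gen)
    then have l: "x $ Inl i = 0" for i by (rule posdef_left_kernel[OF assms])
    have "x $ C = 0" for C using r l by (cases C) auto
    then show ?thesis by (simp add: vec_eq_iff)
  qed
  then show ?thesis unfolding invertible_left_inverse matrix_left_invertible_ker by blast
qed

text \<open>In the product of the inverse with the metric, the entries of row \<open>Inl a\<close>
  in the barred columns are 0. They say that this part of the row lies in the left kernel of
  h.\<close>

lemma inv_cmetric_Inl_Inl: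
  fixes h :: "'n::finite cmat"
  assumes "posdef h" shows "matrix_inv (cmetric h) $ Inl a $ Inl d = 0"
proof -
  let ?M = "matrix_inv (cmetric h)"
  have M: "?M ** cmetric h = mat 1"
    using someI_ex[OF invertible_cmetric[OF assms, unfolded invertible_def]] by (simp add: matrix_inv_def)
  have "(\<Sum>d\<in>UNIV. h $ d $ j * ?M $ Inl a $ Inl d) = 0" for j
  proof -
    have "(?M ** cmetric h) $ Inl a $ Inr j = 0" unfolding M by (simp add: mat_def)
    then show ?thesis by (simp add: matrix_matrix_mult_def sum_UNIV_gen mult.commute)
  qed
  then show ?thesis by (rule posdef_left_kernel[OF assms])
qed

text \<open>This is the coefficient of dz^i, d zbar^b, d zbar^d in d omega = 0. The operator
  \<open>del\<close> adds nothing there, since the form has no component with two barred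
  differentials.\<close>

lemma kform_derivative_symmetric:
  fixes h :: "'n::{finite,linorder} cvec \<Rightarrow> 'n cmat"
  assumes S: "open S" "z \<in> S" and sm: "\<And>i j. smooth_on S (\<lambda>z. h z $ i $ j)" and cl: "closed11 S (kform h)"
  shows "wirt (Inr b) (\<lambda>w. h w $ i $ d) z = wirt (Inr d) (\<lambda>w. h w $ i $ b) z"
proof (cases "b = d")
  case False
  let ?m = "({Inl i, Inr b, Inr d} :: 'n gen set, {#} :: 'n gen multiset, {} :: 'n gen set)"
  let ?w = "kform h"
  have diff: "(\<lambda>w. h w $ i $ j) differentiable (at z)" for i j
  proof -
    have "Ck_on (Suc 0) S (\<lambda>z. h z $ i $ j)" using sm unfolding smooth_on_def by blast
    then show ?thesis using S by simp
  qed
  have f1: "form11 ?w w ({Inl i, Inr j}, {#}, {}) = \<i> * h w $ i $ j" for w i j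
  proof -
    have e: "({Inl i, Inr j} = {Inl a, Inr b}) = (a = i \<and> b = j)" for a b by (auto simp: doubleton_eq_iff)
    have "form11 ?w w ({Inl i, Inr j}, {#}, {}) = (\<Sum>a\<in>UNIV. \<Sum>b\<in>UNIV. if a = i then if b = j then \<i> * h w $ i $ j else 0 else 0)"
      unfolding form11_def by (intro sum.cong refl) (auto simp: mon_def e kform_def)
    also have "\<dots> = (\<Sum>a\<in>UNIV. if a = i then (\<Sum>b\<in>UNIV. if b = j then \<i> * h w $ i $ j else 0) else 0)"
      by (intro sum.cong refl) auto
    finally show ?thesis by simp
  qed
  have f2: "form11 ?w w ({Inr b, Inr d}, {#}, {}) = 0" for w
  proof -
    have e: "{Inr b, Inr d} \<noteq> ({Inl a, Inr b'} :: 'n gen set)" for a b' by (auto simp: doubleton_eq_iff)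
    show ?thesis unfolding form11_def by (intro sum.neutral ballI) (simp add: mon_def e)
  qed
  have "del (form11 ?w) z ?m = 0"
    unfolding del_def
  proof (intro sum.neutral ballI)
    fix k
    have s: "sder (Inl k) (form11 ?w) z ({Inr b, Inr d}, {#}, {}) = 0"
      unfolding sder_def by (rule wirt_zero[OF S]) (rule f2)
    have "{Inl i, Inr b, Inr d} - {Inl i} = {Inr b, Inr d :: 'n gen}" by auto
    then show "wedge (Inl k) (sder (Inl k) (form11 ?w) z) ?m = 0"
      using s by (auto simp: wedge_def)
  qed
  moreover have "delbar (form11 ?w) z ?m
      = wsgn {Inr b} {Inl i, Inr d} * (\<i> * wirt (Inr b) (\<lambda>w. h w $ i $ d) z) + wsgn {Inr d} {Inl i, Inr b} * (\<i> * wirt (Inr d) (\<lambda>w. h w $ i $ b) z)"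
  proof -
    have d1: "{Inl i, Inr b, Inr d} - {Inr b} = {Inl i, Inr d :: 'n gen}" "{Inl i, Inr b, Inr d} - {Inr d} = {Inl i, Inr b :: 'n gen}"
      using False by auto
    have s: "sder (Inr j) (form11 ?w) z ({Inl i, Inr k}, {#}, {}) = \<i> * wirt (Inr j) (\<lambda>w. h w $ i $ k) z" for j k
      unfolding sder_def f1 by (rule wirt_cmult[OF diff])
    have "delbar (form11 ?w) z ?m = (\<Sum>j\<in>{b, d}. wedge (Inr j) (sder (Inr j) (form11 ?w) z) ?m)"
      unfolding delbar_def by (intro sum.mono_neutral_right) (auto simp: wedge_def)
    also have "\<dots> = wedge (Inr b) (sder (Inr b) (form11 ?w) z) ?m + wedge (Inr d) (sder (Inr d) (form11 ?w) z) ?m"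
      using False by simp
    finally show ?thesis by (simp add: wedge_def d1 s)
  qed
  moreover have "del (form11 ?w) z ?m + delbar (form11 ?w) z ?m = 0" using cl S by (auto simp: closed11_def)
  \<comment> \<open>Both barred differentials pass dz^i with the same sign but anticommute with each
    other, so closedness yields a difference of derivatives.\<close>
  moreover have "wsgn {Inr d} {Inl i, Inr b} = - (wsgn {Inr b} {Inl i, Inr d} :: complex)"
  proof -
    have l: "wsgn {Inr k} {Inl i :: 'n gen} = (- 1 :: complex)" for k
    proof -
      have "{(a, b). a \<in> {Inr k} \<and> b \<in> {Inl i :: 'n gen} \<and> before b a} = {(Inr k, Inl i)}" by auto
      then show ?thesis by (simp add: wsgn_def)
    qed
    have "wsgn {Inr d} {Inl i, Inr b} = (wsgn {Inr d} {Inl i} * wsgn {Inr d} {Inr b} :: complex)"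
      using wsgn_Un_right[of "{Inl i}" "{Inr b}" "{Inr d}"] by (simp add: insert_commute)
    moreover have "wsgn {Inr b} {Inl i, Inr d} = (wsgn {Inr b} {Inl i} * wsgn {Inr b} {Inr d} :: complex)"
      using wsgn_Un_right[of "{Inl i}" "{Inr d}" "{Inr b}"] by (simp add: insert_commute)
    moreover have "wsgn {Inr d} {Inr b} = - (wsgn {Inr b} {Inr d} :: complex)"
      using wsgn_commute[of "{Inr d}" "{Inr b}"] by simp
    ultimately show ?thesis by (simp add: l)
  qed
  moreover have "wsgn {Inr b} {Inl i, Inr d} \<noteq> (0 :: complex)" using False by (simp add: wsgn_def)
  ultimately have "wsgn {Inr b} {Inl i, Inr d} * (\<i> * (wirt (Inr b) (\<lambda>w. h w $ i $ d) z - wirt (Inr d) (\<lambda>w. h w $ i $ b) z)) = 0"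
    by (simp add: algebra_simps del: wirt.simps)
  then show ?thesis using \<open>wsgn {Inr b} {Inl i, Inr d} \<noteq> 0\<close> by (simp del: wirt.simps)
qed simp

text \<open>The inverse metric pairs \<open>Inl a\<close> only with barred D. For these the bracket
  reduces to the antisymmetrised derivative of the metric in the two barred directions, which
  vanishes for a Kaehler form.\<close>

lemma christoffel_mixed:
  assumes K: "kaehler_manifold X A g" and c: "c \<in> A" "z \<in> chart_image c"
  shows "christoffel (g c) (Inl a) (Inl i) (Inr b) z = 0"
proof -
  have S: "open (chart_image c)" using K c by (auto simp: kaehler_manifold_def complex_manifold_def)
  have sm: "smooth_on (chart_image c) (\<lambda>z. g c z $ i $ j)" for i j using K c by (auto simp: kaehler_manifold_def tensor11_def)
  have cl: "closed11 (chart_image c) (kform (g c))" using K c by (auto simp: kaehler_manifold_def)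
  have pd: "posdef (g c z)" using K c unfolding kaehler_manifold_def posdef_def by blast
  have z0: "wirt B (\<lambda>w. 0) z = 0" for B by (rule wirt_zero[OF open_UNIV]) auto
  show ?thesis
    unfolding christoffel_def sum_UNIV_gen
    using kform_derivative_symmetric[OF S c(2) sm cl] by (simp add: inv_cmetric_Inl_Inl[OF pd] z0 del: wirt.simps)
qed

text \<open>The indices of \<open>I\<close> without its factor \<open>\<omega>\<^bsub>jk\<^esub> \<bar>y\<^sup>k\<close>, and of \<open>J\<^sub>\<alpha>\<close>.\<close>

definition hol_idx :: "'n idx \<Rightarrow> bool" where
  "hol_idx m \<longleftrightarrow> (\<exists>j. fst m = {Inr j}) \<and> (\<forall>B\<in>#fst (snd m). isl B) \<and> snd (snd m) = {}"

text \<open>Stated on a set that will be open, since derivatives preserve vanishing only on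
  neighbourhoods.\<close>

definition hol_sec :: "'n cvec set \<Rightarrow> 'n sec \<Rightarrow> bool" where
  "hol_sec U a \<longleftrightarrow> (\<forall>w\<in>U. \<forall>m. \<not> hol_idx m \<longrightarrow> a w m = 0)"

section \<open>Support under the operators that construct gamma\<close>

lemma sder_hol_sec:
  assumes "open U" "hol_sec U a" shows "hol_sec U (sder B a)"
  unfolding hol_sec_def sder_def
  using wirt_zero[OF assms(1)] assms(2) by (auto simp: hol_sec_def)

text \<open>The connection term replaces some y^C by y^B. Starting from an unbarred C, it could
  leave the allowed indices only through a barred B, and then its coefficient is a mixed Christoffel
  symbol.\<close>

lemma cov_hol_sec:
  fixes a :: "'n::{finite,linorder} sec"
  assumes U: "open U" "\<And>z b d. z \<in> U \<Longrightarrow> christoffel h (Inl d) (Inl i) (Inr b) z = 0" and a: "hol_sec U a"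
  shows "hol_sec U (cov h (Inl i) a)"
  unfolding hol_sec_def
proof (intro ballI allI impI)
  fix z and m :: "'n idx" assume z: "z \<in> U" and m: "\<not> hol_idx m"
  have c0: "christoffel h C (Inl i) B z * ymult B (yder C (a z)) m = 0" for B C
  proof (cases "ymult B (yder C (a z)) m = 0")
    case False
    obtain S M T where mm: "m = (S, M, T)" by (cases m)
    have B: "B \<in># M" "a z (S, add_mset C (M - {#B#}), T) \<noteq> 0"
      using False by (auto simp: mm ymult_def yder_def split: if_splits)
    then have ok: "hol_idx (S, add_mset C (M - {#B#}), T)" using a z by (auto simp: hol_sec_def)
    have "\<not> isl B"
    proof
      assume "isl B"
      then have "\<forall>D\<in>#add_mset B (M - {#B#}). isl D" using ok by (auto simp: hol_idx_def)
      then have "hol_idx m" using ok B(1) by (simp add: hol_idx_def mm)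
      then show False using m by simp
    qed
    moreover have "isl C" using ok by (auto simp: hol_idx_def)
    ultimately show ?thesis using U(2)[OF z] by (cases B; cases C) auto
  qed simp
  have s0: "sder (Inl i) a z m = 0" using sder_hol_sec[OF U(1) a] z m unfolding hol_sec_def by blast
  show "cov h (Inl i) a z m = 0" unfolding cov_def c0 s0 by simp
qed

text \<open>The factor dz^i just introduced is traded for y^i. Terms with i different from k would
  need a second holomorphic differential in the argument, which is excluded.\<close>

lemma delta_inv_wedge_hol:
  fixes b :: "'n::{finite,linorder} \<Rightarrow> ('n, complex) elt"
  assumes b: "\<And>i m. \<not> hol_idx m \<Longrightarrow> b i m = 0" and m: "\<not> hol_idx m"
  shows "delta_inv (\<lambda>m. \<Sum>i\<in>UNIV. wedge (Inl i) (b i) m) m = 0"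
  unfolding delta_inv_def
proof (intro sum.neutral ballI)
  fix k
  obtain S M T where mm: "m = (S, M, T)" by (cases m)
  let ?a = "\<lambda>m. \<Sum>i\<in>UNIV. wedge (Inl i) (b i) m"
  show "ymult (Inl k) (contract (Inl k) (\<lambda>m'. ?a m' / of_nat (hol_degree m'))) m = 0"
  proof (cases "Inl k \<in># M \<and> Inl k \<notin> S")
    case True
    have "wedge (Inl i) (b i) (insert (Inl k) S, M - {#Inl k#}, T) = 0" for i
    proof (cases "i = k")
      case i: True
      have "\<not> hol_idx (S, M - {#Inl k#}, T)"
      proof
        assume h: "hol_idx (S, M - {#Inl k#}, T)"
        then have "\<forall>D\<in>#add_mset (Inl k) (M - {#Inl k#}). isl D" by (auto simp: hol_idx_def)
        then have "hol_idx m" using True h by (simp add: hol_idx_def mm)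
        then show False using m by simp
      qed
      then show ?thesis using True b i by (simp add: wedge_def)
    next
      case False
      have "\<not> hol_idx (insert (Inl k) S - {Inl i}, M - {#Inl k#}, T)"
      proof
        assume "hol_idx (insert (Inl k) S - {Inl i}, M - {#Inl k#}, T)"
        then obtain j where "insert (Inl k) S - {Inl i} = {Inr j}" by (auto simp: hol_idx_def)
        moreover have "Inl k \<in> insert (Inl k) S - {Inl i}" using False by auto
        ultimately show False by auto
      qed
      then show ?thesis using b by (simp add: wedge_def)
    qed
    then show ?thesis by (simp add: mm ymult_def contract_def)
  qed (auto simp: mm ymult_def contract_def)
qed

lemma hol_sec_delta_inv_nabla10:
  fixes a :: "'n::{finite,linorder} sec"
  assumes U: "open U" "\<And>z i b d. z \<in> U \<Longrightarrow> christoffel h (Inl d) (Inl i) (Inr b) z = 0" and a: "hol_sec U a"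
  shows "hol_sec U (\<lambda>w. delta_inv (nabla10 h a w))"
  unfolding hol_sec_def nabla10_def
proof (intro ballI allI impI delta_inv_wedge_hol)
  show "cov h (Inl i) a z m = 0" if "z \<in> U" "\<not> hol_idx m" for z i m
    using cov_hol_sec[OF U(1) U(2) a] that unfolding hol_sec_def by blast
qed

lemma hol_sec_Rstar:
  fixes h :: "'n::{finite,linorder} cvec \<Rightarrow> 'n cmat"
  assumes U: "open U" "\<And>z i b d. z \<in> U \<Longrightarrow> christoffel h (Inl d) (Inl i) (Inr b) z = 0"
  shows "hol_sec U (Rstar h r C)"
proof (induction r arbitrary: C)
  case 0
  show ?case unfolding hol_sec_def
  proof (intro ballI allI impI)
    fix w m assume m: "\<not> hol_idx (m :: 'n idx)"
    have "mon {Inr j} {#Inl i, Inl k#} {} m = (0 :: complex)" for i j k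
      using m by (auto simp: mon_def hol_idx_def)
    then show "Rstar h 0 C w m = 0" by (cases C) simp_all
  qed
next
  case (Suc r)
  show ?case
    unfolding hol_sec_def Rstar.simps nabla10_T_def
  proof (intro ballI allI impI delta_inv_wedge_hol)
    show "cov h (Inl i) (Rstar h r C) z m + (\<Sum>B\<in>UNIV. christoffel h C (Inl i) B z * Rstar h r B z m) = 0"
      if "z \<in> U" "\<not> hol_idx m" for z i m
    proof -
      have "cov h (Inl i) (Rstar h r C) z m = 0"
        using cov_hol_sec[OF U(1) U(2) Suc] that unfolding hol_sec_def by blast
      moreover have "Rstar h r B z m = 0" for B using Suc that unfolding hol_sec_def by blast
      ultimately show ?thesis by simp
    qed
  qed
qed

lemma hol_sec_delbar_fun:
  fixes f :: "'n::{finite,linorder} cvec \<Rightarrow> complex"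
  assumes "open U" shows "hol_sec U (delbar (fun_sec f))"
  unfolding hol_sec_def delbar_def
proof (intro ballI allI impI sum.neutral)
  fix w j and m :: "'n idx" assume w: "w \<in> U" and m: "\<not> hol_idx m"
  obtain S M T where mm: "m = (S, M, T)" by (cases m)
  show "wedge (Inr j) (sder (Inr j) (fun_sec f) w) m = 0"
  proof (cases "Inr j \<in> S")
    case True
    have "(S - {Inr j}, M, T) \<noteq> ({}, {#}, {})"
    proof
      assume "(S - {Inr j}, M, T) = ({}, {#}, {})"
      then have "S = {Inr j}" "M = {#}" "T = {}" using True by auto
      then show False using m by (simp add: hol_idx_def mm)
    qed
    then have "sder (Inr j) (fun_sec f) w (S - {Inr j}, M, T) = 0"
      unfolding sder_def fun_sec_def by (intro wirt_zero[OF open_UNIV]) (auto simp: mon_def)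
    then show ?thesis by (simp add: wedge_def mm)
  qed (simp add: wedge_def mm)
qed

lemma Sum_any_0: "(\<And>x. f x = 0) \<Longrightarrow> Sum_any f = 0"
  by (simp add: Sum_any.expand_set)

definition bars :: "'n gen multiset \<Rightarrow> nat" where
  "bars M = size (filter_mset (\<lambda>B. \<not> isl B) M)"

lemma bars_hol: "hol_idx m \<Longrightarrow> bars (fst (snd m)) = 0"
proof -
  assume "hol_idx m"
  then have "filter_mset (\<lambda>B. \<not> isl B) (fst (snd m)) = filter_mset (\<lambda>_. False) (fst (snd m))"
    by (intro filter_mset_cong) (auto simp: hol_idx_def)
  then show ?thesis by (simp add: bars_def)
qed

text \<open>J has no barred y, I gains exactly one from the lowered index, and the correction terms
  are dz with a barred y or d zbar with an unbarred y.\<close>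

lemma gamma_coeff_supp:
  fixes h :: "'n::{finite,linorder} cvec \<Rightarrow> 'n cmat"
  assumes U: "open U" "\<And>z i b d. z \<in> U \<Longrightarrow> christoffel h (Inl d) (Inl i) (Inr b) z = 0" and z: "z \<in> U"
    and m: "\<not> (card S = 1 \<and> T = {} \<and> bars M \<le> 1)"
  shows "gamma_coeff h f i z (S, M, T) = 0"
proof -
  have nh: "\<not> hol_idx (S, M, T)" using m bars_hol[of "(S, M, T)"] by (auto simp: hol_idx_def)
  have pw: "hol_sec U (((\<lambda>a w. delta_inv (nabla10 h a w)) ^^ k) (delbar (fun_sec (f i))))" for k
  proof (induction k)
    case (Suc k)
    then show ?case using hol_sec_delta_inv_nabla10[OF U Suc] by simp
  qed (simp add: hol_sec_delbar_fun[OF U(1)])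
  have J: "J_sec h (f i) z (S, M, T) = 0"
    unfolding J_sec_def using pw z nh by (intro Sum_any_0) (auto simp: hol_sec_def simp del: funpow.simps)
  have "ymult (Inr k) (Rstar h r (Inl j) z) (S, M, T) = 0" for k r j
  proof (cases "Inr k \<in># M")
    case True
    have "\<not> hol_idx (S, M - {#Inr k#}, T)"
    proof
      assume hh: "hol_idx (S, M - {#Inr k#}, T)"
      have "bars M = bars (add_mset (Inr k) (M - {#Inr k#}))" using True by simp
      also have "\<dots> = 1" using bars_hol[OF hh] by (simp add: bars_def)
      finally show False using hh m by (auto simp: hol_idx_def)
    qed
    then show ?thesis using hol_sec_Rstar[OF U, of r "Inl j"] z by (simp add: ymult_def hol_sec_def)
  qed (simp add: ymult_def)
  then have I: "I_sec h z (S, M, T) = 0" unfolding I_sec_def by (intro Sum_any_0) simp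
  have "mon {Inl a} {#Inr b#} {} (S, M, T) = (0 :: complex)" "mon {Inr b} {#Inl a#} {} (S, M, T) = (0 :: complex)" for a b
    using m by (auto simp: mon_def bars_def)
  then show ?thesis using I J by (simp add: gamma_coeff_def)
qed

lemma ydrs_nonzero: "ydrs L a (S, M, T) \<noteq> 0 \<Longrightarrow> a (S, M + L, T) \<noteq> 0"
proof (induction L arbitrary: M)
  case (add B L)
  then have "ydrs L a (S, add_mset B M, T) \<noteq> 0" by (auto simp: ydrs_add_mset yder_def)
  then show ?case using add.IH by fastforce
qed simp

text \<open>\<open>dTX\<close> exchanges one y for one dy, so the form degree stays 1, exactly one
  odd variable appears, and the number of barred y cannot grow.\<close>

theorem bv_one_form_gamma:
  fixes h :: "'n::{finite,linorder} cvec \<Rightarrow> 'n cmat"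
  assumes U: "open U" "\<And>z i b d. z \<in> U \<Longrightarrow> christoffel h (Inl d) (Inl i) (Inr b) z = 0" and z: "z \<in> U"
  shows "bv_one_form (gamma h f z) (\<lambda>k. Abs_bv (\<lambda>m. fps_nth (dTX (gamma h f z) m) k))"
proof -
  let ?a = "\<lambda>k m. fps_nth (dTX (gamma h f z) m) k"
  have supp: "card S = 1 \<and> card T = 1 \<and> bars M \<le> 1" if "?a k (S, M, T) \<noteq> 0" for k S M T
  proof -
    have "?a k (S, M, T) = (\<Sum>B\<in>T. wsgn {B} (T - {B}) * of_nat (count M B + 1) * gamma_coeff h f k z (S, add_mset B M, T - {B}))"
      unfolding dTX_def prod.case fps_sum_nth mult.assoc fps_nth_wsgn_mult fps_mult_of_nat_nth by (simp add: gamma_def)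
    then have "(\<Sum>B\<in>T. wsgn {B} (T - {B}) * of_nat (count M B + 1) * gamma_coeff h f k z (S, add_mset B M, T - {B})) \<noteq> 0"
      using that by simp
    then obtain B where B: "B \<in> T" "gamma_coeff h f k z (S, add_mset B M, T - {B}) \<noteq> 0"
      by (rule sum.not_neutral_contains_not_neutral) auto
    have *: "card S = 1 \<and> T - {B} = {} \<and> bars (add_mset B M) \<le> 1"
    proof (rule ccontr)
      assume n: "\<not> ?thesis"
      have "gamma_coeff h f k z (S, add_mset B M, T - {B}) = 0" by (rule gamma_coeff_supp[OF U z n])
      then show False using B(2) by simp
    qed
    then have "T = {B}" using B(1) by auto
    moreover have "bars M \<le> bars (add_mset B M)" by (simp add: bars_def)
    ultimately show ?thesis using * by simp
  qed
  have ev: "even_elt (?a k)" for k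
    unfolding even_elt_def
  proof (intro allI impI)
    fix m :: "'n idx" assume m: "odd (card (fst m) + card (snd (snd m)))"
    obtain S M T where mm: "m = (S, M, T)" by (cases m)
    show "?a k m = 0"
    proof (rule ccontr)
      assume "?a k m \<noteq> 0"
      then have "card S = 1 \<and> card T = 1" using supp[where k = k and S = S and M = M and T = T] by (simp add: mm)
      then show False using m by (simp add: mm)
    qed
  qed
  have R: "Rep_bv (Abs_bv (?a k)) = ?a k" for k by (rule Abs_bv_inverse) (simp add: ev)
  show ?thesis
  proof
    show "Rep_bv (Abs_bv (?a k)) m = ?a k m" for k m by (simp add: R)
    show "Rep_bv (Abs_bv (?a k)) m = 0" if "deg m \<noteq> 1" for k m
    proof -
      obtain S M T where mm: "m = (S, M, T)" by (cases m)
      show ?thesis unfolding R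
      proof (rule ccontr)
        assume "?a k m \<noteq> 0"
        then have "card S = 1 \<and> card T = 1" using supp[where k = k and S = S and M = M and T = T] by (simp add: mm)
        then show False using that by (simp add: mm deg_def)
      qed
    qed
    show "Rep_bv (Abs_bv (?a k)) m = 0" if "card (snd (snd m)) \<noteq> 1" for k m
    proof -
      obtain S M T where mm: "m = (S, M, T)" by (cases m)
      show ?thesis unfolding R
      proof (rule ccontr)
        assume "?a k m \<noteq> 0"
        then have "card S = 1 \<and> card T = 1" using supp[where k = k and S = S and M = M and T = T] by (simp add: mm)
        then show False using that by (simp add: mm deg_def)
      qed
    qed
    show "bder L (Abs_bv (?a k)) = 0" if L: "2 \<le> size (filter_mset (\<lambda>B. \<not> isl B) L)" for L k
    proof (rule bv_eqI)
      fix m :: "'n idx"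
      obtain S M T where mm: "m = (S, M, T)" by (cases m)
      \<comment> \<open>The coefficient of the derivative at \<open>M\<close> is a multiple of the
        original coefficient at \<open>M + L\<close>.\<close>
      have "bars (M + L) \<ge> 2" using L by (simp add: bars_def)
      then have "?a k (S, M + L, T) = 0" using supp[where k = k and S = S and M = "M + L" and T = T] by linarith
      then have "ydrs L (?a k) (S, M, T) = 0" using ydrs_nonzero[of L "?a k" S M T] by blast
      then show "Rep_bv (bder L (Abs_bv (?a k))) m = Rep_bv 0 m" by (simp add: Rep_bder R mm Rep_bv_ops(1))
    qed
  qed
qed

section \<open>The graph expansion\<close>

lemma pres_genus:
  assumes p: "pres G vs L ts gs es us"
  shows "(\<Sum>v\<in>gverts G. ggenus G v) = sum_list gs"
proof -
  have "distinct vs" "set vs = gverts G" "map (ggenus G) vs = gs" using p by (auto simp: pres_def)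
  then show ?thesis by (metis sum_list_distinct_conv_sum_set)
qed

lemma pres_subsets:
  assumes "pres G vs L ts gs es us"
  shows "set es \<subseteq> {..<length gs} \<times> {..<length gs}" "set us \<subseteq> {..<length gs}"
  using assms pres_lengths[OF assms] by (auto simp: pres_def)

text \<open>A multiset of size t has t! / (product of the factorials of its multiplicities)
  orderings. The compensating factorials are the t_v! in the Feynman weight.\<close>

lemma sum_lists_multisets:
  fixes f :: "nat multiset \<Rightarrow> complex"
  shows "(\<Sum>X\<in>multisets_of_size {..<s} t. f X)
    = (\<Sum>us\<in>{us. set us \<subseteq> {..<s} \<and> length us = t}. (\<Prod>v<s. fact (count (mset us) v)) / fact t * f (mset us))"
proof -
  let ?U = "{us. set us \<subseteq> {..<s} \<and> length us = t}"
  let ?g = "\<lambda>X. (\<Prod>v<s. fact (count X v)) / fact t * f X"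
  have "(\<Sum>us\<in>?U. ?g (mset us)) = (\<Sum>X\<in>multisets_of_size {..<s} t. \<Sum>us\<in>{us \<in> ?U. mset us = X}. ?g (mset us))"
    by (rule sum.group[symmetric]) (simp_all add: finite_lists_length_eq finite_multisets_of_size, auto simp: multisets_of_size_def)
  also have "\<dots> = (\<Sum>X\<in>multisets_of_size {..<s} t. f X)"
  proof (intro sum.cong refl)
    fix X assume X: "X \<in> multisets_of_size {..<s} t"
    have eq: "{us \<in> ?U. mset us = X} = permutations_of_multiset X"
      using X by (auto simp: permutations_of_multiset_def multisets_of_size_def)
    have "(\<Sum>us\<in>{us \<in> ?U. mset us = X}. ?g (mset us)) = (\<Sum>us\<in>{us \<in> ?U. mset us = X}. ?g X)"
      by (rule sum.cong) auto
    also have "\<dots> = of_nat (card (permutations_of_multiset X)) * ?g X"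
      by (simp only: eq sum_constant)
    also have "(\<Prod>v<s. fact (count X v) :: complex) = of_nat (\<Prod>x\<in>set_mset X. fact (count X x))"
    proof -
      have "(\<Prod>v<s. fact (count X v) :: complex) = (\<Prod>x\<in>set_mset X. fact (count X x))"
        by (rule prod.mono_neutral_right) (use X in \<open>auto simp: multisets_of_size_def not_in_iff\<close>)
      then show ?thesis by simp
    qed
    also have "of_nat (card (permutations_of_multiset X)) * (of_nat (\<Prod>x\<in>set_mset X. fact (count X x)) / fact t * f X)
        = (of_nat (card (permutations_of_multiset X)) * of_nat (\<Prod>x\<in>set_mset X. fact (count X x))) / fact t * f X"
      by (simp only: times_divide_eq_right times_divide_eq_left mult.assoc)
    also have "of_nat (card (permutations_of_multiset X)) * of_nat (\<Prod>x\<in>set_mset X. fact (count X x)) = (fact t :: complex)"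
      using arg_cong[OF card_permutations_of_multiset_aux[of X], of "of_nat :: nat \<Rightarrow> complex"] X
      by (simp add: multisets_of_size_def)
    finally show "(\<Sum>us\<in>{us \<in> ?U. mset us = X}. ?g (mset us)) = f X"
      by simp
  qed
  finally show ?thesis ..
qed

section \<open>Sorting the expansion by isomorphism classes\<close>

context bv_one_form
begin

theorem feynman_weight_two_loops:
  assumes "is_graph G" "connected_graph G" "betti1 G \<ge> 2" "numbering G num"
  shows "feynman_weight w \<gamma> G num m = 0"
proof -
  obtain vs L ts gs es us where p: "pres G vs L ts gs es us" using ex_pres[OF assms(1)] .
  have "length es > length gs" using betti1_connected[OF assms(1) p assms(2)] assms(3) by simp
  then have "gwgt gs es (mset us) = 0" using gwgt_many_edges[OF pres_subsets(1)[OF p]] by simp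
  then show ?thesis using feynman_weight_pres[OF assms(1) p assms(4)] by (simp add: Rep_bv_ops(1))
qed

text \<open>For connected graphs, having at most as many edges as vertices means \<open>b\<^sub>1 \<le> 1\<close>.\<close>

definition contrib :: "'a idx \<Rightarrow> int \<Rightarrow> (nat list \<times> (nat \<times> nat) list \<times> nat list) set" where
  "contrib m n = {(gs, es, us). length gs = deg m \<and> deg m > 0 \<and> es \<in> elists {..<deg m} (deg m) \<and>
     conn {..<deg m} es \<and> set us \<subseteq> {..<deg m} \<and> length us = tdeg m \<and>
     int (sum_list gs) + int (length es) = n + int (deg m) - 1}"

text \<open>The weight of a graph of the given type, divided by the number of its numberings, that
  is, of its vertices, oriented edges and tails.\<close>

definition cweight :: "'a idx \<Rightarrow> nat list \<times> (nat \<times> nat) list \<times> nat list \<Rightarrow> complex" where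
  "cweight m = (\<lambda>(gs, es, us). (\<Prod>v<length gs. fact (count (mset us) v)) * Rep_bv (gwgt gs es (mset us)) m
     / (fact (length gs) * (fact (length es) * 2 ^ length es) * fact (length us)))"

lemma contrib_eq:
  assumes s: "deg m > 0" "n + int (deg m) \<ge> 1"
  defines "N \<equiv> nat (n + int (deg m) - 1)"
  shows "contrib m n = (\<lambda>(es, gs, us). (gs, es, us)) `
    (SIGMA es:{es \<in> elists {..<deg m} (deg m). conn {..<deg m} es \<and> length es \<le> N}.
       glists (deg m) (N - length es) \<times> {us. set us \<subseteq> {..<deg m} \<and> length us = tdeg m})"
proof (intro set_eqI iffI)
  fix x assume x: "x \<in> contrib m n"
  obtain gs es us where x': "x = (gs, es, us)" by (cases x)
  have *: "length gs = deg m" "es \<in> elists {..<deg m} (deg m)" "conn {..<deg m} es" "set us \<subseteq> {..<deg m}" "length us = tdeg m"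
    "int (sum_list gs) + int (length es) = n + int (deg m) - 1" using x by (auto simp: contrib_def x')
  then have "sum_list gs + length es = N" unfolding N_def using s by linarith
  then show "x \<in> (\<lambda>(es, gs, us). (gs, es, us)) `
    (SIGMA es:{es \<in> elists {..<deg m} (deg m). conn {..<deg m} es \<and> length es \<le> N}.
       glists (deg m) (N - length es) \<times> {us. set us \<subseteq> {..<deg m} \<and> length us = tdeg m})"
    unfolding x' using * by (intro image_eqI[of _ _ "(es, gs, us)"]) (auto simp: glists_def)
next
  fix x assume "x \<in> (\<lambda>(es, gs, us). (gs, es, us)) `
    (SIGMA es:{es \<in> elists {..<deg m} (deg m). conn {..<deg m} es \<and> length es \<le> N}.
       glists (deg m) (N - length es) \<times> {us. set us \<subseteq> {..<deg m} \<and> length us = tdeg m})"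
  then obtain gs es us where x: "x = (gs, es, us)" "es \<in> elists {..<deg m} (deg m)" "conn {..<deg m} es" "length es \<le> N"
    "length gs = deg m" "sum_list gs = N - length es" "set us \<subseteq> {..<deg m}" "length us = tdeg m"
    by (auto simp: glists_def)
  then have "int (sum_list gs) + int (length es) = int N" by simp
  also have "\<dots> = n + int (deg m) - 1" using s by (simp add: N_def)
  finally show "x \<in> contrib m n" using x s by (simp add: contrib_def)
qed

text \<open>In the denominator of \<open>cweight\<close>, k! comes from the exponential series, l!
  2^l from the exponential of the propagator over ordered pairs, and t! from listing the
  tails.\<close>

lemma fls_nth_gamma_infinity_contrib:
  "finite (contrib m n)" "fls_nth (gamma_infinity w \<gamma> m) n = (\<Sum>x\<in>contrib m n. cweight m x)"
proof -
  have "finite (contrib m n) \<and> fls_nth (gamma_infinity w \<gamma> m) n = (\<Sum>x\<in>contrib m n. cweight m x)"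
  proof (cases "deg m = 0 \<or> n + int (deg m) < 1")
    case True
    then have "contrib m n = {}" by (auto simp: contrib_def)
    then show ?thesis using True by (simp add: fls_nth_gamma_infinity)
  next
    case False
    let ?s = "deg m" and ?t = "tdeg m"
    define N where "N = nat (n + int ?s - 1)"
    let ?E = "{es \<in> elists {..<?s} ?s. conn {..<?s} es}"
    let ?E' = "{es \<in> elists {..<?s} ?s. conn {..<?s} es \<and> length es \<le> N}"
    let ?U = "{us. set us \<subseteq> {..<?s} \<and> length us = ?t}"
    let ?S = "SIGMA es:?E'. glists ?s (N - length es) \<times> ?U"
    have fE: "finite ?E" by (rule finite_subset[OF _ finite_elists[of "{..<?s}" ?s]]) auto
    have fE': "finite ?E'" by (rule finite_subset[OF _ fE]) auto
    have fU: "finite ?U" by (simp add: finite_lists_length_eq)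
    have fS: "finite ?S" using fE' fU by (intro finite_SigmaI) auto
    have c: "contrib m n = (\<lambda>(es, gs, us). (gs, es, us)) ` ?S"
      unfolding N_def by (rule contrib_eq) (use False in auto)
    have inj: "inj_on (\<lambda>(es, gs, us). (gs, es, us)) ?S" by (auto simp: inj_on_def)
    have "(\<Sum>x\<in>contrib m n. cweight m x) = (\<Sum>y\<in>?S. cweight m (fst (snd y), fst y, snd (snd y)))"
      unfolding c sum.reindex[OF inj] by (simp add: case_prod_unfold comp_def)
    also have "\<dots> = (\<Sum>es\<in>?E'. \<Sum>gs\<in>glists ?s (N - length es). \<Sum>us\<in>?U. cweight m (gs, es, us))"
      using fE' fU by (simp add: sum.cartesian_product sum.Sigma case_prod_unfold)
    also have "\<dots> = (\<Sum>es\<in>?E'. 1 / fact ?s * Rep_bv (fps_nth (term_of {..<?s} es) N) m)"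
    proof (intro sum.cong refl)
      fix es assume es: "es \<in> ?E'"
      have "(\<Sum>gs\<in>glists ?s (N - length es). \<Sum>us\<in>?U. cweight m (gs, es, us))
          = (\<Sum>gs\<in>glists ?s (N - length es). 1 / (fact ?s * (fact (length es) * 2 ^ length es)) * Rep_bv (wgt cst w {..<?s} es (\<lambda>v L. bder L (A (gs ! v)))) m)"
      proof (intro sum.cong refl)
        fix gs assume "gs \<in> glists ?s (N - length es)"
        then have l: "length gs = ?s" by (simp add: glists_def)
        have "(\<Sum>us\<in>?U. cweight m (gs, es, us)) = (\<Sum>us\<in>?U. 1 / (fact ?s * (fact (length es) * 2 ^ length es))
            * ((\<Prod>v<?s. fact (count (mset us) v)) / fact ?t * Rep_bv (gwgt gs es (mset us)) m))"
          by (intro sum.cong refl) (simp add: cweight_def l)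
        also have "\<dots> = 1 / (fact ?s * (fact (length es) * 2 ^ length es)) * (\<Sum>X\<in>multisets_of_size {..<?s} ?t. Rep_bv (gwgt gs es X) m)"
          unfolding sum_lists_multisets by (simp only: sum_distrib_left)
        finally show "(\<Sum>us\<in>?U. cweight m (gs, es, us)) = 1 / (fact ?s * (fact (length es) * 2 ^ length es)) * Rep_bv (wgt cst w {..<?s} es (\<lambda>v L. bder L (A (gs ! v)))) m"
          using wgt_eq_sum_gwgt[of gs es m] by (simp only: l)
      qed
      also have "\<dots> = 1 / fact ?s * Rep_bv (fps_nth (term_of {..<?s} es) N) m"
        using es by (simp add: fps_nth_term_of Rep_cst_mult Rep_bv_sum sum_distrib_left power_one_over)
      finally show "(\<Sum>gs\<in>glists ?s (N - length es). \<Sum>us\<in>?U. cweight m (gs, es, us)) = 1 / fact ?s * Rep_bv (fps_nth (term_of {..<?s} es) N) m" .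
    qed
    also have "\<dots> = (\<Sum>es\<in>?E. 1 / fact ?s * Rep_bv (fps_nth (term_of {..<?s} es) N) m)"
      using fE by (intro sum.mono_neutral_left) (auto simp: fps_nth_term_of Rep_bv_ops(1))
    also have "\<dots> = 1 / fact ?s * Rep_bv (fps_nth (Csum {..<?s}) N) m"
      by (simp add: Csum_def fps_sum_nth Rep_bv_sum sum_distrib_left)
    also have "\<dots> = fls_nth (gamma_infinity w \<gamma> m) n"
      using False by (simp add: fls_nth_gamma_infinity N_def)
    finally show ?thesis using c fS by simp
  qed
  then show "finite (contrib m n)" "fls_nth (gamma_infinity w \<gamma> m) n = (\<Sum>x\<in>contrib m n. cweight m x)" by auto
qed

text \<open>The types are grouped by the representative that realises them. A class contributes its
  number of types times one common weight, and \<open>card_ptypes\<close> turns this into weight /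
  |Aut|.\<close>

theorem gamma_infinity_graph_expansion:
  fixes R :: "(nat, nat) graph set"
  assumes R: "isoclass_representatives {G. is_graph G \<and> connected_graph G \<and> betti1 G \<in> {0, 1}} R"
    and num: "\<And>G. G \<in> R \<Longrightarrow> numbering G (num G)"
  shows "finite {G \<in> R. int (graph_genus G) = n \<and> feynman_weight w \<gamma> G (num G) m \<noteq> 0}"
    and "fls_nth (gamma_infinity w \<gamma> m) n =
      (\<Sum>G\<in>{G \<in> R. int (graph_genus G) = n \<and> feynman_weight w \<gamma> G (num G) m \<noteq> 0}.
        1 / of_nat (num_aut G) * feynman_weight w \<gamma> G (num G) m)"
proof -
  let ?X = "contrib m n"
  define S where "S = {G \<in> R. int (graph_genus G) = n \<and> feynman_weight w \<gamma> G (num G) m \<noteq> 0}"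
  have RC: "is_graph G" "connected_graph G" "betti1 G = 0 \<or> betti1 G = 1" if "G \<in> R" for G
    using R that by (auto simp: isoclass_representatives_def)
  \<comment> \<open>The type is realised by its standard graph, whose class has exactly one member
    in \<open>R\<close>; graphs with a common type are isomorphic.\<close>
  have ex: "\<exists>!G. G \<in> R \<and> x \<in> ptypes G" if x: "x \<in> ?X" for x
  proof -
    obtain gs es us where x': "x = (gs, es, us)" by (cases x)
    have X: "length gs = deg m" "deg m > 0" "set es \<subseteq> {..<length gs} \<times> {..<length gs}" "length es \<le> length gs"
      "conn {..<length gs} es" "set us \<subseteq> {..<length gs}" using x by (auto simp: contrib_def x' elists_def)
    let ?G = "std_graph gs es us"
    note g = std_graph[OF X(3,6)]
    have con: "connected_graph ?G" using pres_connected[OF g] X by simp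
    have "betti1 ?G \<in> {0, 1}" using betti1_connected[OF g con] X(4) by auto
    then have "\<exists>!H. H \<in> R \<and> (\<exists>f \<phi>. is_graph_iso ?G H f \<phi>)"
      using R g(1) con unfolding isoclass_representatives_def by blast
    moreover have "(\<exists>f \<phi>. is_graph_iso ?G H f \<phi>) \<longleftrightarrow> x \<in> ptypes H" if "H \<in> R" for H
    proof
      assume "\<exists>f \<phi>. is_graph_iso ?G H f \<phi>"
      then obtain f \<phi> where "is_graph_iso ?G H f \<phi>" by blast
      from iso_pres[OF g this] show "x \<in> ptypes H" unfolding ptypes_def x' by blast
    next
      assume "x \<in> ptypes H"
      then obtain vs L ts where "pres H vs L ts gs es us" by (auto simp: ptypes_def x')
      from pres_iso[OF g RC(1)[OF that] this] show "\<exists>f \<phi>. is_graph_iso ?G H f \<phi>" by blast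
    qed
    ultimately show ?thesis by (metis (no_types, lifting))
  qed
  define \<rho> where "\<rho> x = (THE G. G \<in> R \<and> x \<in> ptypes G)" for x
  have \<rho>: "\<rho> x \<in> R" "x \<in> ptypes (\<rho> x)" if "x \<in> ?X" for x
    using theI'[OF ex[OF that]] by (auto simp: \<rho>_def)
  have \<rho>_eq: "\<rho> x = G" if "x \<in> ?X" "G \<in> R" "x \<in> ptypes G" for x G
    unfolding \<rho>_def using that by (intro the1_equality[OF ex]) auto
  \<comment> \<open>All types of one graph share their numbers: edges are counted by the Betti
    number, tails by the half-edges that remain, and the total genus is a sum over vertices. The
    fibre over \<open>G\<close> is therefore all of \<open>ptypes G\<close>.\<close>
  have ptypes_contrib: "(gs', es', us') \<in> ?X \<and> length gs' = length gs \<and> length es' = length es \<and> length us' = length us"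
    if G: "G \<in> R" and p: "(gs, es, us) \<in> ptypes G" "(gs, es, us) \<in> ?X" and p': "(gs', es', us') \<in> ptypes G" for G gs es us gs' es' us'
  proof -
    obtain vs L ts where P: "pres G vs L ts gs es us" using p by (auto simp: ptypes_def)
    obtain vs' L' ts' where P': "pres G vs' L' ts' gs' es' us'" using p' by (auto simp: ptypes_def)
    note l = pres_lengths[OF P] pres_lengths[OF P']
    have gs: "length gs' = length gs" using l by simp
    have E: "length es' = length es"
      using betti1_connected[OF RC(1)[OF G] P RC(2)[OF G]] betti1_connected[OF RC(1)[OF G] P' RC(2)[OF G]] gs by simp
    have "length (L @ map (gflip G) L @ ts) = card (ghalfs G)" "length (L' @ map (gflip G) L' @ ts') = card (ghalfs G)"
      using P P' unfolding pres_def by (metis distinct_card)+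
    then have us: "length us' = length us" using l E by simp
    have "sum_list gs' = sum_list gs" using pres_genus[OF P] pres_genus[OF P'] by simp
    moreover have "conn {..<length gs'} es'" using pres_connected[OF RC(1)[OF G] P'] RC(2)[OF G] by simp
    ultimately show ?thesis using p(2) gs E us pres_subsets[OF P'] by (simp add: contrib_def elists_def)
  qed
  have genus: "int (graph_genus G) = int (sum_list gs) + int (length es) + 1 - int (length gs)"
    if "G \<in> R" "pres G vs L ts gs es us" for G vs L ts gs es us
    using betti1_connected[OF RC(1)[OF that(1)] that(2) RC(2)[OF that(1)]] pres_genus[OF that(2)] by (simp add: graph_genus_def)
  have fibre: "(\<Sum>x\<in>{x \<in> ?X. \<rho> x = G}. cweight m x) = 1 / of_nat (num_aut G) * feynman_weight w \<gamma> G (num G) m"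
    if G_in: "G \<in> \<rho> ` ?X" for G
  proof -
    obtain gs es us where x: "(gs, es, us) \<in> ?X" "G = \<rho> (gs, es, us)" using G_in unfolding image_iff by (metis prod_cases3)
    have G: "G \<in> R" "(gs, es, us) \<in> ptypes G" using \<rho>[OF x(1)] x(2) by auto
    obtain vs L ts where P: "pres G vs L ts gs es us" using G by (auto simp: ptypes_def)
    let ?c = "fact (length gs) * (fact (length es) * 2 ^ length es) * fact (length us) :: complex"
    let ?W = "feynman_weight w \<gamma> G (num G) m"
    have eq: "{x \<in> ?X. \<rho> x = G} = ptypes G"
    proof (intro set_eqI iffI)
      fix y assume "y \<in> ptypes G"
      then show "y \<in> {x \<in> ?X. \<rho> x = G}" using ptypes_contrib[OF G x(1)] \<rho>_eq G(1) by (cases y) blast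
    qed (use \<rho> in auto)
    have "cweight m y = ?W / ?c" if y: "y \<in> ptypes G" for y
    proof -
      obtain gs' es' us' where y': "y = (gs', es', us')" by (cases y)
      then obtain vs' L' ts' where P': "pres G vs' L' ts' gs' es' us'" using y by (auto simp: ptypes_def)
      have l: "length gs' = length gs" "length es' = length es" "length us' = length us"
        using ptypes_contrib[OF G x(1)] y y' by blast+
      show ?thesis
        using feynman_weight_pres[OF RC(1)[OF G(1)] P' num[OF G(1)], of m] by (simp add: y' cweight_def l)
    qed
    then have sum: "(\<Sum>x\<in>{x \<in> ?X. \<rho> x = G}. cweight m x) = of_nat (card (ptypes G)) * (?W / ?c)"
      unfolding eq by simp
    have c: "?c = of_nat (card (ptypes G)) * of_nat (num_aut G)"
      using arg_cong[OF card_ptypes(2)[OF RC(1)[OF G(1)] P], of "of_nat :: nat \<Rightarrow> complex"] by simp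
    moreover have "?c \<noteq> 0" by simp
    ultimately have "of_nat (card (ptypes G)) \<noteq> (0 :: complex)" by (metis mult_zero_left)
    then show ?thesis unfolding sum c by simp
  qed
  have fin: "finite ?X" by (rule fls_nth_gamma_infinity_contrib(1))
  \<comment> \<open>A nonzero weight at \<open>m\<close> forces \<open>deg m\<close> vertices and
    \<open>tdeg m\<close> tails, and the genus then fixes the power of hbar.\<close>
  have sub: "S \<subseteq> \<rho> ` ?X"
  proof
    fix G assume "G \<in> S"
    then have G: "G \<in> R" "int (graph_genus G) = n" "feynman_weight w \<gamma> G (num G) m \<noteq> 0" by (auto simp: S_def)
    obtain vs L ts gs es us where P: "pres G vs L ts gs es us" using ex_pres[OF RC(1)[OF G(1)]] .
    have W: "Rep_bv (gwgt gs es (mset us)) m \<noteq> 0"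
      using feynman_weight_pres[OF RC(1)[OF G(1)] P num[OF G(1)], of m] G(3) by auto
    have s: "deg m = length gs" using gwgt_supp(1)[OF W] .
    have t: "tdeg m = length us"
      using gwgt_supp(2)[OF W, of "length us"] pres_subsets(2)[OF P] by (simp add: multisets_of_size_def)
    have con: "length gs > 0" "conn {..<length gs} es" using pres_connected[OF RC(1)[OF G(1)] P] RC(2)[OF G(1)] by auto
    have "length es \<le> length gs"
      using betti1_connected[OF RC(1)[OF G(1)] P RC(2)[OF G(1)]] RC(3)[OF G(1)] by auto
    moreover have "int (sum_list gs) + int (length es) = n + int (length gs) - 1"
      using genus[OF G(1) P] G(2) by simp
    ultimately have x: "(gs, es, us) \<in> ?X" using s t con pres_subsets[OF P] by (simp add: contrib_def elists_def)
    moreover have "(gs, es, us) \<in> ptypes G" using P by (auto simp: ptypes_def)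
    ultimately show "G \<in> \<rho> ` ?X" using \<rho>_eq G(1) by (intro image_eqI[of _ _ "(gs, es, us)"]) auto
  qed
  have "fls_nth (gamma_infinity w \<gamma> m) n = (\<Sum>G\<in>\<rho> ` ?X. \<Sum>x\<in>{x \<in> ?X. \<rho> x = G}. cweight m x)"
    unfolding fls_nth_gamma_infinity_contrib(2) by (rule sum.group[symmetric]) (use fin in auto)
  also have "\<dots> = (\<Sum>G\<in>\<rho> ` ?X. 1 / of_nat (num_aut G) * feynman_weight w \<gamma> G (num G) m)"
    by (rule sum.cong[OF refl fibre])
  also have "\<dots> = (\<Sum>G\<in>S. 1 / of_nat (num_aut G) * feynman_weight w \<gamma> G (num G) m)"
  proof (rule sum.mono_neutral_right)
    show "finite (\<rho> ` ?X)" using fin by simp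
    show "S \<subseteq> \<rho> ` ?X" by (rule sub)
    \<comment> \<open>Every type in \<open>contrib m n\<close> has genus \<open>n\<close>, so a
      graph of the image outside \<open>S\<close> can only be missing because its weight at
      \<open>m\<close> is 0.\<close>
    show "\<forall>G\<in>\<rho> ` ?X - S. 1 / of_nat (num_aut G) * feynman_weight w \<gamma> G (num G) m = 0"
    proof
      fix G assume G: "G \<in> \<rho> ` ?X - S"
      then obtain gs es us where x: "(gs, es, us) \<in> ?X" "G = \<rho> (gs, es, us)" "G \<notin> S" unfolding image_iff Diff_iff by (metis prod_cases3)
      have GR: "G \<in> R" "(gs, es, us) \<in> ptypes G" using \<rho>[OF x(1)] x(2) by auto
      then obtain vs L ts where P: "pres G vs L ts gs es us" by (auto simp: ptypes_def)
      have "int (graph_genus G) = n" using genus[OF GR(1) P] x(1) by (simp add: contrib_def)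
      then show "1 / of_nat (num_aut G) * feynman_weight w \<gamma> G (num G) m = 0" using G GR(1) by (auto simp: S_def)
    qed
  qed
  finally show "fls_nth (gamma_infinity w \<gamma> m) n =
      (\<Sum>G\<in>{G \<in> R. int (graph_genus G) = n \<and> feynman_weight w \<gamma> G (num G) m \<noteq> 0}.
        1 / of_nat (num_aut G) * feynman_weight w \<gamma> G (num G) m)" by (simp only: S_def)
  show "finite {G \<in> R. int (graph_genus G) = n \<and> feynman_weight w \<gamma> G (num G) m \<noteq> 0}"
    using finite_subset[OF sub] fin by (simp add: S_def)
qed

end

text \<open>Both claims are fibrewise: at the point \<open>z\<close> they follow from the algebra of
  \<open>bv_one_form\<close>, whose support conditions carry the Kaehler geometry of the
  chart.\<close>

theorem theorem1p2:
  fixes X :: "'x topology"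
    and A :: "('x, 'n::{finite,linorder}) chart set"
    and g :: "('x, 'n) chart \<Rightarrow> 'n cvec \<Rightarrow> 'n cmat"
    and \<alpha> :: "('x, 'n) chart \<Rightarrow> nat \<Rightarrow> 'n cvec \<Rightarrow> 'n cmat"
    and f :: "nat \<Rightarrow> 'n cvec \<Rightarrow> complex"
  assumes "kaehler_manifold X A g"
    and "closed_formal_form11 A \<alpha>"
    and "c \<in> A"
    and "N \<subseteq> chart_image c" and "local_potential (\<alpha> c) N f"
    and "z \<in> N"
  shows "(\<forall>(G :: ('v, 'h) graph) num m.
            is_graph G \<and> connected_graph G \<and> betti1 G \<ge> 2 \<and> numbering G num \<longrightarrow>
            feynman_weight (kform (g c) z) (gamma (g c) f z) G num m = 0)
       \<and> (\<forall>(R :: (nat, nat) graph set) num m (n :: int).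
            isoclass_representatives
              {G. is_graph G \<and> connected_graph G \<and> betti1 G \<in> {0, 1}} R \<and>
            (\<forall>G\<in>R. numbering G (num G)) \<longrightarrow>
            finite {G \<in> R. int (graph_genus G) = n \<and>
              feynman_weight (kform (g c) z) (gamma (g c) f z) G (num G) m \<noteq> 0} \<and>
            fls_nth (gamma_infinity (kform (g c) z) (gamma (g c) f z) m) n =
              (\<Sum>G\<in>{G \<in> R. int (graph_genus G) = n \<and>
                  feynman_weight (kform (g c) z) (gamma (g c) f z) G (num G) m \<noteq> 0}.
                1 / of_nat (num_aut G) *
                feynman_weight (kform (g c) z) (gamma (g c) f z) G (num G) m))"
proof -
  have "open (chart_image c)" using assms(1,3) by (auto simp: kaehler_manifold_def complex_manifold_def)
  then have bv: "bv_one_form (gamma (g c) f z) (\<lambda>k. Abs_bv (\<lambda>m. fps_nth (dTX (gamma (g c) f z) m) k))"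
    using christoffel_mixed[OF assms(1,3)] assms(4,6) by (intro bv_one_form_gamma[of "chart_image c"]) auto
  show ?thesis
  proof (intro conjI allI impI; elim conjE)
    fix G :: "('v, 'h) graph" and num m
    assume "is_graph G" "connected_graph G" "betti1 G \<ge> 2" "numbering G num"
    then show "feynman_weight (kform (g c) z) (gamma (g c) f z) G num m = 0"
      by (rule bv_one_form.feynman_weight_two_loops[OF bv])
  next
    fix R :: "(nat, nat) graph set" and num :: "(nat, nat) graph \<Rightarrow> nat \<Rightarrow> nat" and m and n :: int
    let ?W = "\<lambda>G. feynman_weight (kform (g c) z) (gamma (g c) f z) G (num G) m"
    assume R: "isoclass_representatives {G. is_graph G \<and> connected_graph G \<and> betti1 G \<in> {0, 1}} R"
      "\<forall>G\<in>R. numbering G (num G)"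
    then show "finite {G \<in> R. int (graph_genus G) = n \<and> ?W G \<noteq> 0}"
      by (intro bv_one_form.gamma_infinity_graph_expansion(1)[OF bv]) auto
    from R show "fls_nth (gamma_infinity (kform (g c) z) (gamma (g c) f z) m) n =
        (\<Sum>G\<in>{G \<in> R. int (graph_genus G) = n \<and> ?W G \<noteq> 0}. 1 / of_nat (num_aut G) * ?W G)"
      by (intro bv_one_form.gamma_infinity_graph_expansion(2)[OF bv]) auto
  qed
qed


end
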